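(* Let $(\mathcal M,h)$ be a Riemannian manifold equipped with an infinitesimal homothety $W$, that is, $\mathcal L_W h=\sigma h$ with $\sigma$ a constant. Let $F$ denote the Randers metric solving Zermelo's problem of navigation for $(h,W)$ on $M:=\{|W|<1\}\subset\mathcal M$. Then the unit speed geodesics $\mathscr P:(-\varepsilon,\varepsilon)\to M$ of $F$ are given (shrinking $\varepsilon>0$ if necessary) by $$\mathscr P(t)=\varphi(t,\rho(t)),$$ where (i) $\rho:(-\varepsilon,\varepsilon)\to\mathcal M$ is a geodesic of $h$ parameterized so that $|\dot\rho(t)|^2=e^{-\sigma t}$; (ii) shrinking $\varepsilon$ if necessary, $\varphi:(-\varepsilon,\varepsilon)\times U\to M$ is the flow of $W$ defined on a neighborhood $U$ of $\rho(0)$ such that $\rho(t)\in U$ for all $t\in(-\varepsilon,\varepsilon)$.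
   Context: Notation: $|y|^2=h(y,y)$; $\mathcal L$ is the Lie derivative. For a vector field $W$ on a Riemannian manifold $(\mathcal M,h)$, the Randers metric solving Zermelo's problem of navigation for $(h,W)$ is the Finsler metric defined on $\{|W|<1\}$ by $$F(x,y)=\frac{\sqrt{\lambda|y|^2+W_0^2}}{\lambda}-\frac{W_0}{\lambda},\qquad \lambda=1-|W|^2,\quad W_0=h(W,y),\quad y\in T_xM.$$ A geodesic of $h$ here means a curve whose constant-speed reparameterization satisfies the usual geodesic equation; equivalently, in local coordinates, $\ddot\rho^i+\gamma^i{}_{jk}(\rho)\dot\rho^j\dot\rho^k=\frac{d}{dt}(\ln|\dot\rho|)\,\dot\rho^i$, with $\gamma^i{}_{jk}$ the Christoffel symbols of $h$. A unit speed geodesic of $F$ is a curve $\mathscr P$ with $F(\dot{\mathscr P})=1$ satisfying the Finsler geodesic equation $\ddot{\mathscr P}^i+2G^i(\mathscr P,\dot{\mathscr P})=0$. Here $G^i$ are the geodesic spray coefficients of $F$: $G^i=\frac14 g^{il}\big((F^2)_{x^k y^l}y^k-(F^2)_{x^l}\big)$ with $g_{ij}=(\frac12F^2)_{y^iy^j}$ and $(g^{ij})$ its inverse. The flow $\varphi$ of $W$ satisfies $\partial_t\varphi(t,x)=W_{\varphi(t,x)}$, $\varphi(0,x)=x$. *)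

theory Defs
  imports "HOL-Analysis.Analysis"
begin

section \<open>Smooth maps between open subsets of normed spaces\<close>

text \<open>The following notions are meant for open sets S only.\<close>

primrec Ck_on :: "nat \<Rightarrow> ('a::real_normed_vector \<Rightarrow> 'b::real_normed_vector) \<Rightarrow> 'a set \<Rightarrow> bool" where
  "Ck_on 0 f S \<longleftrightarrow> continuous_on S f"
| "Ck_on (Suc k) f S \<longleftrightarrow>
     (\<forall>x\<in>S. f differentiable (at x)) \<and> (\<forall>v. Ck_on k (\<lambda>x. frechet_derivative f (at x) v) S)"

definition smooth_on :: "('a::real_normed_vector \<Rightarrow> 'b::real_normed_vector) \<Rightarrow> 'a set \<Rightarrow> bool" where
  "smooth_on f S \<longleftrightarrow> (\<forall>k. Ck_on k f S)"

definition partial :: "'n \<Rightarrow> (real ^ 'n::finite \<Rightarrow> real) \<Rightarrow> real ^ 'n \<Rightarrow> real" where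
  "partial i f x = deriv (\<lambda>s. f (x + s *\<^sub>R axis i 1)) 0"


section \<open>Smooth manifolds\<close>

text \<open>
  A manifold is given by a smooth atlas; its underlying set is the union of the chart domains,
  an open subset of a Hausdorff, second countable space. The atlas need not be maximal.
\<close>

record ('m, 'n) chart =
  cdom :: "'m set"
  cmap :: "'m \<Rightarrow> real ^ 'n"

definition cimg :: "('m, 'n::finite) chart \<Rightarrow> (real ^ 'n) set" where
  "cimg c = cmap c ` cdom c"

definition cinv :: "('m, 'n::finite) chart \<Rightarrow> real ^ 'n \<Rightarrow> 'm" where
  "cinv c = inv_into (cdom c) (cmap c)"

definition is_chart :: "('m::topological_space, 'n::finite) chart \<Rightarrow> bool" where
  "is_chart c \<longleftrightarrow> open (cdom c) \<and> open (cimg c) \<and> homeomorphism (cdom c) (cimg c) (cmap c) (cinv c)"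

definition transition :: "('m, 'n::finite) chart \<Rightarrow> ('m, 'n) chart \<Rightarrow> real ^ 'n \<Rightarrow> real ^ 'n" where
  "transition c d = cmap d \<circ> cinv c"

definition smooth_atlas ::
  "('m::{t2_space, second_countable_topology}, 'n::finite) chart set \<Rightarrow> bool" where
  "smooth_atlas A \<longleftrightarrow>
     (\<forall>c\<in>A. is_chart c) \<and>
     (\<forall>c\<in>A. \<forall>d\<in>A. smooth_on (transition c d) (cmap c ` (cdom c \<inter> cdom d)))"

definition carrier :: "('m, 'n::finite) chart set \<Rightarrow> 'm set" where
  "carrier A = (\<Union>c\<in>A. cdom c)"


section \<open>Tangent vectors and tensor fields\<close>

text \<open>
  A tangent vector at p is the family of its components with respect to all charts around p,
  related by the Jacobians of the transition maps. It is set to 0 at all irrelevant charts,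
  so that equality of functions is equality of tangent vectors.
\<close>

type_synonym ('m, 'n) tangent = "('m, 'n) chart \<Rightarrow> real ^ 'n"

definition tangent_space :: "('m, 'n::finite) chart set \<Rightarrow> 'm \<Rightarrow> ('m, 'n) tangent set" where
  "tangent_space A p = {v.
     (\<forall>c. \<not> (c \<in> A \<and> p \<in> cdom c) \<longrightarrow> v c = 0) \<and>
     (\<forall>c\<in>A. \<forall>d\<in>A. p \<in> cdom c \<inter> cdom d \<longrightarrow>
        v d = frechet_derivative (transition c d) (at (cmap c p)) (v c))}"

text \<open>The tangent vector at p whose component vector in the chart c is y.\<close>

definition tangent_of ::
  "('m, 'n::finite) chart set \<Rightarrow> ('m, 'n) chart \<Rightarrow> 'm \<Rightarrow> real ^ 'n \<Rightarrow> ('m, 'n) tangent" where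
  "tangent_of A c p y = (\<lambda>d. if d \<in> A \<and> p \<in> cdom d
     then frechet_derivative (transition c d) (at (cmap c p)) y else 0)"

text \<open>A metric assigns to each point p a bilinear form on the tangent space at p.\<close>

type_synonym ('m, 'n) metric = "'m \<Rightarrow> ('m, 'n) tangent \<Rightarrow> ('m, 'n) tangent \<Rightarrow> real"

definition metric_comp ::
  "('m, 'n::finite) chart set \<Rightarrow> ('m, 'n) metric \<Rightarrow> ('m, 'n) chart \<Rightarrow> 'n \<Rightarrow> 'n \<Rightarrow> real ^ 'n \<Rightarrow> real" where
  "metric_comp A h c i j x =
     h (cinv c x) (tangent_of A c (cinv c x) (axis i 1)) (tangent_of A c (cinv c x) (axis j 1))"

definition riemannian_metric :: "('m, 'n::finite) chart set \<Rightarrow> ('m, 'n) metric \<Rightarrow> bool" where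
  "riemannian_metric A h \<longleftrightarrow>
     (\<forall>p\<in>carrier A. \<forall>u\<in>tangent_space A p.
        (\<forall>v\<in>tangent_space A p. h p u v = h p v u) \<and>
        (\<forall>v\<in>tangent_space A p. \<forall>w\<in>tangent_space A p. \<forall>a.
           h p (\<lambda>c. a *\<^sub>R u c + v c) w = a * h p u w + h p v w) \<and>
        (u \<noteq> (\<lambda>c. 0) \<longrightarrow> h p u u > 0)) \<and>
     (\<forall>c\<in>A. \<forall>i j. smooth_on (metric_comp A h c i j) (cimg c))"

definition hnorm :: "('m, 'n::finite) metric \<Rightarrow> 'm \<Rightarrow> ('m, 'n) tangent \<Rightarrow> real" where
  "hnorm h p y = sqrt (h p y y)"

definition field_comp :: "('m \<Rightarrow> ('m, 'n::finite) tangent) \<Rightarrow> ('m, 'n) chart \<Rightarrow> real ^ 'n \<Rightarrow> real ^ 'n" where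
  "field_comp W c x = W (cinv c x) c"

definition smooth_vector_field ::
  "('m, 'n::finite) chart set \<Rightarrow> ('m \<Rightarrow> ('m, 'n) tangent) \<Rightarrow> bool" where
  "smooth_vector_field A W \<longleftrightarrow>
     (\<forall>p\<in>carrier A. W p \<in> tangent_space A p) \<and> (\<forall>c\<in>A. smooth_on (field_comp W c) (cimg c))"

text \<open>The (i, j) component in the chart c of the Lie derivative of h along W.\<close>

definition lie_derivative_comp ::
  "('m, 'n::finite) chart set \<Rightarrow> ('m \<Rightarrow> ('m, 'n) tangent) \<Rightarrow> ('m, 'n) metric \<Rightarrow>
     ('m, 'n) chart \<Rightarrow> 'n \<Rightarrow> 'n \<Rightarrow> real ^ 'n \<Rightarrow> real" where
  "lie_derivative_comp A W h c i j x =
     (\<Sum>k\<in>UNIV. field_comp W c x $ k * partial k (metric_comp A h c i j) x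
        + metric_comp A h c k j x * partial i (\<lambda>z. field_comp W c z $ k) x
        + metric_comp A h c i k x * partial j (\<lambda>z. field_comp W c z $ k) x)"

definition infinitesimal_homothety ::
  "('m, 'n::finite) chart set \<Rightarrow> ('m, 'n) metric \<Rightarrow> ('m \<Rightarrow> ('m, 'n) tangent) \<Rightarrow> real \<Rightarrow> bool" where
  "infinitesimal_homothety A h W \<sigma> \<longleftrightarrow>
     smooth_vector_field A W \<and>
     (\<forall>c\<in>A. \<forall>x\<in>cimg c. \<forall>i j. lie_derivative_comp A W h c i j x = \<sigma> * metric_comp A h c i j x)"


section \<open>Curves and geodesics of a Riemannian metric\<close>

text \<open>Curves are defined on open intervals I.\<close>

definition C2_curve ::
  "('m::topological_space, 'n::finite) chart set \<Rightarrow> real set \<Rightarrow> (real \<Rightarrow> 'm) \<Rightarrow> bool" where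
  "C2_curve A I r \<longleftrightarrow> r ` I \<subseteq> carrier A \<and> continuous_on I r \<and>
     (\<forall>c\<in>A. Ck_on 2 (\<lambda>t. cmap c (r t)) {t \<in> I. r t \<in> cdom c})"

definition coord_vel :: "('m, 'n::finite) chart \<Rightarrow> (real \<Rightarrow> 'm) \<Rightarrow> real \<Rightarrow> real ^ 'n" where
  "coord_vel c r t = vector_derivative (\<lambda>s. cmap c (r s)) (at t)"

definition coord_acc :: "('m, 'n::finite) chart \<Rightarrow> (real \<Rightarrow> 'm) \<Rightarrow> real \<Rightarrow> real ^ 'n" where
  "coord_acc c r t = vector_derivative (coord_vel c r) (at t)"

definition velocity ::
  "('m, 'n::finite) chart set \<Rightarrow> (real \<Rightarrow> 'm) \<Rightarrow> real \<Rightarrow> ('m, 'n) tangent" where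
  "velocity A r t = (\<lambda>c. if c \<in> A \<and> r t \<in> cdom c then coord_vel c r t else 0)"

definition christoffel ::
  "('m, 'n::finite) chart set \<Rightarrow> ('m, 'n) metric \<Rightarrow> ('m, 'n) chart \<Rightarrow>
     'n \<Rightarrow> 'n \<Rightarrow> 'n \<Rightarrow> real ^ 'n \<Rightarrow> real" where
  "christoffel A h c i j k x =
     (1/2) * (\<Sum>l\<in>UNIV. matrix_inv (\<chi> a b. metric_comp A h c a b x) $ i $ l *
        (partial j (metric_comp A h c l k) x + partial k (metric_comp A h c l j) x
           - partial l (metric_comp A h c j k) x))"

text \<open>
  A geodesic of h is a regular curve satisfying the geodesic equation in arbitrary
  parameterization; the right-hand side of the equation vanishes at constant speed.
\<close>

definition geodesic ::
  "('m::topological_space, 'n::finite) chart set \<Rightarrow> ('m, 'n) metric \<Rightarrow> real set \<Rightarrow> (real \<Rightarrow> 'm) \<Rightarrow> bool"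
  where
  "geodesic A h I r \<longleftrightarrow> C2_curve A I r \<and>
     (\<forall>t\<in>I. velocity A r t \<noteq> (\<lambda>c. 0)) \<and>
     (\<forall>t\<in>I. \<forall>c\<in>A. r t \<in> cdom c \<longrightarrow> (\<forall>i.
        coord_acc c r t $ i
          + (\<Sum>j\<in>UNIV. \<Sum>k\<in>UNIV. christoffel A h c i j k (cmap c (r t))
               * coord_vel c r t $ j * coord_vel c r t $ k)
        = deriv (\<lambda>s. ln (hnorm h (r s) (velocity A r s))) t * coord_vel c r t $ i))"


section \<open>Finsler metrics and the navigation problem\<close>

type_synonym ('m, 'n) finsler = "'m \<Rightarrow> ('m, 'n) tangent \<Rightarrow> real"

definition finsler_sq_loc ::
  "('m, 'n::finite) chart set \<Rightarrow> ('m, 'n) finsler \<Rightarrow> ('m, 'n) chart \<Rightarrow> real ^ 'n \<Rightarrow> real ^ 'n \<Rightarrow> real" where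
  "finsler_sq_loc A F c x y = (F (cinv c x) (tangent_of A c (cinv c x) y))\<^sup>2"

definition fundamental_tensor ::
  "('m, 'n::finite) chart set \<Rightarrow> ('m, 'n) finsler \<Rightarrow> ('m, 'n) chart \<Rightarrow>
     real ^ 'n \<Rightarrow> real ^ 'n \<Rightarrow> real ^ 'n ^ 'n" where
  "fundamental_tensor A F c x y =
     (\<chi> i j. partial j (partial i (\<lambda>u. (1/2) * finsler_sq_loc A F c x u)) y)"

definition spray_coeff ::
  "('m, 'n::finite) chart set \<Rightarrow> ('m, 'n) finsler \<Rightarrow> ('m, 'n) chart \<Rightarrow>
     'n \<Rightarrow> real ^ 'n \<Rightarrow> real ^ 'n \<Rightarrow> real" where
  "spray_coeff A F c i x y =
     (1/4) * (\<Sum>l\<in>UNIV. matrix_inv (fundamental_tensor A F c x y) $ i $ l *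
        ((\<Sum>k\<in>UNIV. partial l (\<lambda>u. partial k (\<lambda>z. finsler_sq_loc A F c z u) x) y * y $ k)
           - partial l (\<lambda>z. finsler_sq_loc A F c z y) x))"

text \<open>N is the open subset of the manifold on which F is a Finsler metric.\<close>

definition unit_speed_finsler_geodesic ::
  "('m::topological_space, 'n::finite) chart set \<Rightarrow> 'm set \<Rightarrow> ('m, 'n) finsler \<Rightarrow>
     real set \<Rightarrow> (real \<Rightarrow> 'm) \<Rightarrow> bool" where
  "unit_speed_finsler_geodesic A N F I P \<longleftrightarrow> C2_curve A I P \<and> P ` I \<subseteq> N \<and>
     (\<forall>t\<in>I. F (P t) (velocity A P t) = 1) \<and>
     (\<forall>t\<in>I. \<forall>c\<in>A. P t \<in> cdom c \<longrightarrow> (\<forall>i.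
        coord_acc c P t $ i + 2 * spray_coeff A F c i (cmap c (P t)) (coord_vel c P t) = 0))"

definition navigation_domain ::
  "('m, 'n::finite) chart set \<Rightarrow> ('m, 'n) metric \<Rightarrow> ('m \<Rightarrow> ('m, 'n) tangent) \<Rightarrow> 'm set" where
  "navigation_domain A h W = {p \<in> carrier A. hnorm h p (W p) < 1}"

definition randers ::
  "('m, 'n::finite) metric \<Rightarrow> ('m \<Rightarrow> ('m, 'n) tangent) \<Rightarrow> ('m, 'n) finsler" where
  "randers h W p y =
     (let l = 1 - (hnorm h p (W p))\<^sup>2; w = h p (W p) y
      in sqrt (l * (hnorm h p y)\<^sup>2 + w\<^sup>2) / l - w / l)"


section \<open>Flows\<close>

text \<open>
  \<open>\<phi>\<close> restricts to a map from T \<times> U to N and is the flow of W there, T being an open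
  interval around 0. The chartwise differential equation is meaningful only along continuous
  curves, so continuity in time is required explicitly.
\<close>

definition is_flow ::
  "('m::topological_space, 'n::finite) chart set \<Rightarrow> ('m \<Rightarrow> ('m, 'n) tangent) \<Rightarrow>
     real set \<Rightarrow> 'm set \<Rightarrow> 'm set \<Rightarrow> (real \<Rightarrow> 'm \<Rightarrow> 'm) \<Rightarrow> bool" where
  "is_flow A W T U N \<phi> \<longleftrightarrow> (\<forall>x\<in>U. \<phi> 0 x = x \<and>
     (\<forall>t\<in>T. \<phi> t x \<in> N) \<and> continuous_on T (\<lambda>t. \<phi> t x) \<and>
     (\<forall>t\<in>T. \<forall>c\<in>A. \<phi> t x \<in> cdom c \<longrightarrow>
        ((\<lambda>s. cmap c (\<phi> s x)) has_vector_derivative W (\<phi> t x) c) (at t)))"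

end

theory Submission
  imports Defs
begin

text \<open>
  The idea is to work on the tangent bundle of a chart, where both kinds of geodesics are
  integral curves of vector fields, and where a homothety says that these fields commute.

  Write a unit speed curve of the Randers metric as $P' = v + W$; navigation means $h(v,v) = 1$.
  Let $X(x,y) = (W, DW\,y)$ be the complete lift of $W$, whose flow is the differential of the flow
  of $W$, and let $Y(x,y) = (y, -\Gamma(y,y) - \frac{\sigma}{2} y)$, whose integral curves are the
  geodesics of $h$ parameterized so that $h(y,y)$ decays like $e^{-\sigma t}$. There are two
  computations. First, the Euler-Lagrange equation of $F^2/2$ along a curve with $F = 1$ says
  exactly that $(P, v)$ is an integral curve of $X + Y$ (\<open>unit_spray_iff\<close>); here $F$ is
  differentiated implicitly through $h(y - F W, y - F W) = F^2$, and the spray coefficients make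
  sense because the fundamental tensor is positive definite. Second, differentiating the equation
  $\mathcal L_W h = \sigma h$ once gives $[X, Y] = 0$ (\<open>lift_spray_commute\<close>).

  For commuting fields, moving an integral curve of $Y + kX$ at the parameter $t$ along the flow of
  $X$ for the time $\beta_0 + \beta (t - t_0)$ yields an integral curve of $Y + (k + \beta) X$
  (\<open>flow_of_integral_curve\<close>). With $k = 0$, $\beta = 1$ this turns geodesics of $h$ into geodesics
  of $F$, and with $k = 1$, $\beta = -1$ it goes back; on base points the flow of $X$ is the flow
  of $W$. Along $X$ the quantity $h(y,y)$ grows like $e^{\sigma s}$, which gives the stated speed.
  The commutation lemma is a Gronwall estimate for the difference quotient of the moved curve, which
  rests on Picard's theorem and on the Lipschitz dependence of solutions on their initial values.

  All this is local in one chart (\<open>germ_transport\<close>). A prescribed flow on a long time interval crosses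
  many charts; there one moves along the flow in small steps, showing by connectedness of the
  time interval that $t \mapsto \varphi(s, \rho(t))$ is, for every $s$, near a given $t_0$ a geodesic
  of $h$ whose velocity has the square length $e^{\sigma (s - t)}$. Between steps the chart is
  changed, by the transformation law of the Christoffel symbols.
\<close>

section \<open>Second derivatives and partial derivatives\<close>

abbreviation D :: "('a::real_normed_vector \<Rightarrow> 'b::real_normed_vector) \<Rightarrow> 'a \<Rightarrow> 'a \<Rightarrow> 'b" where
  "D f x \<equiv> frechet_derivative f (at x)"

text \<open>
  The mean value theorem, applied first in the direction $u$ and then in the direction $v$. Exchanging
  the directions leaves the left-hand side unchanged, whence the symmetry of second derivatives.
\<close>

lemma mixed_difference_eq_second_derivative:
  fixes f :: "'a::real_normed_vector \<Rightarrow> real"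
  assumes f': "\<And>y. y \<in> S \<Longrightarrow> (f has_derivative f' y) (at y)"
    and f'': "\<And>y u. y \<in> S \<Longrightarrow> ((\<lambda>z. f' z u) has_derivative f'' y u) (at y)"
    and k: "0 < k"
    and S: "\<And>s t. \<lbrakk>0 \<le> s; s \<le> k; 0 \<le> t; t \<le> k\<rbrakk> \<Longrightarrow> x + s *\<^sub>R u + t *\<^sub>R v \<in> S"
  obtains s t where "0 \<le> s" "s \<le> k" "0 \<le> t" "t \<le> k"
    "f (x + k *\<^sub>R u + k *\<^sub>R v) - f (x + k *\<^sub>R u) - f (x + k *\<^sub>R v) + f x
       = k * k * f'' (x + s *\<^sub>R u + t *\<^sub>R v) u v"
proof -
  define \<phi> where "\<phi> s = f (x + s *\<^sub>R u + k *\<^sub>R v) - f (x + s *\<^sub>R u + 0 *\<^sub>R v)" for s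
  have d1: "((\<lambda>s. f (x + s *\<^sub>R u + t *\<^sub>R v)) has_real_derivative f' (x + s *\<^sub>R u + t *\<^sub>R v) u) (at s)"
    if "0 \<le> s" "s \<le> k" "0 \<le> t" "t \<le> k" for s t
  proof -
    have "((\<lambda>s. x + s *\<^sub>R u + t *\<^sub>R v) has_derivative (\<lambda>h. h *\<^sub>R u)) (at s)"
      by (auto intro!: derivative_eq_intros)
    from has_derivative_compose[OF this f'[OF S[OF that]]]
    have "((\<lambda>s. f (x + s *\<^sub>R u + t *\<^sub>R v)) has_derivative (\<lambda>h. f' (x + s *\<^sub>R u + t *\<^sub>R v) (h *\<^sub>R u))) (at s)" .
    moreover have "linear (f' (x + s *\<^sub>R u + t *\<^sub>R v))"
      using f'[OF S[OF that]] has_derivative_linear by blast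
    ultimately show ?thesis
      by (simp add: has_field_derivative_def linear_cmul mult.commute cong: if_cong)
        (simp add: linear_cmul mult_commute_abs)
  qed
  have d2: "((\<lambda>t. f' (x + s *\<^sub>R u + t *\<^sub>R v) u) has_real_derivative f'' (x + s *\<^sub>R u + t *\<^sub>R v) u v) (at t)"
    if "0 \<le> s" "s \<le> k" "0 \<le> t" "t \<le> k" for s t
  proof -
    have "((\<lambda>t. x + s *\<^sub>R u + t *\<^sub>R v) has_derivative (\<lambda>h. h *\<^sub>R v)) (at t)"
      by (auto intro!: derivative_eq_intros)
    from has_derivative_compose[OF this f''[OF S[OF that]]]
    have "((\<lambda>t. f' (x + s *\<^sub>R u + t *\<^sub>R v) u) has_derivative
       (\<lambda>h. f'' (x + s *\<^sub>R u + t *\<^sub>R v) u (h *\<^sub>R v))) (at t)" .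
    moreover have "linear (f'' (x + s *\<^sub>R u + t *\<^sub>R v) u)"
      using f''[OF S[OF that]] has_derivative_linear by blast
    ultimately show ?thesis
      by (simp add: has_field_derivative_def linear_cmul mult_commute_abs)
  qed
  have "\<exists>s>0. s < k \<and> \<phi> k - \<phi> 0 = (k - 0) * (f' (x + s *\<^sub>R u + k *\<^sub>R v) u - f' (x + s *\<^sub>R u + 0 *\<^sub>R v) u)"
    unfolding \<phi>_def
    by (rule MVT2[OF k]) (intro DERIV_diff d1, use k in auto)
  then obtain s where s: "0 < s" "s < k"
    "\<phi> k - \<phi> 0 = k * (f' (x + s *\<^sub>R u + k *\<^sub>R v) u - f' (x + s *\<^sub>R u + 0 *\<^sub>R v) u)" by auto
  have "\<exists>t>0. t < k \<and> f' (x + s *\<^sub>R u + k *\<^sub>R v) u - f' (x + s *\<^sub>R u + 0 *\<^sub>R v) u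
       = (k - 0) * f'' (x + s *\<^sub>R u + t *\<^sub>R v) u v"
    by (rule MVT2[OF k]) (intro d2, use s k in auto)
  then obtain t where "0 < t" "t < k" "f' (x + s *\<^sub>R u + k *\<^sub>R v) u - f' (x + s *\<^sub>R u + 0 *\<^sub>R v) u
       = k * f'' (x + s *\<^sub>R u + t *\<^sub>R v) u v" by auto
  with s show ?thesis by (intro that[of s t]) (auto simp: \<phi>_def)
qed

lemma symmetric_second_derivative_real:
  fixes f :: "'a::real_normed_vector \<Rightarrow> real"
  assumes "open S" "x \<in> S"
    and f': "\<And>y. y \<in> S \<Longrightarrow> (f has_derivative f' y) (at y)"
    and f'': "\<And>y u. y \<in> S \<Longrightarrow> ((\<lambda>z. f' z u) has_derivative f'' y u) (at y)"
    and cont: "\<And>u v. continuous_on S (\<lambda>y. f'' y u v)"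
  shows "f'' x u v = f'' x v u"
proof -
  have eps: "\<bar>f'' x u v - f'' x v u\<bar> \<le> e" if "e > 0" for e
  proof -
    have c: "continuous (at x) (\<lambda>y. f'' y u v)" "continuous (at x) (\<lambda>y. f'' y v u)"
      using assms by (auto simp: continuous_on_eq_continuous_at)
    obtain d1 where d1: "d1 > 0" "\<And>y. dist y x < d1 \<Longrightarrow> dist (f'' y u v) (f'' x u v) < e/2"
      using c(1) \<open>e > 0\<close> unfolding continuous_at_eps_delta by (metis half_gt_zero)
    obtain d2 where d2: "d2 > 0" "\<And>y. dist y x < d2 \<Longrightarrow> dist (f'' y v u) (f'' x v u) < e/2"
      using c(2) \<open>e > 0\<close> unfolding continuous_at_eps_delta by (metis half_gt_zero)
    obtain d3 where d3: "d3 > 0" "ball x d3 \<subseteq> S"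
      using assms open_contains_ball by blast
    define d where "d = min d1 (min d2 d3)"
    define k where "k = d / (2 * (norm u + norm v + 1))"
    have pos: "norm u + norm v + 1 > 0" by (smt (verit) norm_ge_zero)
    have "d > 0" using d1 d2 d3 by (auto simp: d_def)
    then have k: "k > 0" using pos by (auto simp: k_def)
    have near: "dist (x + s *\<^sub>R a + t *\<^sub>R b) x < d"
      if "0 \<le> s" "s \<le> k" "0 \<le> t" "t \<le> k" "norm a + norm b = norm u + norm v" for s t a b
    proof -
      have "norm (s *\<^sub>R a + t *\<^sub>R b) \<le> s * norm a + t * norm b"
        using that by (metis abs_of_nonneg norm_scaleR norm_triangle_ineq)
      also have "\<dots> \<le> k * norm a + k * norm b"
        using that by (intro add_mono mult_right_mono) auto
      also have "\<dots> = k * (norm u + norm v)" using that(5) by (metis distrib_left)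
      also have "\<dots> < k * (2 * (norm u + norm v + 1))"
        using k by (intro mult_strict_left_mono) (auto, smt (verit) norm_ge_zero)
      also have "\<dots> = d" using pos by (simp add: k_def)
      finally show ?thesis by (simp add: dist_norm add.assoc)
    qed
    have inS: "x + s *\<^sub>R a + t *\<^sub>R b \<in> S"
      if "0 \<le> s" "s \<le> k" "0 \<le> t" "t \<le> k" "norm a + norm b = norm u + norm v" for s t a b
      using near[OF that] d3 by (auto simp: d_def dist_commute)
    obtain s t where 1: "0 \<le> s" "s \<le> k" "0 \<le> t" "t \<le> k"
      "f (x + k *\<^sub>R u + k *\<^sub>R v) - f (x + k *\<^sub>R u) - f (x + k *\<^sub>R v) + f x
       = k * k * f'' (x + s *\<^sub>R u + t *\<^sub>R v) u v"
      by (rule mixed_difference_eq_second_derivative[OF f' f'' k inS]) auto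
    obtain s' t' where 2: "0 \<le> s'" "s' \<le> k" "0 \<le> t'" "t' \<le> k"
      "f (x + k *\<^sub>R v + k *\<^sub>R u) - f (x + k *\<^sub>R v) - f (x + k *\<^sub>R u) + f x
       = k * k * f'' (x + s' *\<^sub>R v + t' *\<^sub>R u) v u"
      by (rule mixed_difference_eq_second_derivative[OF f' f'' k inS, of v u]) auto
    have "x + k *\<^sub>R v + k *\<^sub>R u = x + k *\<^sub>R u + k *\<^sub>R v" by (simp add: algebra_simps)
    with 1(5) 2(5) k have eq: "f'' (x + s *\<^sub>R u + t *\<^sub>R v) u v = f'' (x + s' *\<^sub>R v + t' *\<^sub>R u) v u"
      by (smt (verit) mult_left_cancel mult_pos_pos)
    have "dist (f'' (x + s *\<^sub>R u + t *\<^sub>R v) u v) (f'' x u v) < e/2"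
      using near[OF 1(1-4)] by (intro d1) (auto simp: d_def)
    moreover have "dist (f'' (x + s' *\<^sub>R v + t' *\<^sub>R u) v u) (f'' x v u) < e/2"
      using near[OF 2(1-4)] by (intro d2) (auto simp: d_def)
    ultimately show ?thesis unfolding eq dist_real_def by arith
  qed
  have "\<bar>f'' x u v - f'' x v u\<bar> \<le> 0" by (rule field_le_epsilon) (simp add: eps)
  then show ?thesis by simp
qed

text \<open>
  The real-valued case applies to the inner product of $f$ with the difference of the two sides.
\<close>

lemma symmetric_second_derivative:
  fixes f :: "'a::real_normed_vector \<Rightarrow> 'b::real_inner"
  assumes "open S" "x \<in> S"
    and f': "\<And>y. y \<in> S \<Longrightarrow> (f has_derivative f' y) (at y)"
    and f'': "\<And>y u. y \<in> S \<Longrightarrow> ((\<lambda>z. f' z u) has_derivative f'' y u) (at y)"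
    and cont: "\<And>u v. continuous_on S (\<lambda>y. f'' y u v)"
  shows "f'' x u v = f'' x v u"
proof -
  define b where "b = f'' x u v - f'' x v u"
  have "f'' x u v \<bullet> b = f'' x v u \<bullet> b"
    by (rule symmetric_second_derivative_real[OF assms(1,2), of "\<lambda>y. f y \<bullet> b" "\<lambda>y u. f' y u \<bullet> b"
          "\<lambda>y u v. f'' y u v \<bullet> b"])
      (auto intro!: f' f'' cont continuous_intros has_derivative_inner_left)
  then have "b \<bullet> b = 0" by (simp add: b_def inner_diff_left)
  then show ?thesis by (simp add: b_def)
qed

lemma smooth_on_D: "smooth_on f S \<Longrightarrow> smooth_on (\<lambda>x. D f x v) S"
  unfolding smooth_on_def by (metis Ck_on.simps(2))

lemma smooth_on_has_derivative: "smooth_on f S \<Longrightarrow> x \<in> S \<Longrightarrow> (f has_derivative D f x) (at x)"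
  unfolding smooth_on_def by (metis Ck_on.simps(2) frechet_derivative_works)

lemma smooth_on_continuous_on: "smooth_on f S \<Longrightarrow> continuous_on S f"
  unfolding smooth_on_def by (metis Ck_on.simps(1))

lemma smooth_on_linear_D: "smooth_on f S \<Longrightarrow> x \<in> S \<Longrightarrow> linear (D f x)"
  using smooth_on_has_derivative has_derivative_linear by blast

lemma smooth_on_symmetric_second_derivative:
  fixes f :: "'a::real_normed_vector \<Rightarrow> 'b::real_inner"
  assumes "open S" "smooth_on f S" "x \<in> S"
  shows "D (\<lambda>y. D f y u) x v = D (\<lambda>y. D f y v) x u"
  by (rule symmetric_second_derivative[OF assms(1,3), where f = f and f' = "\<lambda>y. D f y"])
    (auto intro!: smooth_on_has_derivative smooth_on_D smooth_on_continuous_on assms)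

lemma partial_eq_D:
  assumes "f differentiable (at x)"
  shows "partial i f x = D f x (axis i 1)"
proof -
  have "((\<lambda>s. x + s *\<^sub>R axis i 1) has_derivative (\<lambda>h. h *\<^sub>R axis i 1)) (at 0)"
    by (auto intro!: derivative_eq_intros)
  moreover have f: "(f has_derivative D f x) (at (x + 0 *\<^sub>R axis i 1))"
    using assms by (simp add: frechet_derivative_works)
  ultimately have "((\<lambda>s. f (x + s *\<^sub>R axis i 1)) has_derivative (\<lambda>h. D f x (h *\<^sub>R axis i 1))) (at 0)"
    by (rule has_derivative_compose)
  moreover have "linear (D f x)" using assms by (rule linear_frechet_derivative)
  ultimately have "((\<lambda>s. f (x + s *\<^sub>R axis i 1)) has_real_derivative (D f x (axis i 1))) (at 0)"
    by (simp add: has_field_derivative_def linear_cmul mult_commute_abs)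
  then show ?thesis unfolding partial_def by (rule DERIV_imp_deriv)
qed

lemma linear_sum_axis:
  fixes f :: "real ^ 'n::finite \<Rightarrow> 'b::real_vector"
  assumes "linear f"
  shows "f v = (\<Sum>i\<in>UNIV. v $ i *\<^sub>R f (axis i 1))"
proof -
  have "v = (\<Sum>i\<in>UNIV. v $ i *\<^sub>R axis i 1)"
    using basis_expansion[of v] by (simp add: scalar_mult_eq_scaleR)
  then have "f v = f (\<Sum>i\<in>UNIV. v $ i *\<^sub>R axis i 1)" by simp
  also have "\<dots> = (\<Sum>i\<in>UNIV. v $ i *\<^sub>R f (axis i 1))"
    using assms by (simp add: linear_sum linear_cmul)
  finally show ?thesis .
qed

lemma D_eq_sum_partial:
  fixes f :: "real ^ 'n::finite \<Rightarrow> real"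
  assumes "f differentiable (at x)"
  shows "D f x v = (\<Sum>i\<in>UNIV. v $ i * partial i f x)"
  using linear_sum_axis[OF linear_frechet_derivative[OF assms], of v] partial_eq_D[OF assms] by simp

section \<open>Flows of commuting vector fields\<close>

text \<open>
  The function $(|u|^2 + e^2)\, e^{-(2L+1)s}$ is nonincreasing, since $2 e |u| \le |u|^2 + e^2$. Working
  with squares avoids the points where $|u|$ is not differentiable.
\<close>

lemma gronwall_forward:
  fixes u :: "real \<Rightarrow> 'a::real_inner"
  assumes "a \<le> b"
    and u: "\<And>s. a \<le> s \<Longrightarrow> s \<le> b \<Longrightarrow> (u has_vector_derivative u' s) (at s)"
    and bound: "\<And>s. a \<le> s \<Longrightarrow> s \<le> b \<Longrightarrow> norm (u' s) \<le> L * norm (u s) + e"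
    and "L \<ge> 0"
  shows "(norm (u b))\<^sup>2 + e\<^sup>2 \<le> ((norm (u a))\<^sup>2 + e\<^sup>2) * exp ((2 * L + 1) * (b - a))"
proof -
  define k where "k = 2 * L + 1"
  define f where "f s = (u s \<bullet> u s + e\<^sup>2) * exp (- k * (s - a))" for s
  have "f b \<le> f a"
  proof (rule DERIV_nonpos_imp_nonincreasing[OF \<open>a \<le> b\<close>])
    fix s assume s: "a \<le> s" "s \<le> b"
    let ?y = "(2 * (u s \<bullet> u' s) - k * (u s \<bullet> u s + e\<^sup>2)) * exp (- k * (s - a))"
    have "((\<lambda>s. u s \<bullet> u s) has_real_derivative 2 * (u s \<bullet> u' s)) (at s)"
      using has_derivative_inner[OF u[OF s, unfolded has_vector_derivative_def]
          u[OF s, unfolded has_vector_derivative_def]]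
      by (simp add: has_field_derivative_def inner_commute mult_commute_abs algebra_simps)
    then have "(f has_real_derivative ?y) (at s)"
      unfolding f_def by (auto intro!: derivative_eq_intros simp: algebra_simps)
    moreover have "?y \<le> 0"
    proof -
      have "u s \<bullet> u' s \<le> norm (u s) * norm (u' s)" by (rule norm_cauchy_schwarz)
      also have "\<dots> \<le> norm (u s) * (L * norm (u s) + e)"
        using bound[OF s] by (intro mult_left_mono) auto
      finally have "2 * (u s \<bullet> u' s) \<le> 2 * L * (norm (u s))\<^sup>2 + 2 * e * norm (u s)"
        by (simp add: power2_eq_square algebra_simps)
      also have "\<dots> \<le> k * (norm (u s))\<^sup>2 + e\<^sup>2"
        using sum_squares_ge_zero[of "norm (u s) - e" 0] by (simp add: k_def power2_eq_square algebra_simps)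
      also have "\<dots> \<le> k * (u s \<bullet> u s + e\<^sup>2)"
        using \<open>L \<ge> 0\<close> by (simp add: k_def power2_norm_eq_inner algebra_simps)
      finally show ?thesis by (simp add: mult_nonpos_nonneg)
    qed
    ultimately show "\<exists>y. DERIV f s :> y \<and> y \<le> 0" by blast
  qed
  then have "(u b \<bullet> u b + e\<^sup>2) * exp (- k * (b - a)) \<le> u a \<bullet> u a + e\<^sup>2"
    by (simp add: f_def)
  then have "(u b \<bullet> u b + e\<^sup>2) * exp (- k * (b - a)) * exp (k * (b - a))
      \<le> (u a \<bullet> u a + e\<^sup>2) * exp (k * (b - a))"
    by (rule mult_right_mono) simp
  then show ?thesis
    by (simp add: mult.assoc flip: exp_add power2_norm_eq_inner k_def)
qed

text \<open>
  Both time directions are needed since flows are followed forwards and backwards.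
\<close>

lemma gronwall:
  fixes u :: "real \<Rightarrow> 'a::real_inner"
  assumes u: "\<And>s. s \<in> closed_segment a b \<Longrightarrow> (u has_vector_derivative u' s) (at s)"
    and bound: "\<And>s. s \<in> closed_segment a b \<Longrightarrow> norm (u' s) \<le> L * norm (u s) + e"
    and "L \<ge> 0"
  shows "(norm (u b))\<^sup>2 + e\<^sup>2 \<le> ((norm (u a))\<^sup>2 + e\<^sup>2) * exp ((2 * L + 1) * \<bar>b - a\<bar>)"
proof (cases "a \<le> b")
  case True
  then show ?thesis
    using gronwall_forward[of a b u u' L e] assms by (auto simp: closed_segment_eq_real_ivl)
next
  case False
  have "((\<lambda>s. u (- s)) has_vector_derivative - u' (- s)) (at s)" if "-a \<le> s" "s \<le> -b" for s
  proof -
    have "(u has_vector_derivative u' (- s)) (at (- s))"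
      using u that by (auto simp: closed_segment_eq_real_ivl)
    then have "(u \<circ> uminus has_vector_derivative (-1) *\<^sub>R u' (- s)) (at s)"
      by (intro vector_diff_chain_at) (auto intro!: derivative_eq_intros simp: has_vector_derivative_minus)
    then show ?thesis by (simp add: o_def)
  qed
  moreover have "norm (- u' (- s)) \<le> L * norm (u (- s)) + e" if "-a \<le> s" "s \<le> -b" for s
    using bound[of "- s"] that by (auto simp: closed_segment_eq_real_ivl)
  ultimately show ?thesis
    using gronwall_forward[of "-a" "-b" "\<lambda>s. u (- s)" "\<lambda>s. - u' (- s)" L e] assms False by auto
qed

lemma ode_lipschitz_dependence:
  fixes X :: "'a::real_inner \<Rightarrow> 'a"
  assumes lip: "\<And>x y. x \<in> K \<Longrightarrow> y \<in> K \<Longrightarrow> norm (X x - X y) \<le> L * norm (x - y)" and "L \<ge> 0"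
    and f: "\<And>s. s \<in> closed_segment a b \<Longrightarrow> f s \<in> K \<and> (f has_vector_derivative X (f s)) (at s)"
    and g: "\<And>s. s \<in> closed_segment a b \<Longrightarrow> g s \<in> K \<and> (g has_vector_derivative X (g s)) (at s)"
  shows "(norm (f b - g b))\<^sup>2 \<le> (norm (f a - g a))\<^sup>2 * exp ((2 * L + 1) * \<bar>b - a\<bar>)"
  using gronwall[of a b "\<lambda>s. f s - g s" "\<lambda>s. X (f s) - X (g s)" L 0] assms
  by (simp add: has_vector_derivative_diff)

text \<open>
  Banach's fixed point theorem for the integral operator on bounded continuous curves with values in
  the ball. To stay with curves defined on the whole line, time is clamped to $[-\eta, \eta]$;
  the lower limit of integration is moved from $0$ to $-\eta$ so that both signs of time are treated
  at once.
\<close>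

lemma picard_existence:
  fixes X :: "'a::euclidean_space \<Rightarrow> 'a"
  assumes lip: "\<And>x y. x \<in> cball z d \<Longrightarrow> y \<in> cball z d \<Longrightarrow> norm (X x - X y) \<le> L * norm (x - y)"
    and "L \<ge> 0"
    and bound: "\<And>x. x \<in> cball z d \<Longrightarrow> norm (X x) \<le> B"
    and "\<eta> > 0" "d > 0" "B * \<eta> \<le> d" "L * \<eta> \<le> 1/2"
  shows "\<exists>f. f 0 = z \<and> (\<forall>s\<in>{-\<eta><..<\<eta>}. f s \<in> cball z d \<and> (f has_vector_derivative X (f s)) (at s))"
proof -
  define J where "J \<phi> t = integral {-\<eta>..t} \<phi> - integral {-\<eta>..0} \<phi>" for \<phi> :: "real \<Rightarrow> 'a" and t
  have J_bound: "norm (J \<phi> t) \<le> b * \<eta>"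
    if c: "continuous_on {-\<eta>..\<eta>} \<phi>" and b: "\<And>s. s \<in> {-\<eta>..\<eta>} \<Longrightarrow> norm (\<phi> s) \<le> b"
      and t: "-\<eta> \<le> t" "t \<le> \<eta>" for \<phi> :: "real \<Rightarrow> 'a" and t b :: real
  proof -
    have "b \<ge> 0" using b[of 0] \<open>\<eta> > 0\<close> norm_ge_zero[of "\<phi> 0"] by (smt (verit) atLeastAtMost_iff)
    have ci: "\<phi> integrable_on {-\<eta>..r}" if "r \<le> \<eta>" for r
      using that by (intro integrable_continuous_real continuous_on_subset[OF c]) auto
    show ?thesis
    proof (cases "t \<ge> 0")
      case True
      have "J \<phi> t = integral {0..t} \<phi>"
        using Henstock_Kurzweil_Integration.integral_combine[of "-\<eta>" 0 t \<phi>] ci[of t] True t \<open>\<eta> > 0\<close> by (simp add: J_def algebra_simps)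
      also have "norm \<dots> \<le> b * (t - 0)"
        using True t \<open>\<eta> > 0\<close> b by (intro integral_bound continuous_on_subset[OF c]) auto
      also have "\<dots> \<le> b * \<eta>" using t(1,2) \<open>b \<ge> 0\<close> by (intro mult_left_mono) auto
      finally show ?thesis .
    next
      case False
      have "J \<phi> t = - integral {t..0} \<phi>"
        using Henstock_Kurzweil_Integration.integral_combine[of "-\<eta>" t 0 \<phi>] ci[of 0] False t \<open>\<eta> > 0\<close> by (simp add: J_def algebra_simps)
      also have "norm \<dots> \<le> b * (0 - t)"
        unfolding norm_minus_cancel
        using False t \<open>\<eta> > 0\<close> b by (intro integral_bound continuous_on_subset[OF c]) auto
      also have "\<dots> \<le> b * \<eta>" using t(1,2) \<open>b \<ge> 0\<close> by (intro mult_left_mono) auto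
      finally show ?thesis .
    qed
  qed
  have J_deriv: "(J \<phi> has_vector_derivative \<phi> t) (at t within {-\<eta>..\<eta>})"
    if c: "continuous_on {-\<eta>..\<eta>} \<phi>" and t: "t \<in> {-\<eta>..\<eta>}" for \<phi> t
    unfolding J_def using integral_has_vector_derivative[OF c t]
    by (auto intro!: derivative_eq_intros)
  define cl where "cl t = max (-\<eta>) (min \<eta> t)" for t
  have cl: "cl t \<in> {-\<eta>..\<eta>}" for t using \<open>\<eta> > 0\<close> by (auto simp: cl_def)
  have contX: "continuous_on (cball z d) X"
    using lip \<open>L \<ge> 0\<close>
    by (intro lipschitz_on_continuous_on[of L] lipschitz_onI) (auto simp: dist_norm)
  define S where "S = PiC (UNIV :: real set) (\<lambda>_. cball z d)"
  have S: "g \<in> S \<longleftrightarrow> (\<forall>t. apply_bcontfun g t \<in> cball z d)" for g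
    by (auto simp: S_def mem_PiC_iff)
  have contXg: "continuous_on A (\<lambda>s. X (apply_bcontfun g s))" if "g \<in> S" for g A
    using that by (intro continuous_on_compose2[OF contX]) (auto simp: S)
  (* the integral operator, extended to all times by clamping *)
  define T where "T g = Bcontfun (\<lambda>t. z + J (\<lambda>s. X (apply_bcontfun g s)) (cl t))" for g
  have inball: "z + J (\<lambda>s. X (apply_bcontfun g s)) (cl t) \<in> cball z d" if "g \<in> S" for g t
  proof -
    have "norm (J (\<lambda>s. X (apply_bcontfun g s)) (cl t)) \<le> B * \<eta>"
      using that cl[of t] bound by (intro J_bound contXg) (auto simp: S)
    then show ?thesis using \<open>B * \<eta> \<le> d\<close> by (auto simp: dist_norm)
  qed
  have T: "apply_bcontfun (T g) t = z + J (\<lambda>s. X (apply_bcontfun g s)) (cl t)" if "g \<in> S" for g t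
  proof -
    have "continuous_on {-\<eta>..\<eta>} (J (\<lambda>s. X (apply_bcontfun g s)))"
      using J_deriv[OF contXg[OF that]] has_vector_derivative_continuous continuous_on_eq_continuous_within
      by blast
    then have "continuous_on UNIV (\<lambda>t. z + J (\<lambda>s. X (apply_bcontfun g s)) (cl t))"
      by (intro continuous_intros continuous_on_compose2[of _ "J (\<lambda>s. X (apply_bcontfun g s))" UNIV cl])
        (use cl in \<open>auto simp: cl_def intro!: continuous_intros\<close>)
    moreover have "bounded (range (\<lambda>t. z + J (\<lambda>s. X (apply_bcontfun g s)) (cl t)))"
      by (rule bounded_subset[OF bounded_cball[of z d]]) (use inball[OF that] in auto)
    ultimately show ?thesis by (simp add: T_def Bcontfun_inverse bcontfun_def)
  qed
  have "\<exists>!g\<in>S. T g = g"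
  proof (rule Banach_fix[where c = "1/2"])
    have "closed S" unfolding S_def by (intro closed_PiC) auto
    then show "complete S" by (simp add: complete_eq_closed)
    have "const_bcontfun z \<in> S" using \<open>d > 0\<close> by (simp add: S const_bcontfun.rep_eq)
    then show "S \<noteq> {}" by blast
    show "T ` S \<subseteq> S"
    proof
      fix f assume "f \<in> T ` S"
      then obtain g where "g \<in> S" "f = T g" by blast
      then show "f \<in> S" using T inball by (auto simp: S)
    qed
    fix f g assume fg: "f \<in> S" "g \<in> S"
    show "dist (T f) (T g) \<le> 1/2 * dist f g"
    proof (rule dist_bound)
      fix t
      let ?F = "\<lambda>f s. X (apply_bcontfun f s)"
      have "J (?F f) (cl t) - J (?F g) (cl t) = J (\<lambda>s. ?F f s - ?F g s) (cl t)"
        unfolding J_def using contXg[OF fg(1)] contXg[OF fg(2)]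
        by (simp add: integral_diff integrable_continuous_real algebra_simps)
      then have "dist (apply_bcontfun (T f) t) (apply_bcontfun (T g) t)
          = norm (J (\<lambda>s. ?F f s - ?F g s) (cl t))"
        using fg by (simp add: T dist_norm)
      also have "\<dots> \<le> (L * dist f g) * \<eta>"
      proof (rule J_bound)
        show "continuous_on {- \<eta>..\<eta>} (\<lambda>s. ?F f s - ?F g s)"
          using fg by (intro continuous_intros contXg)
        fix s
        have "norm (?F f s - ?F g s) \<le> L * dist (apply_bcontfun f s) (apply_bcontfun g s)"
          using lip fg by (simp add: S dist_norm)
        also have "\<dots> \<le> L * dist f g" using dist_bounded \<open>L \<ge> 0\<close> by (intro mult_left_mono) auto
        finally show "norm (?F f s - ?F g s) \<le> L * dist f g" .
      qed (use cl[of t] in auto)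
      also have "\<dots> = (L * \<eta>) * dist f g" by simp
      also have "\<dots> \<le> 1/2 * dist f g" using \<open>L * \<eta> \<le> 1/2\<close> by (intro mult_right_mono) auto
      finally show "dist (apply_bcontfun (T f) t) (apply_bcontfun (T g) t) \<le> 1/2 * dist f g" .
    qed
  qed auto
  from ex1_implies_ex[OF this] obtain g where g: "g \<in> S" "T g = g" by (elim exE conjE)
  let ?g = "apply_bcontfun g"
  have g_eq: "?g t = z + J (\<lambda>s. X (?g s)) (cl t)" for t using T[OF g(1), of t] unfolding g(2) .
  have "J \<phi> (cl 0) = 0" for \<phi> using \<open>\<eta> > 0\<close> by (simp add: J_def cl_def)
  then have "?g 0 = z" using g_eq[of 0] by (metis add.right_neutral)
  moreover have "(?g has_vector_derivative X (?g s)) (at s)" if "s \<in> {-\<eta><..<\<eta>}" for s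
  proof -
    have "((\<lambda>t. z + J (\<lambda>s. X (?g s)) t) has_vector_derivative X (?g s)) (at s within {-\<eta>..\<eta>})"
      using J_deriv[OF contXg[OF g(1)], of s] that by (auto intro!: derivative_eq_intros)
    then have "((\<lambda>t. z + J (\<lambda>s. X (?g s)) t) has_vector_derivative X (?g s)) (at s)"
      using that by (metis at_within_interior interior_atLeastAtMost_real)
    then show ?thesis
    proof (rule has_vector_derivative_transform_within_open[of _ _ _ "{-\<eta><..<\<eta>}"])
      fix t assume "t \<in> {-\<eta><..<\<eta>}"
      then have "cl t = t" by (auto simp: cl_def)
      then show "z + J (\<lambda>s. X (?g s)) t = ?g t" using g_eq[of t] by metis
    qed (use that in auto)
  qed
  ultimately show ?thesis using g(1) by (auto simp: S)
qed

text \<open>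
  The derivative is uniformly continuous on a compact set. Convexity is what allows the mean value
  inequality to turn this into a uniform first order approximation.
\<close>

lemma C1_on_compact_convex:
  fixes X :: "'a::euclidean_space \<Rightarrow> 'b::real_normed_vector"
  assumes "compact K" "convex K" "K \<subseteq> S"
    and X': "\<And>x. x \<in> S \<Longrightarrow> (X has_derivative X' x) (at x)"
    and cont: "\<And>v. continuous_on S (\<lambda>x. X' x v)"
  shows "\<exists>L\<ge>0. (\<forall>x\<in>K. \<forall>v. norm (X' x v) \<le> L * norm v) \<and>
      (\<forall>x\<in>K. \<forall>y\<in>K. norm (X x - X y) \<le> L * norm (x - y))"
    and "\<And>\<epsilon>. \<epsilon> > 0 \<Longrightarrow> \<exists>\<delta>>0. \<forall>a\<in>K. \<forall>b\<in>K. norm (b - a) < \<delta> \<longrightarrow>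
        norm (X b - X a - X' a (b - a)) \<le> \<epsilon> * norm (b - a)"
proof -
  define Z where "Z x = Blinfun (X' x)" for x
  have Z: "blinfun_apply (Z x) = X' x" if "x \<in> S" for x
    unfolding Z_def using X'[OF that] by (intro bounded_linear_Blinfun_apply has_derivative_bounded_linear)
  have "continuous_on S Z"
    by (rule continuous_on_blinfun_componentwise) (use cont Z in \<open>simp cong: continuous_on_cong\<close>)
  then have contZ: "continuous_on K Z" using \<open>K \<subseteq> S\<close> continuous_on_subset by blast
  then have "compact (Z ` K)" using \<open>compact K\<close> by (rule compact_continuous_image)
  then obtain L where L: "L > 0" "\<And>x. x \<in> K \<Longrightarrow> norm (Z x) \<le> L"
    using compact_imp_bounded bounded_pos by (metis image_eqI)
  have XK: "(X has_derivative X' x) (at x within A)" if "x \<in> K" for x A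
    using X' that \<open>K \<subseteq> S\<close> has_derivative_at_withinI by blast
  have "norm (X' x v) \<le> L * norm v" if "x \<in> K" for x v
  proof -
    have "norm (Z x v) \<le> norm (Z x) * norm v" by (rule norm_blinfun)
    also have "\<dots> \<le> L * norm v" using L that by (intro mult_right_mono) auto
    finally show ?thesis using Z that \<open>K \<subseteq> S\<close> by auto
  qed
  moreover have "norm (X x - X y) \<le> L * norm (x - y)" if "x \<in> K" "y \<in> K" for x y
  proof (rule differentiable_bound[OF \<open>convex K\<close> XK _ that])
    fix x assume "x \<in> K"
    then show "onorm (X' x) \<le> L" using L Z \<open>K \<subseteq> S\<close> by (metis norm_blinfun.rep_eq subsetD)
  qed
  ultimately show "\<exists>L\<ge>0. (\<forall>x\<in>K. \<forall>v. norm (X' x v) \<le> L * norm v) \<and>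
      (\<forall>x\<in>K. \<forall>y\<in>K. norm (X x - X y) \<le> L * norm (x - y))"
    using L(1) by (intro exI[of _ L]) auto
  fix \<epsilon> :: real assume "\<epsilon> > 0"
  have "uniformly_continuous_on K Z" using compact_uniformly_continuous contZ \<open>compact K\<close> by blast
  then obtain \<delta> where \<delta>: "\<delta> > 0" "\<And>a b. a \<in> K \<Longrightarrow> b \<in> K \<Longrightarrow> dist b a < \<delta> \<Longrightarrow> dist (Z b) (Z a) < \<epsilon>"
    unfolding uniformly_continuous_on_def using \<open>\<epsilon> > 0\<close> by metis
  have "norm (X b - X a - X' a (b - a)) \<le> \<epsilon> * norm (b - a)"
    if "a \<in> K" "b \<in> K" "norm (b - a) < \<delta>" for a b
  proof -
    have seg: "closed_segment a b \<subseteq> K" using that \<open>convex K\<close> by (simp add: closed_segment_subset)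
    have "norm (X b - X a - X' a (b - a)) \<le> norm (b - a) * \<epsilon>"
    proof (rule differentiable_bound_linearization[where S = "closed_segment a b"])
      show "a + t *\<^sub>R (b - a) \<in> closed_segment a b" if "t \<in> {0..1}" for t
        using that by (auto simp: in_segment algebra_simps intro!: exI[of _ t])
      show "(X has_derivative X' x) (at x within closed_segment a b)" if "x \<in> closed_segment a b" for x
        using XK seg that by blast
      fix x assume x: "x \<in> closed_segment a b"
      then have "norm (x - a) \<le> norm (b - a)" using segment_bound(1) by (metis norm_minus_commute)
      then have "norm (Z x - Z a) < \<epsilon>"
        using \<delta>(2)[of a x] x seg that by (auto simp: dist_norm)
      moreover have "blinfun_apply (Z x - Z a) = X' x - X' a"
        using Z x seg that \<open>K \<subseteq> S\<close> by (subst minus_blinfun.rep_eq) (auto simp: fun_eq_iff subset_iff)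
      ultimately show "onorm (X' x - X' a) \<le> \<epsilon>" by (simp add: norm_blinfun.rep_eq)
    qed (use that in auto)
    then show ?thesis by (simp add: mult.commute)
  qed
  then show "\<exists>\<delta>>0. \<forall>a\<in>K. \<forall>b\<in>K. norm (b - a) < \<delta> \<longrightarrow>
        norm (X b - X a - X' a (b - a)) \<le> \<epsilon> * norm (b - a)"
    using \<delta>(1) by blast
qed

text \<open>
  Let $u(s)$ be the error of the first order approximation of $\Phi_t(s)$ by
  $\Phi_{t_0}(s) + (t - t_0) Y(\Phi_{t_0}(s))$. Because $DX\,Y = DY\,X$, it satisfies the variational
  equation $u' = DX\,u$ up to an error of order $o(t - t_0)$; it is $o(t - t_0)$ at $s = a$, and by Gronwall
  it stays so.
\<close>

lemma flow_maps_commuting_field: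
  fixes X Y :: "'a::euclidean_space \<Rightarrow> 'a" and \<Phi> :: "real \<Rightarrow> real \<Rightarrow> 'a"
  assumes K: "compact K" "convex K" "K \<subseteq> S"
    and X': "\<And>x. x \<in> S \<Longrightarrow> (X has_derivative X' x) (at x)"
    and cont: "\<And>v. continuous_on S (\<lambda>x. X' x v)"
    and Y': "\<And>x. x \<in> S \<Longrightarrow> (Y has_derivative Y' x) (at x)"
    and bracket: "\<And>x. x \<in> S \<Longrightarrow> X' x (Y x) = Y' x (X x)"
    and J: "open J" "t0 \<in> J"
    and flow: "\<And>t s. t \<in> J \<Longrightarrow> s \<in> closed_segment a b \<Longrightarrow>
        \<Phi> t s \<in> K \<and> (\<Phi> t has_vector_derivative X (\<Phi> t s)) (at s)"
    and init: "((\<lambda>t. \<Phi> t a) has_vector_derivative Y (\<Phi> t0 a)) (at t0)"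
  shows "((\<lambda>t. \<Phi> t b) has_vector_derivative Y (\<Phi> t0 b)) (at t0)"
proof -
  obtain L where L: "L \<ge> 0" "\<And>x v. x \<in> K \<Longrightarrow> norm (X' x v) \<le> L * norm v"
    "\<And>x y. x \<in> K \<Longrightarrow> y \<in> K \<Longrightarrow> norm (X x - X y) \<le> L * norm (x - y)"
    using C1_on_compact_convex(1)[OF K X' cont] by blast
  (* the amplification factor of Gronwall; as it is at least 1, it may also be used in place of its root *)
  define E where "E = exp ((2 * L + 1) * \<bar>b - a\<bar>)"
  have E: "E \<ge> 1" using L(1) by (simp add: E_def)
  have E_seg: "exp ((2 * L + 1) * \<bar>s - a\<bar>) \<le> E" if "s \<in> closed_segment a b" for s
    using that L(1) by (auto simp: E_def closed_segment_eq_real_ivl split: if_splits intro!: mult_left_mono)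
  have E2: "x * E \<le> x * E\<^sup>2" if "x \<ge> 0" for x :: real
    using that E by (intro mult_left_mono) (auto simp: power2_eq_square)
  define c where "c = norm (Y (\<Phi> t0 a)) + 1"
  have c: "c > 0" unfolding c_def by (smt (verit) norm_ge_zero)
  define C where "C = c * E"
  have C: "C > 0" using c E by (simp add: C_def)
  have t0seg: "\<Phi> t0 s \<in> K" "(\<Phi> t0 has_vector_derivative X (\<Phi> t0 s)) (at s)" if "s \<in> closed_segment a b" for s
    using flow[OF J(2) that] by auto
  obtain r where r: "r > 0" "\<And>t. \<bar>t - t0\<bar> < r \<Longrightarrow> t \<in> J"
    using J unfolding open_dist dist_real_def by blast
  have init_eps: "\<exists>d>0. \<forall>t. \<bar>t - t0\<bar> < d \<longrightarrow>
      norm (\<Phi> t a - \<Phi> t0 a - (t - t0) *\<^sub>R Y (\<Phi> t0 a)) \<le> \<epsilon> * \<bar>t - t0\<bar>" if "\<epsilon> > 0" for \<epsilon>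
    using init that unfolding has_vector_derivative_def has_derivative_at_alt by (auto simp: abs_minus_commute)
  obtain d1 where d1: "d1 > 0" "\<And>t. \<bar>t - t0\<bar> < d1 \<Longrightarrow>
      norm (\<Phi> t a - \<Phi> t0 a - (t - t0) *\<^sub>R Y (\<Phi> t0 a)) \<le> 1 * \<bar>t - t0\<bar>"
    using init_eps[of 1] by auto
  have near: "norm (\<Phi> t s - \<Phi> t0 s) \<le> C * \<bar>t - t0\<bar>"
    if t: "\<bar>t - t0\<bar> < d1" "\<bar>t - t0\<bar> < r" and s: "s \<in> closed_segment a b" for t s
  proof -
    have seg: "closed_segment a s \<subseteq> closed_segment a b" using s by (simp add: subset_closed_segment)
    have "norm (\<Phi> t a - \<Phi> t0 a) \<le> norm (\<Phi> t a - \<Phi> t0 a - (t - t0) *\<^sub>R Y (\<Phi> t0 a)) + norm ((t - t0) *\<^sub>R Y (\<Phi> t0 a))"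
      by (metis diff_add_cancel norm_triangle_ineq)
    also have "\<dots> \<le> c * \<bar>t - t0\<bar>" using d1(2)[OF t(1)] unfolding norm_scaleR c_def distrib_right by (simp add: mult.commute)
    finally have 1: "norm (\<Phi> t a - \<Phi> t0 a) \<le> c * \<bar>t - t0\<bar>" .
    have "(norm (\<Phi> t s - \<Phi> t0 s))\<^sup>2 \<le> (norm (\<Phi> t a - \<Phi> t0 a))\<^sup>2 * exp ((2 * L + 1) * \<bar>s - a\<bar>)"
      by (rule ode_lipschitz_dependence[OF L(3) L(1)]) (use flow[OF r(2)[OF t(2)]] flow[OF J(2)] seg in auto)
    also have "\<dots> \<le> (c * \<bar>t - t0\<bar>)\<^sup>2 * E"
      using 1 E_seg[OF s] by (intro mult_mono power_mono) auto
    also have "\<dots> \<le> (C * \<bar>t - t0\<bar>)\<^sup>2"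
      using E2[of "(c * \<bar>t - t0\<bar>)\<^sup>2"] by (simp add: C_def power_mult_distrib mult_ac)
    finally show ?thesis using C by (simp add: power2_le_iff_abs_le)
  qed
  show ?thesis
    unfolding has_vector_derivative_def has_derivative_at_alt
  proof (intro conjI allI impI)
    show "bounded_linear (\<lambda>x. x *\<^sub>R Y (\<Phi> t0 b))" by (rule bounded_linear_scaleR_left)
    fix e :: real assume "e > 0"
    (* chosen so that the initial error and the error of the differential equation together, amplified by E, give e *)
    define \<epsilon> where "\<epsilon> = e / ((1 + C) * E)"
    have \<epsilon>: "\<epsilon> > 0" using \<open>e > 0\<close> C E by (simp add: \<epsilon>_def)
    obtain d2 where d2: "d2 > 0" "\<And>t. \<bar>t - t0\<bar> < d2 \<Longrightarrow>
        norm (\<Phi> t a - \<Phi> t0 a - (t - t0) *\<^sub>R Y (\<Phi> t0 a)) \<le> \<epsilon> * \<bar>t - t0\<bar>"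
      using init_eps[OF \<epsilon>] by auto
    obtain \<delta> where \<delta>: "\<delta> > 0" "\<And>x y. x \<in> K \<Longrightarrow> y \<in> K \<Longrightarrow> norm (y - x) < \<delta> \<Longrightarrow>
        norm (X y - X x - X' x (y - x)) \<le> \<epsilon> * norm (y - x)"
      using C1_on_compact_convex(2)[OF K X' cont \<epsilon>] by blast
    define d where "d = min (min d1 r) (min d2 (\<delta> / C))"
    have "norm (\<Phi> t b - \<Phi> t0 b - (t - t0) *\<^sub>R Y (\<Phi> t0 b)) \<le> e * norm (t - t0)"
      if "norm (t - t0) < d" for t
    proof -
      define m where "m = \<bar>t - t0\<bar>"
      have t: "m < d1" "m < r" "m < d2" "m < \<delta> / C" using that by (auto simp: d_def m_def)
      note t' = t[unfolded m_def]
      define u where "u s = \<Phi> t s - \<Phi> t0 s - (t - t0) *\<^sub>R Y (\<Phi> t0 s)" for s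
      define u' where "u' s = X (\<Phi> t s) - X (\<Phi> t0 s) - (t - t0) *\<^sub>R Y' (\<Phi> t0 s) (X (\<Phi> t0 s))" for s
      have "(norm (u b))\<^sup>2 + (\<epsilon> * C * m)\<^sup>2 \<le> ((norm (u a))\<^sup>2 + (\<epsilon> * C * m)\<^sup>2) * exp ((2 * L + 1) * \<bar>b - a\<bar>)"
      proof (rule gronwall[OF _ _ L(1)])
        fix s assume s: "s \<in> closed_segment a b"
        note K0 = t0seg[OF s] and K1 = flow[OF r(2)[OF t'(2)] s]
        have S0: "\<Phi> t0 s \<in> S" using K0 K(3) by blast
        have "((\<lambda>s. Y (\<Phi> t0 s)) has_vector_derivative Y' (\<Phi> t0 s) (X (\<Phi> t0 s))) (at s)"
          using vector_derivative_diff_chain_within[OF K0(2) has_derivative_at_withinI[OF Y'[OF S0]]]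
          by (simp add: o_def)
        then show "(u has_vector_derivative u' s) (at s)"
          unfolding u_def u'_def using K0(2) K1 by (auto intro!: derivative_eq_intros)
        have "linear (X' (\<Phi> t0 s))" using X'[OF S0] has_derivative_linear by blast
        then have "u' s = X' (\<Phi> t0 s) (u s) + (X (\<Phi> t s) - X (\<Phi> t0 s) - X' (\<Phi> t0 s) (\<Phi> t s - \<Phi> t0 s))"
          by (simp add: u_def u'_def linear_diff linear_cmul bracket[OF S0])
        then have "norm (u' s) \<le> norm (X' (\<Phi> t0 s) (u s))
            + norm (X (\<Phi> t s) - X (\<Phi> t0 s) - X' (\<Phi> t0 s) (\<Phi> t s - \<Phi> t0 s))"
          using norm_triangle_ineq by metis
        also have "\<dots> \<le> L * norm (u s) + \<epsilon> * norm (\<Phi> t s - \<Phi> t0 s)"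
        proof (intro add_mono L(2) \<delta>(2))
          have "norm (\<Phi> t s - \<Phi> t0 s) \<le> C * m" using near[OF t'(1,2) s] by (simp add: m_def)
          also have "\<dots> < \<delta>" using t(4) C by (simp add: pos_less_divide_eq mult.commute)
          finally show "norm (\<Phi> t s - \<Phi> t0 s) < \<delta>" .
        qed (use K0 K1 in auto)
        also have "\<dots> \<le> L * norm (u s) + \<epsilon> * C * m"
          using near[OF t'(1,2) s] \<epsilon> by (simp add: m_def mult.assoc)
        finally show "norm (u' s) \<le> L * norm (u s) + \<epsilon> * C * m" .
      qed
      also have "\<dots> \<le> ((\<epsilon> * m)\<^sup>2 + (\<epsilon> * C * m)\<^sup>2) * E"
        unfolding E_def[symmetric] using d2(2)[OF t'(3)] E C \<epsilon>
        by (intro mult_right_mono add_mono power_mono) (auto simp: u_def m_def)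
      also have "\<dots> \<le> (\<epsilon> * m + \<epsilon> * C * m)\<^sup>2 * E\<^sup>2"
      proof -
        have "(\<epsilon> * m)\<^sup>2 + (\<epsilon> * C * m)\<^sup>2 \<le> (\<epsilon> * m + \<epsilon> * C * m)\<^sup>2"
          using \<epsilon> C by (auto simp: power2_sum m_def)
        then show ?thesis using E by (intro mult_mono) (auto simp: power2_eq_square)
      qed
      also have "\<dots> = ((1 + C) * E * \<epsilon> * m)\<^sup>2" by (simp add: power2_eq_square algebra_simps)
      also have "(1 + C) * E * \<epsilon> * m = e * m" using C E by (simp add: \<epsilon>_def)
      finally have "(norm (u b))\<^sup>2 \<le> (e * m)\<^sup>2" by (smt (verit) zero_le_power2)
      then have "norm (u b) \<le> e * m"
        using \<open>e > 0\<close> by (simp add: m_def power2_le_iff_abs_le)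
      then show ?thesis by (simp add: u_def m_def)
    qed
    moreover have "d > 0" using d1 r d2 \<delta> C by (auto simp: d_def)
    ultimately show "\<exists>d>0. \<forall>y. norm (y - t0) < d \<longrightarrow>
        norm (\<Phi> y b - \<Phi> t0 b - (y - t0) *\<^sub>R Y (\<Phi> t0 b)) \<le> e * norm (y - t0)" by blast
  qed
qed

text \<open>
  If $z$ is an integral curve of $Y$ and $\Phi_t$ is the $X$-trajectory of $z(t)$, then the two
  partial derivatives of $\Phi$ are the continuous fields $X$ and $Y$, so that $\Phi$ is jointly
  differentiable and may be evaluated along the time schedule $s = b(t)$.
\<close>

lemma flow_of_integral_curve:
  fixes X Y :: "'a::euclidean_space \<Rightarrow> 'a" and \<Phi> :: "real \<Rightarrow> real \<Rightarrow> 'a"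
  assumes K: "compact K" "convex K" "K \<subseteq> S"
    and X': "\<And>x. x \<in> S \<Longrightarrow> (X has_derivative X' x) (at x)"
    and cont: "\<And>v. continuous_on S (\<lambda>x. X' x v)"
    and Y': "\<And>x. x \<in> S \<Longrightarrow> (Y has_derivative Y' x) (at x)"
    and bracket: "\<And>x. x \<in> S \<Longrightarrow> X' x (Y x) = Y' x (X x)"
    and J: "open J" "t0 \<in> J"
    and flow: "\<And>t s. t \<in> J \<Longrightarrow> s \<in> {-\<eta><..<\<eta>} \<Longrightarrow>
        \<Phi> t s \<in> K \<and> (\<Phi> t has_vector_derivative X (\<Phi> t s)) (at s)"
    and init: "\<And>t. t \<in> J \<Longrightarrow> ((\<lambda>t. \<Phi> t 0) has_vector_derivative Y (\<Phi> t 0)) (at t)"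
    and b: "(b has_real_derivative b') (at t0)" "b t0 \<in> {-\<eta><..<\<eta>}"
  shows "((\<lambda>t. \<Phi> t (b t)) has_vector_derivative Y (\<Phi> t0 (b t0)) + b' *\<^sub>R X (\<Phi> t0 (b t0))) (at t0)"
proof -
  define s0 where "s0 = b t0"
  have s0: "s0 \<in> {-\<eta><..<\<eta>}" using b by (simp add: s0_def)
  have seg: "closed_segment 0 s \<subseteq> {-\<eta><..<\<eta>}" if "s \<in> {-\<eta><..<\<eta>}" for s
    using that by (auto simp: closed_segment_eq_real_ivl split: if_splits)
  have dt: "((\<lambda>t. \<Phi> t s) has_vector_derivative Y (\<Phi> t s)) (at t)"
    if "t \<in> J" "s \<in> {-\<eta><..<\<eta>}" for t s
    by (rule flow_maps_commuting_field[OF K X' cont Y' bracket J(1) that(1), where a = 0])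
      (use that flow init seg[OF that(2)] in auto)
  obtain L where L: "L \<ge> 0" "\<And>x y. x \<in> K \<Longrightarrow> y \<in> K \<Longrightarrow> norm (X x - X y) \<le> L * norm (x - y)"
    using C1_on_compact_convex(1)[OF K X' cont] by blast
  have contX: "continuous_on K X"
    using L by (intro lipschitz_on_continuous_on[of L] lipschitz_onI) (auto simp: dist_norm)
  then have "compact (X ` K)" using K(1) compact_continuous_image by blast
  then obtain B where B: "B > 0" "\<And>x. x \<in> K \<Longrightarrow> norm (X x) \<le> B"
    using compact_imp_bounded bounded_pos by (metis image_eqI)
  have lip_s: "norm (\<Phi> t s - \<Phi> t s') \<le> B * \<bar>s - s'\<bar>"
    if "t \<in> J" "s \<in> {-\<eta><..<\<eta>}" "s' \<in> {-\<eta><..<\<eta>}" for t s s'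
  proof -
    have "norm (\<Phi> t s - \<Phi> t s') \<le> B * norm (s - s')"
    proof (rule differentiable_bound[where S = "{-\<eta><..<\<eta>}" and f' = "\<lambda>s h. h *\<^sub>R X (\<Phi> t s)"])
      show "(\<Phi> t has_derivative (\<lambda>h. h *\<^sub>R X (\<Phi> t x))) (at x within {-\<eta><..<\<eta>})"
        if "x \<in> {-\<eta><..<\<eta>}" for x
        using flow[OF \<open>t \<in> J\<close> that] has_derivative_at_withinI unfolding has_vector_derivative_def by blast
      show "onorm (\<lambda>h. h *\<^sub>R X (\<Phi> t x)) \<le> B" if "x \<in> {-\<eta><..<\<eta>}" for x
        using flow[OF \<open>t \<in> J\<close> that] B
        by (intro onorm_bound) (auto simp: mult.commute[of B] intro!: mult_left_mono)
    qed (use that in auto)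
    then show ?thesis by simp
  qed
  have "isCont (\<lambda>t. \<Phi> t s0) t0"
    using dt[OF J(2) s0] has_vector_derivative_continuous by blast
  then have lim1: "((\<lambda>t. \<Phi> t s0) \<longlongrightarrow> \<Phi> t0 s0) (at t0)"
    by (simp add: continuous_at)
  have lim: "((\<lambda>(t, s). \<Phi> t s) \<longlongrightarrow> \<Phi> t0 s0) (at (t0, s0) within J \<times> {-\<eta><..<\<eta>})"
  proof (rule Lim_null_comparison[THEN LIM_zero_cancel])
    let ?F = "at (t0, s0) within J \<times> {-\<eta><..<\<eta>}"
    show "\<forall>\<^sub>F x in ?F. norm ((case x of (t, s) \<Rightarrow> \<Phi> t s) - \<Phi> t0 s0)
        \<le> B * \<bar>snd x - s0\<bar> + norm (\<Phi> (fst x) s0 - \<Phi> t0 s0)"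
      unfolding eventually_at_filter
    proof (rule always_eventually, intro allI impI)
      fix x assume "x \<noteq> (t0, s0)" "x \<in> J \<times> {-\<eta><..<\<eta>}"
      then have "norm (\<Phi> (fst x) (snd x) - \<Phi> (fst x) s0) \<le> B * \<bar>snd x - s0\<bar>"
        using s0 by (intro lip_s) auto
      then show "norm ((case x of (t, s) \<Rightarrow> \<Phi> t s) - \<Phi> t0 s0)
        \<le> B * \<bar>snd x - s0\<bar> + norm (\<Phi> (fst x) s0 - \<Phi> t0 s0)"
        using norm_triangle_ineq[of "\<Phi> (fst x) (snd x) - \<Phi> (fst x) s0" "\<Phi> (fst x) s0 - \<Phi> t0 s0"]
        by (auto simp: case_prod_unfold)
    qed
    have fst: "(fst \<longlongrightarrow> t0) ?F" and snd: "(snd \<longlongrightarrow> s0) ?F"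
      using tendsto_fst[OF tendsto_ident_at, of "(t0, s0)"] tendsto_snd[OF tendsto_ident_at, of "(t0, s0)"] by auto
    have "((\<lambda>x. \<Phi> (fst x) s0) \<longlongrightarrow> \<Phi> t0 s0) ?F"
      using \<open>isCont (\<lambda>t. \<Phi> t s0) t0\<close> fst by (rule isCont_tendsto_compose)
    then show "((\<lambda>x. B * \<bar>snd x - s0\<bar> + norm (\<Phi> (fst x) s0 - \<Phi> t0 s0)) \<longlongrightarrow> 0) ?F"
      using snd by (auto intro!: tendsto_eq_intros)
  qed
  have "((\<lambda>(t, s). \<Phi> t s) has_derivative
      (\<lambda>(dt, ds). dt *\<^sub>R Y (\<Phi> t0 s0) + blinfun_scaleR_left (X (\<Phi> t0 s0)) ds))
      (at (t0, s0) within J \<times> {-\<eta><..<\<eta>})"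
  proof (rule has_derivative_partialsI[where fy = "\<lambda>t s. blinfun_scaleR_left (X (\<Phi> t s))"])
    show "((\<lambda>t. \<Phi> t s0) has_derivative (\<lambda>dt. dt *\<^sub>R Y (\<Phi> t0 s0))) (at t0 within J)"
      using dt[OF J(2) s0] has_derivative_at_withinI unfolding has_vector_derivative_def by blast
    show "(\<Phi> t has_derivative blinfun_scaleR_left (X (\<Phi> t s))) (at s within {-\<eta><..<\<eta>})"
      if "t \<in> J" "s \<in> {-\<eta><..<\<eta>}" for t s
      using flow[OF that] has_derivative_at_withinI unfolding has_vector_derivative_def by force
    have "((\<lambda>(t, s). X (\<Phi> t s)) \<longlongrightarrow> X (\<Phi> t0 s0)) (at (t0, s0) within J \<times> {-\<eta><..<\<eta>})"
    proof -
      have "((\<lambda>p. X (case p of (t, s) \<Rightarrow> \<Phi> t s)) \<longlongrightarrow> X (\<Phi> t0 s0)) (at (t0, s0) within J \<times> {-\<eta><..<\<eta>})"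
        by (rule continuous_on_tendsto_compose[OF contX lim])
          (use flow J s0 in \<open>auto simp: eventually_at_filter intro!: always_eventually\<close>)
      then show ?thesis by (simp add: case_prod_unfold)
    qed
    then show "continuous (at (t0, s0) within J \<times> {-\<eta><..<\<eta>}) (\<lambda>(t, s). blinfun_scaleR_left (X (\<Phi> t s)))"
      unfolding continuous_within
      using bounded_linear.tendsto[OF bounded_linear_blinfun_scaleR_left]
      by (fastforce simp: case_prod_unfold)
  qed (use s0 in auto)
  then have joint: "((\<lambda>(t, s). \<Phi> t s) has_derivative
      (\<lambda>(dt, ds). dt *\<^sub>R Y (\<Phi> t0 s0) + ds *\<^sub>R X (\<Phi> t0 s0))) (at (t0, b t0))"
    unfolding s0_def[symmetric]
    using J s0 by (subst (asm) at_within_open) (auto intro!: open_Times)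
  have pair: "((\<lambda>t. (t, b t)) has_derivative (\<lambda>h. (h, h * b'))) (at t0)"
    using b(1) unfolding has_field_derivative_def by (auto intro!: derivative_eq_intros simp: mult.commute)
  have "((\<lambda>t. \<Phi> t (b t)) has_derivative
      (\<lambda>h. h *\<^sub>R Y (\<Phi> t0 s0) + (h * b') *\<^sub>R X (\<Phi> t0 s0))) (at t0)"
    using has_derivative_compose[OF pair joint] by (simp only: prod.case)
  then show ?thesis
    unfolding has_vector_derivative_def s0_def[symmetric] by (simp add: algebra_simps)
qed

section \<open>Riemannian metrics in coordinates\<close>

lemma smooth_on_D_expand:
  fixes f :: "real ^ 'n::finite \<Rightarrow> 'b::real_normed_vector"
  assumes "open S" "smooth_on f S" "x \<in> S"
  shows "((\<lambda>z. D f z v) has_derivative (\<lambda>h. \<Sum>k\<in>UNIV. v $ k *\<^sub>R D (\<lambda>z. D f z (axis k 1)) x h)) (at x)"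
proof -
  have "((\<lambda>z. \<Sum>k\<in>UNIV. v $ k *\<^sub>R D f z (axis k 1)) has_derivative
      (\<lambda>h. \<Sum>k\<in>UNIV. v $ k *\<^sub>R D (\<lambda>z. D f z (axis k 1)) x h)) (at x)"
    by (rule has_derivative_sum) (rule has_derivative_scaleR_right[OF
        smooth_on_has_derivative[OF smooth_on_D[OF assms(2)] assms(3)]])
  then show ?thesis
    by (rule has_derivative_transform_within_open[OF _ assms(1,3)])
      (rule linear_sum_axis[OF smooth_on_linear_D[OF assms(2)], symmetric])
qed

lemma D_D_expand:
  fixes f :: "real ^ 'n::finite \<Rightarrow> 'b::real_normed_vector"
  assumes "open S" "smooth_on f S" "x \<in> S"
  shows "D (\<lambda>z. D f z v) x h = (\<Sum>k\<in>UNIV. v $ k *\<^sub>R D (\<lambda>z. D f z (axis k 1)) x h)"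
  using frechet_derivative_at[OF smooth_on_D_expand[OF assms]] by (metis (lifting))

text \<open>
  A derivative $Df(x)\,a$ with moving base point and moving direction. It is expanded in the standard
  basis, where only derivatives in constant directions occur.
\<close>

lemma D_has_derivative:
  fixes f :: "real ^ 'n::finite \<Rightarrow> 'b::real_normed_vector" and t :: "'z::real_normed_vector"
  assumes "open S" "smooth_on f S" "x t \<in> S"
    and x: "(x has_derivative x') (at t)" and a: "(a has_derivative a') (at t)"
  shows "((\<lambda>t. D f (x t) (a t)) has_derivative
     (\<lambda>h. D (\<lambda>z. D f z (a t)) (x t) (x' h) + D f (x t) (a' h))) (at t)"
proof -
  have *: "((\<lambda>t. D f (x t) (axis k 1)) has_derivative (\<lambda>h. D (\<lambda>z. D f z (axis k 1)) (x t) (x' h))) (at t)" for k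
    by (rule has_derivative_compose[OF x])
      (rule smooth_on_has_derivative[OF smooth_on_D[OF assms(2)] assms(3)])
  have ak: "((\<lambda>t. a t $ k) has_derivative (\<lambda>h. a' h $ k)) (at t)" for k
    using bounded_linear.has_derivative[OF bounded_linear_vec_nth a] .
  have "((\<lambda>t. \<Sum>k\<in>UNIV. a t $ k *\<^sub>R D f (x t) (axis k 1)) has_derivative
      (\<lambda>h. \<Sum>k\<in>UNIV. a t $ k *\<^sub>R D (\<lambda>z. D f z (axis k 1)) (x t) (x' h) + a' h $ k *\<^sub>R D f (x t) (axis k 1))) (at t)"
    by (rule has_derivative_sum, rule has_derivative_scaleR[OF ak *])
  moreover have "(\<lambda>h. \<Sum>k\<in>UNIV. a t $ k *\<^sub>R D (\<lambda>z. D f z (axis k 1)) (x t) (x' h) + a' h $ k *\<^sub>R D f (x t) (axis k 1))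
     = (\<lambda>h. D (\<lambda>z. D f z (a t)) (x t) (x' h) + D f (x t) (a' h))"
    unfolding D_D_expand[OF assms(1-3), of "a t"] linear_sum_axis[OF smooth_on_linear_D[OF assms(2,3)], of "a' _"]
    by (simp add: sum.distrib)
  ultimately have 1: "((\<lambda>t. \<Sum>k\<in>UNIV. a t $ k *\<^sub>R D f (x t) (axis k 1)) has_derivative
     (\<lambda>h. D (\<lambda>z. D f z (a t)) (x t) (x' h) + D f (x t) (a' h))) (at t)" by (rule has_derivative_eq_rhs)
  have "isCont x t" using x has_derivative_continuous by blast
  then have "\<forall>\<^sub>F s in at t. x s \<in> S"
    using assms(1,3) unfolding continuous_at by (intro topological_tendstoD)
  then have ev: "\<forall>\<^sub>F s in at t. (\<Sum>k\<in>UNIV. a s $ k *\<^sub>R D f (x s) (axis k 1)) = D f (x s) (a s)"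
    by (rule eventually_mono) (rule linear_sum_axis[OF smooth_on_linear_D[OF assms(2)], symmetric])
  show ?thesis
    by (rule has_derivative_transform_eventually[OF 1 ev])
      (rule linear_sum_axis[OF smooth_on_linear_D[OF assms(2,3)], symmetric], simp)
qed

lemma continuous_on_D:
  fixes f :: "real ^ 'n::finite \<Rightarrow> 'b::real_normed_vector"
  assumes "smooth_on f S" "continuous_on T x" "continuous_on T a" "x ` T \<subseteq> S"
  shows "continuous_on T (\<lambda>t. D f (x t) (a t))"
proof -
  have "continuous_on T (\<lambda>t. \<Sum>k\<in>UNIV. a t $ k *\<^sub>R D f (x t) (axis k 1))"
    by (intro continuous_intros assms
        continuous_on_compose2[OF smooth_on_continuous_on[OF smooth_on_D[OF assms(1)]] assms(2)])
  then show ?thesis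
    by (rule continuous_on_eq) (use assms(4) linear_sum_axis[OF smooth_on_linear_D[OF assms(1)], symmetric] in blast)
qed

lemma continuous_on_D_D:
  fixes f :: "real ^ 'n::finite \<Rightarrow> 'b::real_normed_vector"
  assumes "open S" "smooth_on f S" "continuous_on T x" "continuous_on T a" "continuous_on T b" "x ` T \<subseteq> S"
  shows "continuous_on T (\<lambda>t. D (\<lambda>z. D f z (a t)) (x t) (b t))"
proof -
  have "continuous_on T (\<lambda>t. \<Sum>k\<in>UNIV. a t $ k *\<^sub>R D (\<lambda>z. D f z (axis k 1)) (x t) (b t))"
    by (intro continuous_intros assms continuous_on_D[OF smooth_on_D[OF assms(2)]])
  then show ?thesis
    by (rule continuous_on_eq) (use assms(6) D_D_expand[OF assms(1,2), symmetric] in blast)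
qed

lemma differentiable_det:
  fixes A :: "'z::real_normed_vector \<Rightarrow> real ^ 'n ^ 'n::finite"
  assumes "\<And>i j. (\<lambda>t. A t $ i $ j) differentiable (at t)"
  shows "(\<lambda>t. det (A t)) differentiable (at t)"
proof -
  have "\<exists>A'. \<forall>i j. ((\<lambda>t. A t $ i $ j) has_derivative A' i j) (at t)"
    using assms unfolding differentiable_def by metis
  then obtain A' where A': "\<And>i j. ((\<lambda>t. A t $ i $ j) has_derivative A' i j) (at t)" by blast
  show ?thesis
    unfolding det_def differentiable_def
    by (rule exI, rule has_derivative_sum, rule has_derivative_mult_right, rule has_derivative_prod, rule A')
qed

lemma differentiable_vec_componentwise:
  fixes f :: "'z::real_normed_vector \<Rightarrow> real ^ 'n::finite"
  assumes "\<And>i. (\<lambda>t. f t $ i) differentiable (at t)"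
  shows "f differentiable (at t)"
proof -
  obtain f' where "\<And>i. ((\<lambda>t. f t $ i) has_derivative f' i) (at t)"
    using assms unfolding differentiable_def by metis
  then have "((\<lambda>t. \<Sum>i\<in>UNIV. f t $ i *\<^sub>R (axis i 1 :: real ^ 'n)) has_derivative (\<lambda>h. \<Sum>i\<in>UNIV. f' i h *\<^sub>R axis i 1)) (at t)"
    by (intro has_derivative_sum has_derivative_scaleR_left)
  moreover have "(\<lambda>t. \<Sum>i\<in>UNIV. f t $ i *\<^sub>R (axis i 1 :: real ^ 'n)) = f"
    using basis_expansion[where 'a = real] by (auto simp: scalar_mult_eq_scaleR fun_eq_iff)
  ultimately show ?thesis unfolding differentiable_def by auto
qed

locale local_metric =
  fixes S :: "(real ^ 'n::finite) set" and g :: "'n \<Rightarrow> 'n \<Rightarrow> real ^ 'n \<Rightarrow> real"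
  assumes open_S: "open S"
    and smooth_g: "\<And>i j. smooth_on (g i j) S"
    and sym_g: "\<And>i j x. x \<in> S \<Longrightarrow> g i j x = g j i x"
    and pos_g: "\<And>x u. x \<in> S \<Longrightarrow> u \<noteq> 0 \<Longrightarrow> (\<Sum>i\<in>UNIV. \<Sum>j\<in>UNIV. g i j x * u $ i * u $ j) > 0"
begin

definition H :: "real ^ 'n \<Rightarrow> real ^ 'n \<Rightarrow> real ^ 'n \<Rightarrow> real" where
  "H x u v = (\<Sum>i\<in>UNIV. \<Sum>j\<in>UNIV. g i j x * u $ i * v $ j)"

text \<open>
  The derivative of the metric in the direction $a$ for arguments $u$, $v$ with constant components.
\<close>

definition dH :: "real ^ 'n \<Rightarrow> real ^ 'n \<Rightarrow> real ^ 'n \<Rightarrow> real ^ 'n \<Rightarrow> real" where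
  "dH x a u v = (\<Sum>i\<in>UNIV. \<Sum>j\<in>UNIV. D (g i j) x a * u $ i * v $ j)"

definition ddH :: "real ^ 'n \<Rightarrow> real ^ 'n \<Rightarrow> real ^ 'n \<Rightarrow> real ^ 'n \<Rightarrow> real ^ 'n \<Rightarrow> real" where
  "ddH x a b u v = (\<Sum>i\<in>UNIV. \<Sum>j\<in>UNIV. D (\<lambda>z. D (g i j) z a) x b * u $ i * v $ j)"

lemma H_linear:
  "H x (u + u') v = H x u v + H x u' v" "H x u (v + v') = H x u v + H x u v'"
  "H x (u - u') v = H x u v - H x u' v" "H x u (v - v') = H x u v - H x u v'"
  "H x (c *\<^sub>R u) v = c * H x u v" "H x u (c *\<^sub>R v) = c * H x u v"
  "H x (- u) v = - H x u v" "H x u (- v) = - H x u v"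
  "H x 0 v = 0" "H x u 0 = 0"
  unfolding H_def by (simp_all add: algebra_simps sum.distrib sum_subtractf sum_negf sum_distrib_left)

lemma dH_linear:
  "dH x a (u + u') v = dH x a u v + dH x a u' v" "dH x a u (v + v') = dH x a u v + dH x a u v'"
  "dH x a (u - u') v = dH x a u v - dH x a u' v" "dH x a u (v - v') = dH x a u v - dH x a u v'"
  "dH x a (c *\<^sub>R u) v = c * dH x a u v" "dH x a u (c *\<^sub>R v) = c * dH x a u v"
  unfolding dH_def by (simp_all add: algebra_simps sum.distrib sum_subtractf sum_negf sum_distrib_left)

lemma dH_linear_direction:
  assumes "x \<in> S"
  shows "dH x (a + b) u v = dH x a u v + dH x b u v" "dH x (a - b) u v = dH x a u v - dH x b u v"
    "dH x (c *\<^sub>R a) u v = c * dH x a u v"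
  using smooth_on_linear_D[OF smooth_g assms] unfolding dH_def
  by (simp_all add: linear_add linear_diff linear_cmul algebra_simps sum.distrib sum_subtractf sum_distrib_left)

lemma H_sym: "x \<in> S \<Longrightarrow> H x u v = H x v u"
  unfolding H_def by (subst sum.swap) (simp add: sym_g mult_ac)

lemma dH_sym: assumes "x \<in> S" shows "dH x a u v = dH x a v u"
proof -
  have "D (g i j) x = D (g j i) x" for i j
    by (rule frechet_derivative_transform_within_open[OF _ open_S assms])
      (use smooth_on_has_derivative[OF smooth_g assms] sym_g in \<open>auto simp: differentiable_def\<close>)
  then show ?thesis unfolding dH_def by (subst sum.swap) (simp add: mult_ac)
qed

lemma ddH_commute: "x \<in> S \<Longrightarrow> ddH x a b u v = ddH x b a u v"
  unfolding ddH_def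
  by (simp add: smooth_on_symmetric_second_derivative[OF open_S smooth_g, where u = a and v = b])

lemma H_pos: "x \<in> S \<Longrightarrow> u \<noteq> 0 \<Longrightarrow> H x u u > 0"
  unfolding H_def by (rule pos_g)

lemma H_nonneg: "x \<in> S \<Longrightarrow> H x u u \<ge> 0"
  using H_pos[of x u] by (cases "u = 0") (auto simp: H_linear)

lemma H_nondegenerate: assumes "x \<in> S" "\<And>z. H x u z = H x v z" shows "u = v"
proof -
  have "H x (u - v) (u - v) = 0" using assms(2)[of "u - v"] by (simp add: H_linear)
  then show ?thesis using H_pos[OF assms(1), of "u - v"] by force
qed

lemma H_cauchy_schwarz: assumes "x \<in> S" shows "(H x u v)\<^sup>2 \<le> H x u u * H x v v"
proof (cases "v = 0")
  case True then show ?thesis by (simp add: H_linear)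
next
  case False
  let ?c = "H x u v / H x v v"
  have v: "H x v v > 0" using H_pos assms False by blast
  have "0 \<le> H x (u - ?c *\<^sub>R v) (u - ?c *\<^sub>R v)" by (rule H_nonneg[OF assms])
  also have "\<dots> = H x u u - (H x u v)\<^sup>2 / H x v v"
    using v H_sym[OF assms, of v u] by (simp add: H_linear field_simps power2_eq_square)
  finally show ?thesis using v by (simp add: field_simps)
qed

lemma H_has_derivative:
  fixes t :: "'z::real_normed_vector"
  assumes "x t \<in> S" and x: "(x has_derivative x') (at t)"
    and u: "(u has_derivative u') (at t)" and v: "(v has_derivative v') (at t)"
  shows "((\<lambda>t. H (x t) (u t) (v t)) has_derivative
     (\<lambda>h. dH (x t) (x' h) (u t) (v t) + H (x t) (u' h) (v t) + H (x t) (u t) (v' h))) (at t)"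
proof -
  have g: "((\<lambda>t. g i j (x t)) has_derivative (\<lambda>h. D (g i j) (x t) (x' h))) (at t)" for i j
    by (rule has_derivative_compose[OF x]) (rule smooth_on_has_derivative[OF smooth_g assms(1)])
  have uv: "((\<lambda>t. u t $ i) has_derivative (\<lambda>h. u' h $ i)) (at t)"
     "((\<lambda>t. v t $ i) has_derivative (\<lambda>h. v' h $ i)) (at t)" for i
    using bounded_linear.has_derivative[OF bounded_linear_vec_nth u]
      bounded_linear.has_derivative[OF bounded_linear_vec_nth v] by auto
  have "((\<lambda>t. g i j (x t) * u t $ i * v t $ j) has_derivative (\<lambda>h. D (g i j) (x t) (x' h) * u t $ i * v t $ j
      + g i j (x t) * u' h $ i * v t $ j + g i j (x t) * u t $ i * v' h $ j)) (at t)" for i j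
    by (rule has_derivative_eq_rhs[OF has_derivative_mult[OF has_derivative_mult[OF g uv(1)] uv(2)]])
      (simp add: fun_eq_iff algebra_simps)
  from has_derivative_sum[OF has_derivative_sum[OF this]]
  show ?thesis unfolding H_def dH_def
    by (rule has_derivative_eq_rhs) (simp add: fun_eq_iff sum.distrib)
qed

lemma dH_has_derivative:
  fixes t :: "'z::real_normed_vector"
  assumes "x t \<in> S" and x: "(x has_derivative x') (at t)" and a: "(a has_derivative a') (at t)"
    and u: "(u has_derivative u') (at t)" and v: "(v has_derivative v') (at t)"
  shows "((\<lambda>t. dH (x t) (a t) (u t) (v t)) has_derivative
     (\<lambda>h. ddH (x t) (a t) (x' h) (u t) (v t) + dH (x t) (a' h) (u t) (v t)
        + dH (x t) (a t) (u' h) (v t) + dH (x t) (a t) (u t) (v' h))) (at t)"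
proof -
  have uv: "((\<lambda>t. u t $ i) has_derivative (\<lambda>h. u' h $ i)) (at t)"
     "((\<lambda>t. v t $ i) has_derivative (\<lambda>h. v' h $ i)) (at t)" for i
    using bounded_linear.has_derivative[OF bounded_linear_vec_nth u]
      bounded_linear.has_derivative[OF bounded_linear_vec_nth v] by auto
  have "((\<lambda>t. D (g i j) (x t) (a t) * u t $ i * v t $ j) has_derivative
      (\<lambda>h. D (\<lambda>z. D (g i j) z (a t)) (x t) (x' h) * u t $ i * v t $ j + D (g i j) (x t) (a' h) * u t $ i * v t $ j
      + D (g i j) (x t) (a t) * u' h $ i * v t $ j + D (g i j) (x t) (a t) * u t $ i * v' h $ j)) (at t)" for i j
    by (rule has_derivative_eq_rhs[OF has_derivative_mult[OF has_derivative_mult[OF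
          D_has_derivative[OF open_S smooth_g assms(1) x a] uv(1)] uv(2)]])
      (simp add: fun_eq_iff algebra_simps)
  from has_derivative_sum[OF has_derivative_sum[OF this]]
  show ?thesis unfolding dH_def ddH_def
    by (rule has_derivative_eq_rhs) (simp add: fun_eq_iff sum.distrib)
qed

definition gmat :: "real ^ 'n \<Rightarrow> real ^ 'n ^ 'n" where
  "gmat x = (\<chi> a b. g a b x)"

lemma H_eq_gmat: "H x u v = (gmat x *v v) \<bullet> u"
  unfolding H_def gmat_def matrix_vector_mult_def inner_vec_def
  by (simp add: sum_distrib_left sum_distrib_right mult_ac)

lemma invertible_gmat: assumes "x \<in> S" shows "invertible (gmat x)"
proof -
  have "v = 0" if "gmat x *v v = 0" for v
    using H_pos[OF assms, of v] that by (force simp: H_eq_gmat)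
  then show ?thesis unfolding invertible_left_inverse matrix_left_invertible_ker by blast
qed

definition christoffel_symbol :: "'n \<Rightarrow> 'n \<Rightarrow> 'n \<Rightarrow> real ^ 'n \<Rightarrow> real" where
  "christoffel_symbol i j k x = (1/2) * (\<Sum>l\<in>UNIV. matrix_inv (\<chi> a b. g a b x) $ i $ l *
        (partial j (g l k) x + partial k (g l j) x - partial l (g j k) x))"

text \<open>
  The vector $\Gamma^i{}_{jk} u^j v^k$.
\<close>

definition Gam :: "real ^ 'n \<Rightarrow> real ^ 'n \<Rightarrow> real ^ 'n \<Rightarrow> real ^ 'n" where
  "Gam x u v = (\<chi> i. \<Sum>j\<in>UNIV. \<Sum>k\<in>UNIV. christoffel_symbol i j k x * u $ j * v $ k)"

definition christoffel_first_kind :: "real ^ 'n \<Rightarrow> real ^ 'n \<Rightarrow> real ^ 'n \<Rightarrow> real ^ 'n" where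
  "christoffel_first_kind x u v = (\<chi> l. (dH x u v (axis l 1) + dH x v u (axis l 1) - dH x (axis l 1) u v) / 2)"

lemma Gam_eq_matrix_inv:
  assumes "x \<in> S" shows "Gam x u v = matrix_inv (gmat x) *v christoffel_first_kind x u v"
proof -
  have dif: "g i j differentiable (at x)" for i j
    using smooth_on_has_derivative[OF smooth_g assms] differentiableI by blast
  have gs: "partial k (g i j) x = partial k (g j i) x" for i j k
  proof -
    have "D (g i j) x = D (g j i) x"
      by (rule frechet_derivative_transform_within_open[OF dif open_S assms]) (use sym_g in auto)
    then show ?thesis by (simp add: partial_eq_D[OF dif])
  qed
  have ax: "(\<Sum>j\<in>UNIV. c j * axis l 1 $ j) = c l" for c :: "'n \<Rightarrow> real" and l
    by (simp add: axis_def if_distrib cong: if_cong)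
  have low: "christoffel_first_kind x u v $ l = (\<Sum>j\<in>UNIV. \<Sum>k\<in>UNIV.
      (partial j (g l k) x + partial k (g l j) x - partial l (g j k) x) / 2 * u $ j * v $ k)" for l
  proof -
    have 1: "dH x u v (axis l 1) = (\<Sum>j\<in>UNIV. \<Sum>k\<in>UNIV. partial j (g l k) x * u $ j * v $ k)"
    proof -
      have "dH x u v (axis l 1) = (\<Sum>k\<in>UNIV. D (g k l) x u * v $ k)"
        unfolding dH_def ax ..
      also have "\<dots> = (\<Sum>k\<in>UNIV. \<Sum>j\<in>UNIV. partial j (g l k) x * u $ j * v $ k)"
        unfolding D_eq_sum_partial[OF dif] sum_distrib_right by (simp add: gs[of _ _ l] mult_ac)
      finally show ?thesis by (subst sum.swap)
    qed
    have 2: "dH x v u (axis l 1) = (\<Sum>j\<in>UNIV. \<Sum>k\<in>UNIV. partial k (g l j) x * u $ j * v $ k)"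
    proof -
      have "dH x v u (axis l 1) = (\<Sum>j\<in>UNIV. D (g j l) x v * u $ j)"
        unfolding dH_def ax ..
      also have "\<dots> = (\<Sum>j\<in>UNIV. \<Sum>k\<in>UNIV. partial k (g l j) x * u $ j * v $ k)"
        unfolding D_eq_sum_partial[OF dif] sum_distrib_right by (simp add: gs[of _ _ l] mult_ac)
      finally show ?thesis .
    qed
    have 3: "dH x (axis l 1) u v = (\<Sum>j\<in>UNIV. \<Sum>k\<in>UNIV. partial l (g j k) x * u $ j * v $ k)"
      unfolding dH_def by (simp add: partial_eq_D[OF dif])
    show ?thesis
      unfolding christoffel_first_kind_def by (simp add: 1 2 3 algebra_simps sum.distrib sum_subtractf sum_divide_distrib
          add_divide_distrib diff_divide_distrib)
  qed
  show ?thesis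
  proof (rule vec_eq_iff[THEN iffD2], intro allI)
    fix i
    have "Gam x u v $ i = (\<Sum>j\<in>UNIV. \<Sum>k\<in>UNIV. \<Sum>l\<in>UNIV. matrix_inv (gmat x) $ i $ l *
      ((partial j (g l k) x + partial k (g l j) x - partial l (g j k) x) / 2 * u $ j * v $ k))"
      unfolding Gam_def christoffel_symbol_def gmat_def by (simp add: sum_distrib_left sum_distrib_right mult_ac)
    also have "\<dots> = (\<Sum>j\<in>UNIV. \<Sum>l\<in>UNIV. \<Sum>k\<in>UNIV. matrix_inv (gmat x) $ i $ l *
      ((partial j (g l k) x + partial k (g l j) x - partial l (g j k) x) / 2 * u $ j * v $ k))"
      by (intro sum.cong refl sum.swap)
    also have "\<dots> = (\<Sum>l\<in>UNIV. \<Sum>j\<in>UNIV. \<Sum>k\<in>UNIV. matrix_inv (gmat x) $ i $ l *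
      ((partial j (g l k) x + partial k (g l j) x - partial l (g j k) x) / 2 * u $ j * v $ k))"
      by (rule sum.swap)
    also have "\<dots> = (matrix_inv (gmat x) *v christoffel_first_kind x u v) $ i"
      unfolding matrix_vector_mult_def low by (simp add: sum_distrib_left)
    finally show "Gam x u v $ i = (matrix_inv (gmat x) *v christoffel_first_kind x u v) $ i" .
  qed
qed

lemma gmat_Gam: assumes "x \<in> S" shows "gmat x *v Gam x u v = christoffel_first_kind x u v"
proof -
  have "gmat x ** matrix_inv (gmat x) = mat 1"
    using invertible_gmat[OF assms] unfolding invertible_def matrix_inv_def by (metis (mono_tags, lifting) someI_ex)
  then show ?thesis by (simp add: Gam_eq_matrix_inv[OF assms] matrix_vector_mul_assoc)
qed

text \<open>
  The form in which Christoffel symbols are used throughout: lowering the index removes the inverse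
  matrix, and nondegeneracy of the metric recovers the vector from its products.
\<close>

lemma H_Gam: assumes "x \<in> S"
  shows "H x (Gam x u v) z = (dH x u v z + dH x v u z - dH x z u v) / 2"
proof -
  have lin: "linear (\<lambda>z. (dH x u v z + dH x v u z - dH x z u v) / 2)"
    by (intro linearI) (simp_all add: dH_linear dH_linear_direction[OF assms] algebra_simps add_divide_distrib diff_divide_distrib)
  have "H x (Gam x u v) z = christoffel_first_kind x u v \<bullet> z"
    using H_sym[OF assms, of "Gam x u v" z] by (simp add: H_eq_gmat gmat_Gam[OF assms])
  also have "\<dots> = (\<Sum>l\<in>UNIV. z $ l *\<^sub>R christoffel_first_kind x u v $ l)"
    by (simp add: inner_vec_def mult.commute)
  also have "\<dots> = (dH x u v z + dH x v u z - dH x z u v) / 2"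
    unfolding christoffel_first_kind_def using linear_sum_axis[OF lin, of z] by simp
  finally show ?thesis .
qed

text \<open>
  Cramer's rule expresses the solution of $g\,\Gamma = $ (symbols of the first kind) rationally in
  differentiable quantities.
\<close>

lemma Gam_differentiable:
  fixes x u v :: "'z::real_normed_vector \<Rightarrow> real ^ 'n"
  assumes "x t \<in> S" and x: "x differentiable (at t)" and u: "u differentiable (at t)" and v: "v differentiable (at t)"
  shows "(\<lambda>t. Gam (x t) (u t) (v t)) differentiable (at t)"
proof -
  note d = x[unfolded frechet_derivative_works] u[unfolded frechet_derivative_works] v[unfolded frechet_derivative_works]
  have gd: "(\<lambda>s. gmat (x s) $ i $ j) differentiable (at t)" for i j
  proof -
    have "((\<lambda>t. g i j (x t)) has_derivative (\<lambda>h. D (g i j) (x t) (D x t h))) (at t)"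
      by (rule has_derivative_compose[OF d(1)]) (rule smooth_on_has_derivative[OF smooth_g assms(1)])
    then show ?thesis unfolding gmat_def differentiable_def by auto
  qed
  have ld: "(\<lambda>s. christoffel_first_kind (x s) (u s) (v s) $ l) differentiable (at t)" for l
  proof -
    have "(\<lambda>s. dH (x s) (u s) (v s) (axis l 1)) differentiable (at t)"
      "(\<lambda>s. dH (x s) (v s) (u s) (axis l 1)) differentiable (at t)"
      "(\<lambda>s. dH (x s) (axis l 1) (u s) (v s)) differentiable (at t)"
      using dH_has_derivative[OF assms(1) d(1) d(2) d(3) has_derivative_const]
        dH_has_derivative[OF assms(1) d(1) d(3) d(2) has_derivative_const]
        dH_has_derivative[OF assms(1) d(1) has_derivative_const d(2) d(3)]
      by (blast intro: differentiableI)+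
    then show ?thesis
      unfolding christoffel_first_kind_def vec_lambda_beta
      by (intro differentiable_divide differentiable_diff differentiable_add differentiable_const) auto
  qed
  have det0: "det (gmat y) \<noteq> 0" if "y \<in> S" for y
    using invertible_gmat[OF that] invertible_det_nz by blast
  let ?C = "\<lambda>s k. det (\<chi> i j. if j = k then christoffel_first_kind (x s) (u s) (v s) $ i else gmat (x s) $ i $ j) / det (gmat (x s))"
  have "(\<lambda>s. if j = k then christoffel_first_kind (x s) (u s) (v s) $ i else gmat (x s) $ i $ j) differentiable (at t)" for i j k
    using gd ld by (cases "j = k") auto
  then have Cd: "(\<lambda>s. ?C s k) differentiable (at t)" for k
    using det0[OF assms(1)] gd by (intro differentiable_divide differentiable_det) auto
  have C: "Gam (x s) (u s) (v s) = (\<chi> k. ?C s k)" if "x s \<in> S" for s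
    using cramer[OF det0[OF that]] gmat_Gam[OF that] by blast
  have "isCont x t" using d(1) has_derivative_continuous by blast
  then have ev: "\<forall>\<^sub>F s in at t. x s \<in> S"
    using assms(1) open_S unfolding continuous_at by (intro topological_tendstoD)
  have "(\<lambda>s. \<chi> k. ?C s k) differentiable (at t)"
    by (rule differentiable_vec_componentwise) (use Cd in simp)
  then obtain G' where G': "((\<lambda>s. \<chi> k. ?C s k) has_derivative G') (at t)"
    unfolding differentiable_def by blast
  have "((\<lambda>t. Gam (x t) (u t) (v t)) has_derivative G') (at t)"
    by (rule has_derivative_transform_eventually[OF G' eventually_mono[OF ev]])
      (use C assms(1) in auto)
  then show ?thesis by (rule differentiableI)
qed

end

section \<open>Homotheties in coordinates\<close>

lemma bilinear_eq_on_axes: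
  fixes B B' :: "real ^ 'n::finite \<Rightarrow> real ^ 'n \<Rightarrow> real"
  assumes "\<And>v. linear (\<lambda>u. B u v)" "\<And>u. linear (B u)" "\<And>v. linear (\<lambda>u. B' u v)" "\<And>u. linear (B' u)"
    and "\<And>i j. B (axis i 1) (axis j 1) = B' (axis i 1) (axis j 1)"
  shows "B u v = B' u v"
proof -
  have "B (axis i 1) v = B' (axis i 1) v" for i
    using linear_sum_axis[OF assms(2), of "axis i 1" v] linear_sum_axis[OF assms(4), of "axis i 1" v] assms(5) by simp
  then show ?thesis
    using linear_sum_axis[OF assms(1), of u v] linear_sum_axis[OF assms(3), of u v] by simp
qed

locale local_homothety = local_metric S g for S :: "(real ^ 'n::finite) set" and g +
  fixes w :: "real ^ 'n \<Rightarrow> real ^ 'n" and \<sigma> :: real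
  assumes smooth_w: "smooth_on w S"
    and lie_g: "\<And>x i j. x \<in> S \<Longrightarrow> (\<Sum>k\<in>UNIV. w x $ k * partial k (g i j) x
        + g k j x * partial i (\<lambda>z. w z $ k) x + g i k x * partial j (\<lambda>z. w z $ k) x) = \<sigma> * g i j x"
begin

lemma H_axis: "H x u (axis j 1) = (\<Sum>k\<in>UNIV. g k j x * u $ k)" "H x (axis i 1) v = (\<Sum>k\<in>UNIV. g i k x * v $ k)"
proof -
  have ax: "(\<Sum>j\<in>UNIV. c j * axis l 1 $ j) = c l" for c :: "'n \<Rightarrow> real" and l
    by (simp add: axis_def if_distrib cong: if_cong)
  show "H x u (axis j 1) = (\<Sum>k\<in>UNIV. g k j x * u $ k)" unfolding H_def ax ..
  have "H x (axis i 1) v = (\<Sum>j\<in>UNIV. \<Sum>k\<in>UNIV. (g k j x * v $ j) * axis i 1 $ k)"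
    unfolding H_def by (subst sum.swap) (simp add: mult_ac)
  then show "H x (axis i 1) v = (\<Sum>k\<in>UNIV. g i k x * v $ k)" unfolding ax .
qed

text \<open>
  The equation $\mathcal L_W h = \sigma h$ without indices.
\<close>

lemma homothety: assumes "x \<in> S"
  shows "dH x (w x) u v + H x (D w x u) v + H x u (D w x v) = \<sigma> * H x u v"
proof (rule bilinear_eq_on_axes[where B = "\<lambda>u v. dH x (w x) u v + H x (D w x u) v + H x u (D w x v)"])
  have lin: "linear (D w x)" by (rule smooth_on_linear_D[OF smooth_w assms])
  show "linear (\<lambda>u. dH x (w x) u v + H x (D w x u) v + H x u (D w x v))"
    "linear (\<lambda>v. dH x (w x) u v + H x (D w x u) v + H x u (D w x v))" for u v
    by (intro linearI; simp add: H_linear dH_linear linear_add[OF lin] linear_cmul[OF lin] algebra_simps)+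
  show "linear (\<lambda>u. \<sigma> * H x u v)" "linear (\<lambda>v. \<sigma> * H x u v)" for u v
    by (intro linearI; simp add: H_linear algebra_simps)+
  fix i j
  have dif: "g i j differentiable (at x)"
    using smooth_on_has_derivative[OF smooth_g assms] differentiableI by blast
  have w: "((\<lambda>z. w z $ k) has_derivative (\<lambda>h. D w x h $ k)) (at x)" for k
    using bounded_linear.has_derivative[OF bounded_linear_vec_nth smooth_on_has_derivative[OF smooth_w assms]] .
  have pw: "partial i (\<lambda>z. w z $ k) x = D w x (axis i 1) $ k" for i k
    using partial_eq_D[OF differentiableI[OF w]] frechet_derivative_at[OF w] by metis
  have ax: "(\<Sum>j\<in>UNIV. c j * axis l 1 $ j) = c l" for c :: "'n \<Rightarrow> real" and l
    by (simp add: axis_def if_distrib cong: if_cong)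
  have "dH x (w x) (axis i 1) (axis j 1) = D (g i j) x (w x)"
    unfolding dH_def ax ..
  then have "dH x (w x) (axis i 1) (axis j 1) = (\<Sum>k\<in>UNIV. w x $ k * partial k (g i j) x)"
    by (simp add: D_eq_sum_partial[OF dif])
  moreover have "H x (axis i 1) (axis j 1) = g i j x" unfolding H_def ax ..
  ultimately show "dH x (w x) (axis i 1) (axis j 1) + H x (D w x (axis i 1)) (axis j 1)
      + H x (axis i 1) (D w x (axis j 1)) = \<sigma> * H x (axis i 1) (axis j 1)"
    using lie_g[OF assms, of i j] by (simp add: H_axis pw sum.distrib)
qed

text \<open>
  From the homothety equation by differentiation in the direction $b$; two instances of it express
  the invariance of the connection under the flow.
\<close>

lemma homothety_derivative: assumes "x \<in> S"
  shows "ddH x (w x) b u v + dH x (D w x b) u v + dH x b (D w x u) v + H x (D (\<lambda>z. D w z u) x b) v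
    + dH x b u (D w x v) + H x u (D (\<lambda>z. D w z v) x b) = \<sigma> * dH x b u v"
proof -
  have w: "(w has_derivative D w x) (at x)" "((\<lambda>z. D w z u) has_derivative D (\<lambda>z. D w z u) x) (at x)" for u
    by (rule smooth_on_has_derivative[OF _ assms], intro smooth_on_D smooth_w)+
  have 1: "((\<lambda>x. dH x (w x) u v + H x (D w x u) v + H x u (D w x v)) has_derivative
    (\<lambda>b. (ddH x (w x) b u v + dH x (D w x b) u v + dH x (w x) 0 v + dH x (w x) u 0)
      + (dH x b (D w x u) v + H x (D (\<lambda>z. D w z u) x b) v + H x (D w x u) 0)
      + (dH x b u (D w x v) + H x 0 (D w x v) + H x u (D (\<lambda>z. D w z v) x b)))) (at x)"
    by (intro has_derivative_add dH_has_derivative H_has_derivative assms w has_derivative_ident has_derivative_const)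
  have 2: "((\<lambda>x. \<sigma> * H x u v) has_derivative (\<lambda>b. \<sigma> * (dH x b u v + H x 0 v + H x u 0))) (at x)"
    by (intro has_derivative_mult_right H_has_derivative assms has_derivative_ident has_derivative_const)
  have "((\<lambda>x. dH x (w x) u v + H x (D w x u) v + H x u (D w x v)) has_derivative
     (\<lambda>b. \<sigma> * (dH x b u v + H x 0 v + H x u 0))) (at x)"
    by (rule has_derivative_transform_within_open[OF 2 open_S assms]) (rule homothety[symmetric])
  from has_derivative_unique[OF 1 this] have "(ddH x (w x) b u v + dH x (D w x b) u v + dH x (w x) 0 v + dH x (w x) u 0)
      + (dH x b (D w x u) v + H x (D (\<lambda>z. D w z u) x b) v + H x (D w x u) 0)
      + (dH x b u (D w x v) + H x 0 (D w x v) + H x u (D (\<lambda>z. D w z v) x b))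
      = \<sigma> * (dH x b u v + H x 0 v + H x u 0)"
    by meson
  moreover have "dH x (w x) 0 v = 0" "dH x (w x) u 0 = 0"
    using dH_linear(5)[of x "w x" 0 0 v] dH_linear(6)[of x "w x" u 0 0] by auto
  ultimately show ?thesis by (simp add: H_linear)
qed

text \<open>
  The complete lift of $w$ to the tangent bundle: the field generated by the differential of the flow
  of $w$.
\<close>

definition complete_lift :: "(real ^ 'n) \<times> (real ^ 'n) \<Rightarrow> (real ^ 'n) \<times> (real ^ 'n)" where
  "complete_lift p = (w (fst p), D w (fst p) (snd p))"

definition complete_lift' :: "(real ^ 'n) \<times> (real ^ 'n) \<Rightarrow> (real ^ 'n) \<times> (real ^ 'n) \<Rightarrow> (real ^ 'n) \<times> (real ^ 'n)" where
  "complete_lift' p q = (D w (fst p) (fst q), D (\<lambda>z. D w z (snd p)) (fst p) (fst q) + D w (fst p) (snd q))"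

text \<open>
  The geodesic spray with a damping term. Along its integral curves $y = \dot x$ and
  $h(y,y)$ is proportional to $e^{-\sigma t}$.
\<close>

definition damped_spray :: "(real ^ 'n) \<times> (real ^ 'n) \<Rightarrow> (real ^ 'n) \<times> (real ^ 'n)" where
  "damped_spray p = (snd p, - Gam (fst p) (snd p) (snd p) - (\<sigma> / 2) *\<^sub>R snd p)"

lemma lift_has_derivative: assumes "p \<in> S \<times> UNIV" shows "(complete_lift has_derivative complete_lift' p) (at p)"
proof -
  have p: "fst p \<in> S" using assms by auto
  have "((\<lambda>p. w (fst p)) has_derivative (\<lambda>q. D w (fst p) (fst q))) (at p)"
    by (rule has_derivative_compose[OF has_derivative_fst[OF has_derivative_ident]])
      (rule smooth_on_has_derivative[OF smooth_w p])
  moreover have "((\<lambda>p. D w (fst p) (snd p)) has_derivative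
      (\<lambda>q. D (\<lambda>z. D w z (snd p)) (fst p) (fst q) + D w (fst p) (snd q))) (at p)"
    by (rule D_has_derivative[OF open_S smooth_w p has_derivative_fst[OF has_derivative_ident]
          has_derivative_snd[OF has_derivative_ident]])
  ultimately show ?thesis
    unfolding complete_lift_def[abs_def] complete_lift'_def[abs_def] by (rule has_derivative_Pair)
qed

lemma lift'_continuous: "continuous_on (S \<times> UNIV) (\<lambda>p. complete_lift' p q)"
  unfolding complete_lift'_def
  by (intro continuous_intros continuous_on_D[OF smooth_w] continuous_on_D_D[OF open_S smooth_w]) auto

lemma spray_has_derivative:
  assumes "p \<in> S \<times> UNIV" shows "(damped_spray has_derivative D damped_spray p) (at p)"
proof -
  have "(\<lambda>p. Gam (fst p) (snd p) (snd p)) differentiable (at p)"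
    by (rule Gam_differentiable) (use assms in \<open>auto intro!: differentiableI has_derivative_fst has_derivative_snd has_derivative_ident\<close>)
  then obtain G' where "((\<lambda>p. Gam (fst p) (snd p) (snd p)) has_derivative G') (at p)"
    unfolding differentiable_def by blast
  then have "(damped_spray has_derivative (\<lambda>q. (snd q, - G' q - (\<sigma> / 2) *\<^sub>R snd q))) (at p)"
    unfolding damped_spray_def[abs_def]
    by (intro has_derivative_Pair has_derivative_snd has_derivative_ident has_derivative_diff
        has_derivative_minus has_derivative_scaleR_right)
  then show ?thesis using differentiableI frechet_derivative_works by blast
qed

text \<open>
  In the second component the bracket of the two fields is
  $D_w\Gamma(y,y) + 2 \Gamma(y, Dw\,y) + D^2w(y,y) - Dw\,\Gamma(y,y)$, the Lie derivative of the connection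
  along $w$. Its product with an arbitrary vector $z$ is the homothety equation differentiated in the
  direction $y$ at $(y, z)$, minus half of that equation differentiated in the direction $z$
  at $(y, y)$. The damping commutes with the lift because the lift is linear in $y$.
\<close>

lemma lift_spray_commute:
  assumes p: "p \<in> S \<times> UNIV" shows "complete_lift' p (damped_spray p) = D damped_spray p (complete_lift p)"
proof -
  obtain x y where xy: "p = (x, y)" by (cases p)
  have x: "x \<in> S" using p xy by auto
  have d_fst: "(fst has_derivative fst) (at p)" and d_snd: "(snd has_derivative snd) (at p)"
    by (rule has_derivative_fst[OF has_derivative_ident] has_derivative_snd[OF has_derivative_ident])+
  have "(\<lambda>p. Gam (fst p) (snd p) (snd p)) differentiable (at p)"
    by (rule Gam_differentiable) (use d_fst d_snd x xy in \<open>auto simp: differentiable_def\<close>)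
  then obtain G' where G': "((\<lambda>p. Gam (fst p) (snd p) (snd p)) has_derivative G') (at p)"
    unfolding differentiable_def by blast
  have "(damped_spray has_derivative (\<lambda>q. (snd q, - G' q - (\<sigma> / 2) *\<^sub>R snd q))) (at p)"
    unfolding damped_spray_def[abs_def]
    by (intro has_derivative_Pair d_snd has_derivative_diff has_derivative_minus has_derivative_scaleR_right G')
  then have D_spray: "D damped_spray p = (\<lambda>q. (snd q, - G' q - (\<sigma> / 2) *\<^sub>R snd q))"
    by (rule frechet_derivative_at[symmetric])
  define \<Gamma> where "\<Gamma> = Gam x y y"
  define W where "W u v = D (\<lambda>z. D w z u) x v" for u v
  have W_sym: "W u v = W v u" for u v
    unfolding W_def by (rule smooth_on_symmetric_second_derivative[OF open_S smooth_w x])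
  define q where "q = (w x, D w x y)"
  have "G' q = D w x \<Gamma> - W y y"
  proof (rule H_nondegenerate[OF x])
    fix z
    have 1: "((\<lambda>p. H (fst p) (Gam (fst p) (snd p) (snd p)) z) has_derivative
        (\<lambda>q. dH (fst p) (fst q) (Gam (fst p) (snd p) (snd p)) z + H (fst p) (G' q) z + H (fst p) (Gam (fst p) (snd p) (snd p)) 0)) (at p)"
      by (intro H_has_derivative d_fst d_snd G' has_derivative_const) (use x xy in auto)
    have 2: "((\<lambda>p. dH (fst p) (snd p) (snd p) z - dH (fst p) z (snd p) (snd p) / 2) has_derivative
       (\<lambda>q. (ddH (fst p) (snd p) (fst q) (snd p) z + dH (fst p) (snd q) (snd p) z + dH (fst p) (snd p) (snd q) z + dH (fst p) (snd p) (snd p) 0)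
          - (ddH (fst p) z (fst q) (snd p) (snd p) + dH (fst p) 0 (snd p) (snd p) + dH (fst p) z (snd q) (snd p) + dH (fst p) z (snd p) (snd q)) / 2)) (at p)"
      unfolding divide_inverse
      by (intro has_derivative_diff has_derivative_mult_left dH_has_derivative d_fst d_snd has_derivative_const) (use x xy in auto)
    have "((\<lambda>p. H (fst p) (Gam (fst p) (snd p) (snd p)) z) has_derivative
       (\<lambda>q. (ddH (fst p) (snd p) (fst q) (snd p) z + dH (fst p) (snd q) (snd p) z + dH (fst p) (snd p) (snd q) z + dH (fst p) (snd p) (snd p) 0)
          - (ddH (fst p) z (fst q) (snd p) (snd p) + dH (fst p) 0 (snd p) (snd p) + dH (fst p) z (snd q) (snd p) + dH (fst p) z (snd p) (snd q)) / 2)) (at p)"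
      by (rule has_derivative_transform_within_open[OF 2, of "S \<times> UNIV"])
        (use open_S p in \<open>auto simp: H_Gam open_Times field_simps\<close>)
    from has_derivative_unique[OF 1 this]
    have "dH x (fst q) \<Gamma> z + H x (G' q) z + H x \<Gamma> 0
      = (ddH x y (fst q) y z + dH x (snd q) y z + dH x y (snd q) z + dH x y y 0)
          - (ddH x z (fst q) y y + dH x 0 y y + dH x z (snd q) y + dH x z y (snd q)) / 2"
      unfolding xy fst_conv snd_conv \<Gamma>_def by meson
    moreover have "dH x y y 0 = 0" "dH x 0 y y = 0"
      using dH_linear(6)[of x y y 0 0] dH_linear_direction(3)[OF x, of 0 0 y y] by auto
    ultimately have I: "dH x (w x) \<Gamma> z + H x (G' q) z
      = ddH x y (w x) y z + dH x (D w x y) y z + dH x y (D w x y) z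
          - (ddH x z (w x) y y + 2 * dH x z (D w x y) y) / 2"
      using dH_sym[OF x, of z y] by (simp add: q_def H_linear)
    have II: "ddH x (w x) y y z + dH x (D w x y) y z + dH x y (D w x y) z + H x (W y y) z
      + dH x y y (D w x z) + H x y (W z y) = \<sigma> * dH x y y z"
      "ddH x (w x) z y y + dH x (D w x z) y y + dH x z (D w x y) y + H x (W y z) y
      + dH x z y (D w x y) + H x y (W y z) = \<sigma> * dH x z y y"
      using homothety_derivative[OF x] unfolding W_def by blast+
    have III: "dH x (w x) \<Gamma> z + H x (D w x \<Gamma>) z + H x \<Gamma> (D w x z) = \<sigma> * H x \<Gamma> z"
      by (rule homothety[OF x])
    have IV: "H x \<Gamma> v = dH x y y v - dH x v y y / 2" for v
      unfolding \<Gamma>_def by (simp add: H_Gam[OF x] field_simps)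
    have V: "ddH x (w x) y y z = ddH x y (w x) y z" "ddH x (w x) z y y = ddH x z (w x) y y"
      by (rule ddH_commute[OF x])+
    have VI: "dH x z y (D w x y) = dH x z (D w x y) y" "H x (W y z) y = H x y (W y z)" "W z y = W y z"
      by (rule dH_sym[OF x] H_sym[OF x] W_sym)+
    have VII: "\<sigma> * H x \<Gamma> z = \<sigma> * dH x y y z - \<sigma> * dH x z y y / 2"
      by (simp add: IV[of z] algebra_simps)
    show "H x (G' q) z = H x (D w x \<Gamma> - W y y) z"
    proof -
      have "ddH x y (w x) y z + dH x (D w x y) y z + dH x y (D w x y) z
          - (ddH x z (w x) y y + 2 * dH x z (D w x y) y) / 2
          = \<sigma> * H x \<Gamma> z - H x \<Gamma> (D w x z) - H x (W y y) z"
        using II(1)[unfolded VI(3) V] II(2)[unfolded VI(1,2) V] IV[of "D w x z"] VII by argo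
      then show ?thesis using I III unfolding H_linear by argo
    qed
  qed
  moreover have "complete_lift p = q" by (simp add: complete_lift_def q_def xy)
  moreover have "linear (D w x)" by (rule smooth_on_linear_D[OF smooth_w x])
  ultimately show ?thesis
    by (simp add: D_spray complete_lift'_def damped_spray_def[of p])
      (simp add: xy q_def \<Gamma>_def W_def linear_diff linear_neg linear_cmul)
qed

text \<open>
  The flow of a homothety scales the metric exponentially, because the derivative of $h(y,y)$ along the
  lift is the left-hand side of the homothety equation at $(y,y)$.
\<close>

lemma energy_along_lift:
  assumes S: "\<And>s. s \<in> closed_segment a b \<Longrightarrow> fst (c s) \<in> S"
    and c: "\<And>s. s \<in> closed_segment a b \<Longrightarrow> (c has_vector_derivative k *\<^sub>R complete_lift (c s)) (at s)"
  shows "H (fst (c b)) (snd (c b)) (snd (c b)) = exp (k * \<sigma> * (b - a)) * H (fst (c a)) (snd (c a)) (snd (c a))"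
proof -
  define f where "f s = exp (- (k * \<sigma> * s)) * H (fst (c s)) (snd (c s)) (snd (c s))" for s
  have "(f has_real_derivative 0) (at s within closed_segment a b)" if s: "s \<in> closed_segment a b" for s
  proof -
    have cs: "((\<lambda>s. fst (c s)) has_derivative (\<lambda>h. h *\<^sub>R k *\<^sub>R w (fst (c s)))) (at s)"
      "((\<lambda>s. snd (c s)) has_derivative (\<lambda>h. h *\<^sub>R k *\<^sub>R D w (fst (c s)) (snd (c s)))) (at s)"
      using has_derivative_fst[OF c[OF s, unfolded has_vector_derivative_def]]
        has_derivative_snd[OF c[OF s, unfolded has_vector_derivative_def]]
      by (simp_all add: complete_lift_def)
    have hom: "dH (fst (c s)) (w (fst (c s))) y y = \<sigma> * H (fst (c s)) y y
        - H (fst (c s)) (D w (fst (c s)) y) y - H (fst (c s)) y (D w (fst (c s)) y)" for y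
      using homothety[OF S[OF s], of y y] by simp
    from H_has_derivative[OF S[OF s] cs(1) cs(2) cs(2)]
    have "((\<lambda>s. H (fst (c s)) (snd (c s)) (snd (c s))) has_derivative
      (\<lambda>h. h * (k * \<sigma> * H (fst (c s)) (snd (c s)) (snd (c s))))) (at s)"
      by (rule has_derivative_eq_rhs)
        (simp add: fun_eq_iff H_linear dH_linear_direction[OF S[OF s]] hom algebra_simps)
    then have "((\<lambda>s. H (fst (c s)) (snd (c s)) (snd (c s))) has_real_derivative
      (k * \<sigma> * H (fst (c s)) (snd (c s)) (snd (c s)))) (at s)"
      unfolding has_field_derivative_def by (simp add: mult_commute_abs)
    then have "(f has_real_derivative 0) (at s)"
      unfolding f_def by (auto intro!: derivative_eq_intros simp: algebra_simps)
    then show ?thesis by (rule has_field_derivative_at_within)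
  qed
  then have "\<exists>e. \<forall>x\<in>closed_segment a b. f x = e"
    by (intro has_field_derivative_zero_constant convex_closed_segment)
  then have "f a = f b" by (metis ends_in_segment)
  then show ?thesis unfolding f_def
    by (simp add: exp_minus field_simps exp_diff right_diff_distrib)
qed

end

text \<open>
  The chart dependence of the Christoffel symbols, obtained like the invariance of the
  Levi-Civita connection under isometries: differentiate the relation between the two metrics
  and form the combination of derivatives which defines $\Gamma$.
\<close>

lemma christoffel_transformation:
  fixes \<tau> :: "real ^ 'n::finite \<Rightarrow> real ^ 'n"
  assumes g1: "local_metric S1 g1" and g2: "local_metric S2 g2"
    and T: "open T" "T \<subseteq> S1" "\<tau> ` T \<subseteq> S2" "smooth_on \<tau> T"
    and iso: "\<And>x u v. x \<in> T \<Longrightarrow> local_metric.H g1 x u v = local_metric.H g2 (\<tau> x) (D \<tau> x u) (D \<tau> x v)"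
    and x: "x \<in> T" and surj: "surj (D \<tau> x)"
  shows "D \<tau> x (local_metric.Gam g1 x y y)
     = local_metric.Gam g2 (\<tau> x) (D \<tau> x y) (D \<tau> x y) + D (\<lambda>z. D \<tau> z y) x y"
proof -
  interpret l1: local_metric S1 g1 by (rule g1)
  interpret l2: local_metric S2 g2 by (rule g2)
  define W where "W u v = D (\<lambda>z. D \<tau> z u) x v" for u v
  have W_sym: "W u v = W v u" for u v
    unfolding W_def by (rule smooth_on_symmetric_second_derivative[OF T(1,4) x])
  have xS: "x \<in> S1" "\<tau> x \<in> S2" using T x by auto
  have dH: "l1.dH x a u v = l2.dH (\<tau> x) (D \<tau> x a) (D \<tau> x u) (D \<tau> x v)
      + l2.H (\<tau> x) (W u a) (D \<tau> x v) + l2.H (\<tau> x) (D \<tau> x u) (W v a)" for a u v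
  proof -
    have \<tau>: "(\<tau> has_derivative D \<tau> x) (at x)" "((\<lambda>z. D \<tau> z u) has_derivative W u) (at x)" for u
      unfolding W_def
      by (rule smooth_on_has_derivative[OF _ x], intro smooth_on_D T)+
    have 1: "((\<lambda>x. l1.H x u v) has_derivative (\<lambda>a. l1.dH x a u v + l1.H x 0 v + l1.H x u 0)) (at x)"
      by (intro l1.H_has_derivative has_derivative_ident has_derivative_const xS)
    have 2: "((\<lambda>x. l2.H (\<tau> x) (D \<tau> x u) (D \<tau> x v)) has_derivative (\<lambda>a. l2.dH (\<tau> x) (D \<tau> x a) (D \<tau> x u) (D \<tau> x v)
      + l2.H (\<tau> x) (W u a) (D \<tau> x v) + l2.H (\<tau> x) (D \<tau> x u) (W v a))) (at x)"
      by (intro l2.H_has_derivative \<tau> xS)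
    have "((\<lambda>x. l1.H x u v) has_derivative (\<lambda>a. l2.dH (\<tau> x) (D \<tau> x a) (D \<tau> x u) (D \<tau> x v)
      + l2.H (\<tau> x) (W u a) (D \<tau> x v) + l2.H (\<tau> x) (D \<tau> x u) (W v a))) (at x)"
      by (rule has_derivative_transform_within_open[OF 2 T(1) x]) (simp add: iso)
    from has_derivative_unique[OF 1 this] show ?thesis by (simp add: l1.H_linear fun_eq_iff)
  qed
  show ?thesis
  proof (rule l2.H_nondegenerate[OF xS(2)])
    fix z'
    obtain z where z: "z' = D \<tau> x z" using surj by (metis surjD)
    have "l2.H (\<tau> x) (D \<tau> x (l1.Gam x y y)) (D \<tau> x z) = l1.H x (l1.Gam x y y) z"
      using iso[OF x] by simp
    also have "\<dots> = l1.dH x y y z - l1.dH x z y y / 2"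
      by (simp add: l1.H_Gam[OF xS(1)] field_simps)
    also have "\<dots> = l2.dH (\<tau> x) (D \<tau> x y) (D \<tau> x y) (D \<tau> x z) - l2.dH (\<tau> x) (D \<tau> x z) (D \<tau> x y) (D \<tau> x y) / 2
        + l2.H (\<tau> x) (W y y) (D \<tau> x z)"
      unfolding dH using W_sym[of y z] l2.H_sym[OF xS(2), of "W y z"] by (simp add: field_simps)
    also have "\<dots> = l2.H (\<tau> x) (l2.Gam (\<tau> x) (D \<tau> x y) (D \<tau> x y) + W y y) (D \<tau> x z)"
      by (simp add: l2.H_linear l2.H_Gam[OF xS(2)] field_simps)
    finally show "l2.H (\<tau> x) (D \<tau> x (l1.Gam x y y)) z'
        = l2.H (\<tau> x) (l2.Gam (\<tau> x) (D \<tau> x y) (D \<tau> x y) + D (\<lambda>z. D \<tau> z y) x y) z'"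
      by (simp add: z W_def)
  qed
qed

section \<open>The spray of the Randers metric\<close>

context local_metric begin

lemma H_DERIV:
  assumes "x s \<in> S" "(x has_vector_derivative x') (at s)" "(u has_vector_derivative u') (at s)"
    "(v has_vector_derivative v') (at s)"
  shows "((\<lambda>s. H (x s) (u s) (v s)) has_real_derivative
     dH (x s) x' (u s) (v s) + H (x s) u' (v s) + H (x s) (u s) v') (at s)"
  unfolding has_field_derivative_def
  by (rule has_derivative_eq_rhs[OF H_has_derivative[OF assms(1)
          assms(2-4)[unfolded has_vector_derivative_def]]])
    (simp add: fun_eq_iff H_linear dH_linear_direction[OF assms(1)] algebra_simps)

lemma dH_DERIV:
  assumes "x \<in> S" "(u has_vector_derivative u') (at s)" "(v has_vector_derivative v') (at s)"
  shows "((\<lambda>s. dH x a (u s) (v s)) has_real_derivative dH x a u' (v s) + dH x a (u s) v') (at s)"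
proof -
  have "ddH x a 0 (u s) (v s) = 0" "dH x 0 (u s) (v s) = 0"
    using smooth_on_linear_D[OF smooth_on_D[OF smooth_g] assms(1), THEN linear_0]
      smooth_on_linear_D[OF smooth_g assms(1), THEN linear_0] by (simp_all add: ddH_def dH_def)
  then show ?thesis
    unfolding has_field_derivative_def
    by (intro has_derivative_eq_rhs[OF dH_has_derivative[OF assms(1) has_derivative_const has_derivative_const
            assms(2,3)[unfolded has_vector_derivative_def]]])
      (simp add: fun_eq_iff dH_linear algebra_simps)
qed

end

context local_homothety begin

text \<open>
  The Randers metric of the navigation problem in coordinates.
\<close>

definition zermelo_norm :: "real ^ 'n \<Rightarrow> real ^ 'n \<Rightarrow> real" where
  "zermelo_norm x y = sqrt ((1 - H x (w x) (w x)) * H x y y + (H x (w x) y)\<^sup>2) / (1 - H x (w x) (w x))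
     - H x (w x) y / (1 - H x (w x) (w x))"

definition mild_wind :: "(real ^ 'n) set" where
  "mild_wind = {x \<in> S. H x (w x) (w x) < 1}"

lemma open_mild: "open mild_wind"
proof -
  have "continuous_on S (\<lambda>x. H x (w x) (w x))"
    unfolding H_def
    by (intro continuous_intros smooth_on_continuous_on[OF smooth_g] smooth_on_continuous_on[OF smooth_w])
  then have "open (S \<inter> (\<lambda>x. H x (w x) (w x)) -` {..<1})"
    by (intro continuous_open_preimage open_S) auto
  also have "S \<inter> (\<lambda>x. H x (w x) (w x)) -` {..<1} = mild_wind" by (auto simp: mild_wind_def)
  finally show ?thesis .
qed

lemma mildD: "x \<in> mild_wind \<Longrightarrow> x \<in> S" "x \<in> mild_wind \<Longrightarrow> H x (w x) (w x) < 1"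
  by (auto simp: mild_wind_def)

lemma zermelo_norm_root:
  fixes x y :: "real ^ 'n"
  assumes x: "x \<in> mild_wind"
  defines "l \<equiv> 1 - H x (w x) (w x)" and "b \<equiv> H x (w x) y"
  shows "l * zermelo_norm x y + b = sqrt (l * H x y y + b\<^sup>2)" "l > 0" "l * (zermelo_norm x y)\<^sup>2 + 2 * zermelo_norm x y * b = H x y y"
proof -
  show l: "l > 0" using mildD[OF x] by (simp add: l_def)
  show r: "l * zermelo_norm x y + b = sqrt (l * H x y y + b\<^sup>2)"
  proof -
    have "zermelo_norm x y = sqrt (l * H x y y + b\<^sup>2) / l - b / l" unfolding zermelo_norm_def l_def b_def ..
    then show ?thesis using l by (simp add: right_diff_distrib)
  qed
  have "l * H x y y + b\<^sup>2 \<ge> 0"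
    using H_nonneg[OF mildD(1)[OF x]] l by simp
  then have "(l * zermelo_norm x y + b)\<^sup>2 = l * H x y y + b\<^sup>2" using r by simp
  then have "l * (l * (zermelo_norm x y)\<^sup>2 + 2 * zermelo_norm x y * b) = l * H x y y"
    by (simp add: power2_eq_square algebra_simps)
  then show "l * (zermelo_norm x y)\<^sup>2 + 2 * zermelo_norm x y * b = H x y y" using l by simp
qed

text \<open>
  The defining property of the navigation metric: $y/F$ is the sum of the wind and of a vector
  of unit length. The value of the metric is the positive root of the resulting quadratic equation.
\<close>

lemma zermelo_norm_zermelo: assumes x: "x \<in> mild_wind"
  shows "H x (y - zermelo_norm x y *\<^sub>R w x) (y - zermelo_norm x y *\<^sub>R w x) = (zermelo_norm x y)\<^sup>2"
  using zermelo_norm_root(3)[OF x, of y] H_sym[OF mildD(1)[OF x], of y "w x"]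
  by (simp add: H_linear power2_eq_square algebra_simps)

lemma zermelo_norm_unique: assumes x: "x \<in> mild_wind" and f: "f > 0" "H x (y - f *\<^sub>R w x) (y - f *\<^sub>R w x) = f\<^sup>2"
  shows "zermelo_norm x y = f"
proof -
  define l where "l = 1 - H x (w x) (w x)" define b where "b = H x (w x) y"
  have l: "l > 0" using zermelo_norm_root(2)[OF x] by (simp add: l_def)
  have eq: "f * (l * f + 2 * b) = H x y y"
    using f(2) H_sym[OF mildD(1)[OF x], of y "w x"]
    by (simp add: l_def b_def H_linear power2_eq_square algebra_simps)
  then have "l * f + 2 * b \<ge> 0"
    using H_nonneg[OF mildD(1)[OF x], of y] f(1) by (metis zero_le_mult_iff not_less)
  then have "l * f + b \<ge> 0" using l f(1) by (smt (verit) mult_pos_pos)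
  moreover have "(l * f + b)\<^sup>2 = l * H x y y + b\<^sup>2"
    unfolding eq[symmetric] by (simp add: power2_eq_square algebra_simps)
  ultimately have "l * f + b = sqrt (l * H x y y + b\<^sup>2)" by (metis real_sqrt_unique)
  moreover have "l * zermelo_norm x y + b = sqrt (l * H x y y + b\<^sup>2)"
    unfolding l_def b_def by (rule zermelo_norm_root(1)[OF x])
  ultimately have "l * f = l * zermelo_norm x y" by linarith
  then show ?thesis using l by simp
qed

text \<open>
  The quantity $F + h(v, w)$ is the square root in the definition of the metric, hence positive. It is
  the denominator whenever the relation $h(y - F w, y - F w) = F^2$ is differentiated.
\<close>

lemma zermelo_norm_denominator: assumes x: "x \<in> mild_wind" and "y \<noteq> 0"
  shows "zermelo_norm x y + H x (y - zermelo_norm x y *\<^sub>R w x) (w x) > 0"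
proof -
  have "zermelo_norm x y + H x (y - zermelo_norm x y *\<^sub>R w x) (w x) = (1 - H x (w x) (w x)) * zermelo_norm x y + H x (w x) y"
    using H_sym[OF mildD(1)[OF x], of y "w x"] by (simp add: H_linear algebra_simps)
  also have "\<dots> > 0"
    unfolding zermelo_norm_root(1)[OF x]
    using zermelo_norm_root(2)[OF x] H_pos[OF mildD(1)[OF x] \<open>y \<noteq> 0\<close>] by (simp add: add_pos_nonneg)
  finally show ?thesis .
qed

text \<open>
  Implicit differentiation of $h(v, v) = F^2$ with $v = y - F w$. The explicit formula is used only
  to know that the derivative exists.
\<close>

lemma zermelo_norm_DERIV:
  fixes x y :: "real \<Rightarrow> real ^ 'n" and x' y' :: "real ^ 'n" and s :: real
  assumes x: "x s \<in> mild_wind" and y: "y s \<noteq> 0"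
    and x': "(x has_vector_derivative x') (at s)" and y': "(y has_vector_derivative y') (at s)"
  defines "F \<equiv> zermelo_norm (x s) (y s)"
  defines "v \<equiv> y s - F *\<^sub>R w (x s)"
  shows "((\<lambda>s. zermelo_norm (x s) (y s)) has_real_derivative
     (dH (x s) x' v v / 2 + H (x s) v (y' - F *\<^sub>R D w (x s) x')) / (F + H (x s) v (w (x s)))) (at s)"
proof -
  have xS: "x s \<in> S" using mildD x by blast
  have w': "((\<lambda>s. w (x s)) has_vector_derivative D w (x s) x') (at s)"
    using vector_derivative_diff_chain_within[OF x' has_derivative_at_withinI[OF smooth_on_has_derivative[OF smooth_w xS]]]
    by (simp add: o_def)
  note ww = H_DERIV[OF xS x' w' w'] and yy = H_DERIV[OF xS x' y' y'] and wy = H_DERIV[OF xS x' w' y']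
  have pos: "(1 - H (x s) (w (x s)) (w (x s))) * H (x s) (y s) (y s) + (H (x s) (w (x s)) (y s))\<^sup>2 > 0"
    using zermelo_norm_root(2)[OF x] H_pos[OF xS y] by (simp add: add_pos_nonneg)
  have l: "1 - H (x s) (w (x s)) (w (x s)) \<noteq> 0" using zermelo_norm_root(2)[OF x] by simp
  have "\<exists>d. ((\<lambda>s. zermelo_norm (x s) (y s)) has_real_derivative d) (at s)"
    unfolding zermelo_norm_def
    by (rule exI, rule DERIV_diff[OF
          DERIV_divide[OF DERIV_chain2[OF DERIV_real_sqrt[OF pos]
            DERIV_add[OF DERIV_mult[OF DERIV_diff[OF DERIV_const ww] yy] DERIV_power[OF wy]]]
            DERIV_diff[OF DERIV_const ww] l]
          DERIV_divide[OF wy DERIV_diff[OF DERIV_const ww] l]])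
  then obtain d where d: "((\<lambda>s. zermelo_norm (x s) (y s)) has_real_derivative d) (at s)" by blast
  then have d': "((\<lambda>s. zermelo_norm (x s) (y s)) has_vector_derivative d) (at s)"
    by (simp add: has_real_derivative_iff_has_vector_derivative)
  have v': "((\<lambda>s. y s - zermelo_norm (x s) (y s) *\<^sub>R w (x s)) has_vector_derivative
      y' - (F *\<^sub>R D w (x s) x' + d *\<^sub>R w (x s))) (at s)"
    unfolding F_def by (intro has_vector_derivative_diff y' has_vector_derivative_scaleR d w')
  note 1 = H_DERIV[OF xS x' v' v']
  have 2: "((\<lambda>s. (zermelo_norm (x s) (y s))\<^sup>2) has_real_derivative 2 * F * d) (at s)"
    unfolding F_def by (auto intro!: derivative_eq_intros d)
  have "isCont x s" using x' has_vector_derivative_continuous by blast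
  then have "\<forall>\<^sub>F r in nhds s. x r \<in> mild_wind"
    using open_mild x unfolding isCont_def by (simp add: eventually_nhds_conv_at topological_tendstoD)
  then have ev: "\<forall>\<^sub>F r in nhds s. H (x r) (y r - zermelo_norm (x r) (y r) *\<^sub>R w (x r)) (y r - zermelo_norm (x r) (y r) *\<^sub>R w (x r))
      = (zermelo_norm (x r) (y r))\<^sup>2"
    by (rule eventually_mono) (rule zermelo_norm_zermelo)
  have "((\<lambda>s. H (x s) (y s - zermelo_norm (x s) (y s) *\<^sub>R w (x s)) (y s - zermelo_norm (x s) (y s) *\<^sub>R w (x s)))
      has_real_derivative 2 * F * d) (at s)"
    by (rule DERIV_cong_ev[OF refl ev refl, THEN iffD2, OF 2])
  from DERIV_unique[OF 1 this]
  have "dH (x s) x' v v + 2 * H (x s) v (y' - F *\<^sub>R D w (x s) x') - 2 * d * H (x s) v (w (x s)) = 2 * F * d"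
    unfolding v_def[symmetric] F_def[symmetric]
    using H_sym[OF xS, of v "D w (x s) x'"] H_sym[OF xS, of v "w (x s)"] H_sym[OF xS, of v y']
    by (simp add: H_linear algebra_simps)
  then have "d * (F + H (x s) v (w (x s))) = dH (x s) x' v v / 2 + H (x s) v (y' - F *\<^sub>R D w (x s) x')"
    by (simp add: algebra_simps)
  moreover have "F + H (x s) v (w (x s)) > 0"
    using zermelo_norm_denominator[OF x y] by (simp add: v_def F_def)
  ultimately have "d = (dH (x s) x' v v / 2 + H (x s) v (y' - F *\<^sub>R D w (x s) x')) / (F + H (x s) v (w (x s)))"
    by (simp add: field_simps)
  then show ?thesis using d by simp
qed

text \<open>
  The fundamental tensor of the Randers metric.
\<close>

definition zermelo_hessian :: "real ^ 'n \<Rightarrow> real ^ 'n \<Rightarrow> real ^ 'n ^ 'n" where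
  "zermelo_hessian x y = (\<chi> i j. partial j (partial i (\<lambda>u. (1/2) * (zermelo_norm x u)\<^sup>2)) y)"

definition zermelo_spray :: "'n \<Rightarrow> real ^ 'n \<Rightarrow> real ^ 'n \<Rightarrow> real" where
  "zermelo_spray i x y = (1/4) * (\<Sum>l\<in>UNIV. matrix_inv (zermelo_hessian x y) $ i $ l *
        ((\<Sum>k\<in>UNIV. partial l (\<lambda>u. partial k (\<lambda>z. (zermelo_norm z u)\<^sup>2) x) y * y $ k)
           - partial l (\<lambda>z. (zermelo_norm z y)\<^sup>2) x))"

lemma line_has_vector_derivative: "((\<lambda>s. a + s *\<^sub>R e) has_vector_derivative e) (at s)"
  by (auto intro!: derivative_eq_intros)

lemma zermelo_norm_line_DERIV:
  assumes x: "x \<in> mild_wind" and y: "y \<noteq> 0"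
  shows "((\<lambda>s. zermelo_norm x (y + s *\<^sub>R e)) has_real_derivative
     H x (y - zermelo_norm x y *\<^sub>R w x) e / (zermelo_norm x y + H x (y - zermelo_norm x y *\<^sub>R w x) (w x))) (at 0)"
proof -
  have "dH x 0 v v = 0" "D w x 0 = 0" for v
    using dH_linear_direction(3)[OF mildD(1)[OF x], of 0 0 v v]
      smooth_on_linear_D[OF smooth_w mildD(1)[OF x], THEN linear_0] by auto
  then show ?thesis
    using zermelo_norm_DERIV[of "\<lambda>_. x" 0 "\<lambda>s. y + s *\<^sub>R e", OF _ _ has_vector_derivative_const line_has_vector_derivative] x y
    by simp
qed

lemma partial_y_F:
  assumes x: "x \<in> mild_wind" and y: "y \<noteq> 0"
  shows "partial i (\<lambda>u. (1/2) * (zermelo_norm x u)\<^sup>2) y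
    = zermelo_norm x y * (H x (y - zermelo_norm x y *\<^sub>R w x) (axis i 1) / (zermelo_norm x y + H x (y - zermelo_norm x y *\<^sub>R w x) (w x)))"
proof -
  have "((\<lambda>s. (1/2) * (f s)\<^sup>2) has_real_derivative f 0 * d) (at 0)"
    if "(f has_real_derivative d) (at 0)" for f :: "real \<Rightarrow> real" and d
    using that by (auto intro!: derivative_eq_intros)
  from this[OF zermelo_norm_line_DERIV[OF x y]] show ?thesis
    unfolding partial_def by (intro DERIV_imp_deriv) simp
qed

lemma partial_x_F:
  assumes x: "x \<in> mild_wind" and y: "y \<noteq> 0"
  shows "partial k (\<lambda>z. (zermelo_norm z y)\<^sup>2) x
    = 2 * zermelo_norm x y * ((dH x (axis k 1) (y - zermelo_norm x y *\<^sub>R w x) (y - zermelo_norm x y *\<^sub>R w x) / 2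
        - zermelo_norm x y * H x (y - zermelo_norm x y *\<^sub>R w x) (D w x (axis k 1))) / (zermelo_norm x y + H x (y - zermelo_norm x y *\<^sub>R w x) (w x)))"
proof -
  have "((\<lambda>s. zermelo_norm (x + s *\<^sub>R axis k 1) y) has_real_derivative
    ((dH x (axis k 1) (y - zermelo_norm x y *\<^sub>R w x) (y - zermelo_norm x y *\<^sub>R w x) / 2
        - zermelo_norm x y * H x (y - zermelo_norm x y *\<^sub>R w x) (D w x (axis k 1))) / (zermelo_norm x y + H x (y - zermelo_norm x y *\<^sub>R w x) (w x)))) (at 0)"
    using zermelo_norm_DERIV[of "\<lambda>s. x + s *\<^sub>R axis k 1" 0 "\<lambda>_. y", OF _ _ line_has_vector_derivative has_vector_derivative_const] x y
    by (simp add: H_linear)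
  then show ?thesis unfolding partial_def
    by (intro DERIV_imp_deriv) (auto intro!: derivative_eq_intros)
qed

text \<open>
  The Euler-Lagrange equation for $F^2/2$ at a point where $F = 1$. Below, $f(z) = h(v,z)/(1 + h(v,w))$ is the
  derivative of $F$ in the fibre direction $z$ and $\delta z = z - f(z) w$ that of $v = y - F w$.
  The assumption that $F$ stays constant along $(y, a)$ cancels all terms of second
  order in $f$, and what remains is $h(b + \Gamma(v,v) - Dw\,v + \sigma v, z) = K f(z)$ for all $z$,
  where $b = \dot v$. Pairing with $v$ shows $K/(1 + h(v,w)) = \sigma/2$.
\<close>

lemma unit_spray_iff:
  fixes x y a :: "real ^ 'n"
  assumes x: "x \<in> mild_wind" and y: "y \<noteq> 0" and F1: "zermelo_norm x y = 1"
  defines "v \<equiv> y - w x"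
  assumes const: "dH x y v v / 2 + H x v (a - D w x y) = 0"
  shows "(\<forall>i. a $ i + 2 * zermelo_spray i x y = 0) \<longleftrightarrow> a - D w x y = D w x v - Gam x v v - (\<sigma> / 2) *\<^sub>R v"
proof -
  have xS: "x \<in> S" using mildD x by blast
  have linw: "linear (D w x)" by (rule smooth_on_linear_D[OF smooth_w xS])
  define Dn where "Dn = 1 + H x v (w x)"
  have Dn: "Dn > 0" using zermelo_norm_denominator[OF x y] by (simp add: F1 Dn_def v_def)
  have vv: "H x v v = 1" using zermelo_norm_zermelo[OF x, of y] by (simp add: F1 v_def)
  define f where "f z = H x v z / Dn" for z
  define dv where "dv z = z - f z *\<^sub>R w x" for z
  have F': "((\<lambda>s. zermelo_norm x (y + s *\<^sub>R e)) has_real_derivative f e) (at 0)" for e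
    using zermelo_norm_line_DERIV[OF x y, of e] by (simp add: F1 f_def Dn_def v_def)
  have v': "((\<lambda>s. y + s *\<^sub>R e - zermelo_norm x (y + s *\<^sub>R e) *\<^sub>R w x) has_vector_derivative dv e) (at 0)" for e
    unfolding dv_def
    by (rule has_vector_derivative_eq_rhs[OF has_vector_derivative_diff[OF line_has_vector_derivative
            has_vector_derivative_scaleR[OF F' has_vector_derivative_const]]]) simp
  have Hv': "((\<lambda>s. H x (y + s *\<^sub>R e - zermelo_norm x (y + s *\<^sub>R e) *\<^sub>R w x) z) has_real_derivative H x (dv e) z) (at 0)" for e z
  proof -
    have "dH x 0 u z = 0" for u using dH_linear_direction(3)[OF xS, of 0 0 u z] by auto
    then show ?thesis
      by (intro DERIV_cong[OF H_DERIV[of "\<lambda>_. x", OF xS has_vector_derivative_const v' has_vector_derivative_const]])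
        (simp add: H_linear(10))
  qed
  have dHv': "((\<lambda>s. dH x b (y + s *\<^sub>R e - zermelo_norm x (y + s *\<^sub>R e) *\<^sub>R w x) (y + s *\<^sub>R e - zermelo_norm x (y + s *\<^sub>R e) *\<^sub>R w x))
      has_real_derivative 2 * dH x b v (dv e)) (at 0)" for e b
    using dH_DERIV[OF xS v' v', of b e e] dH_sym[OF xS, of b "dv e" v] by (simp add: F1 v_def)
  have ev: "\<forall>\<^sub>F s in nhds 0. y + s *\<^sub>R e \<noteq> 0" for e
  proof -
    have "((\<lambda>s. y + s *\<^sub>R e) \<longlongrightarrow> y + 0 *\<^sub>R e) (nhds 0)" by (intro tendsto_intros) (simp add: tendsto_ident_at filterlim_ident)
    then show ?thesis using y by (intro tendsto_imp_eventually_ne) auto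
  qed
  define N where "N b = dH x b v v / 2 - H x v (D w x b)" for b
  define N' where "N' b e = dH x b v (dv e) - f e * H x v (D w x b) - H x (dv e) (D w x b)" for b e
  define D' where "D' e = f e + H x (dv e) (w x)" for e
  have D': "((\<lambda>s. zermelo_norm x (y + s *\<^sub>R e) + H x (y + s *\<^sub>R e - zermelo_norm x (y + s *\<^sub>R e) *\<^sub>R w x) (w x))
     has_real_derivative D' e) (at 0)" for e
    unfolding D'_def by (intro DERIV_add F' Hv')
  have at0: "zermelo_norm x (y + 0 *\<^sub>R e) = 1" "y + 0 *\<^sub>R e - 1 *\<^sub>R w x = v" for e
    by (simp_all add: F1 v_def)
  have den0: "zermelo_norm x (y + 0 *\<^sub>R e) + H x (y + 0 *\<^sub>R e - zermelo_norm x (y + 0 *\<^sub>R e) *\<^sub>R w x) (w x) \<noteq> 0" for e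
    using Dn by (simp only: at0 Dn_def)
  \<comment> \<open>the fundamental tensor as a bilinear form; positive because of the Cauchy-Schwarz inequality for $v$ and $\delta u$\<close>
  define G where "G b e = f b * f e + (H x (dv b) (dv e) - f b * f e) / Dn" for b e
  have zermelo_hessian: "zermelo_hessian x y $ i $ j = G (axis i 1) (axis j 1)" for i j
  proof -
    let ?e = "axis j 1 :: real ^ 'n" and ?b = "axis i 1 :: real ^ 'n"
    have "((\<lambda>s. zermelo_norm x (y + s *\<^sub>R ?e) * (H x (y + s *\<^sub>R ?e - zermelo_norm x (y + s *\<^sub>R ?e) *\<^sub>R w x) ?b
        / (zermelo_norm x (y + s *\<^sub>R ?e) + H x (y + s *\<^sub>R ?e - zermelo_norm x (y + s *\<^sub>R ?e) *\<^sub>R w x) (w x)))) has_real_derivative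
        f ?e * (H x v ?b / Dn) + (H x (dv ?e) ?b * Dn - H x v ?b * D' ?e) / (Dn * Dn) * 1) (at 0)"
      by (rule DERIV_cong[OF DERIV_mult[OF F' DERIV_divide[OF Hv'[of ?e ?b] D'[of ?e] den0[of ?e]]]])
        (simp only: at0 Dn_def[symmetric])
    then have "((\<lambda>s. partial i (\<lambda>u. (1/2) * (zermelo_norm x u)\<^sup>2) (y + s *\<^sub>R ?e)) has_real_derivative
        f ?e * (H x v ?b / Dn) + (H x (dv ?e) ?b * Dn - H x v ?b * D' ?e) / (Dn * Dn) * 1) (at 0)"
      by (rule DERIV_cong_ev[OF refl _ refl, THEN iffD2, rotated])
        (rule eventually_mono[OF ev], rule partial_y_F[OF x])
    from DERIV_imp_deriv[OF this]
    have "partial j (partial i (\<lambda>u. (1/2) * (zermelo_norm x u)\<^sup>2)) y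
        = f ?e * (H x v ?b / Dn) + (H x (dv ?e) ?b * Dn - H x v ?b * D' ?e) / (Dn * Dn)"
      by (simp only: partial_def[of j] mult_1_right)
    then have "zermelo_hessian x y $ i $ j = f ?e * (H x v ?b / Dn) + (H x (dv ?e) ?b * Dn - H x v ?b * D' ?e) / (Dn * Dn)"
      by (simp add: zermelo_hessian_def)
    also have "\<dots> = f ?e * f ?b + (H x (dv ?e) ?b - f ?b * D' ?e) / Dn"
      using Dn by (simp add: f_def field_simps)
    also have "\<dots> = G ?b ?e"
      unfolding G_def D'_def using H_sym[OF xS, of "dv ?b" "dv ?e"]
      by (simp add: dv_def[of ?b] H_linear algebra_simps)
    finally show ?thesis .
  qed
  have f_lin: "f (b + c) = f b + f c" "f (r *\<^sub>R b) = r * f b" for b c r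
    by (simp_all add: f_def H_linear add_divide_distrib)
  have dv_lin: "dv (b + c) = dv b + dv c" "dv (r *\<^sub>R b) = r *\<^sub>R dv b" for b c r
    by (simp_all add: dv_def f_lin algebra_simps)
  have G_lin: "linear (G b)" for b
    by (intro linearI) (simp_all add: G_def f_lin dv_lin H_linear algebra_simps add_divide_distrib diff_divide_distrib)
  have gFa: "(zermelo_hessian x y *v u) $ i = G (axis i 1) u" for u i
    unfolding matrix_vector_mult_def vec_lambda_beta zermelo_hessian
    using linear_sum_axis[OF G_lin, of "axis i 1" u] by (simp add: mult.commute)
  have G_lin1: "linear (\<lambda>b. G b e)" for e
    by (intro linearI) (simp_all add: G_def f_lin dv_lin H_linear algebra_simps add_divide_distrib diff_divide_distrib)
  have inv: "invertible (zermelo_hessian x y)"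
  proof -
    have "u = 0" if "zermelo_hessian x y *v u = 0" for u
    proof -
      have "G (axis i 1) u = 0" for i using gFa[of u i] that by simp
      then have G0: "G u u = 0" using linear_sum_axis[OF G_lin1, of u u] by simp
      have "H x v (dv u) = f u * Dn - f u * H x v (w x)"
        using Dn by (simp add: dv_def f_def H_linear)
      then have "H x v (dv u) = f u" by (simp add: Dn_def algebra_simps)
      then have cs: "(f u)\<^sup>2 \<le> H x (dv u) (dv u)"
        using H_cauchy_schwarz[OF xS, of v "dv u"] by (simp add: vv)
      have "(f u)\<^sup>2 + (H x (dv u) (dv u) - (f u)\<^sup>2) / Dn = 0"
        using G0 by (simp add: G_def power2_eq_square)
      moreover have "(H x (dv u) (dv u) - (f u)\<^sup>2) / Dn \<ge> 0" using cs Dn by simp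
      ultimately have "(f u)\<^sup>2 = 0 \<and> (H x (dv u) (dv u) - (f u)\<^sup>2) / Dn = 0"
        by (smt (verit) zero_le_power2)
      then have "f u = 0" "H x (dv u) (dv u) = 0" using Dn by auto
      then have "dv u = 0" using H_pos[OF xS, of "dv u"] by fastforce
      then show "u = 0" by (simp add: dv_def \<open>f u = 0\<close>)
    qed
    then show ?thesis unfolding invertible_left_inverse matrix_left_invertible_ker by blast
  qed
  \<comment> \<open>here $N(b) / (1 + h(v,w))$ is the derivative of $F$ in the base direction $b$, and $N'$, $D'$ are the fibre derivatives of $N$ and of the denominator\<close>
  have mixed: "partial l (\<lambda>u. partial k (\<lambda>z. (zermelo_norm z u)\<^sup>2) x) y
      = 2 * (f (axis l 1) * N (axis k 1) / Dn
        + (N' (axis k 1) (axis l 1) * Dn - N (axis k 1) * D' (axis l 1)) / (Dn * Dn))" for l k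
  proof -
    let ?e = "axis l 1 :: real ^ 'n" and ?b = "axis k 1 :: real ^ 'n"
    let ?F = "\<lambda>s. zermelo_norm x (y + s *\<^sub>R ?e)" and ?v = "\<lambda>s. y + s *\<^sub>R ?e - zermelo_norm x (y + s *\<^sub>R ?e) *\<^sub>R w x"
    have N': "((\<lambda>s. dH x ?b (?v s) (?v s) / 2 - ?F s * H x (?v s) (D w x ?b)) has_real_derivative N' ?b ?e) (at 0)"
      by (rule DERIV_cong[OF DERIV_diff[OF DERIV_cdivide[OF dHv'] DERIV_mult[OF F' Hv']]])
        (simp add: N'_def F1 v_def)
    have "((\<lambda>s. 2 * ?F s * ((dH x ?b (?v s) (?v s) / 2 - ?F s * H x (?v s) (D w x ?b)) / (?F s + H x (?v s) (w x))))
      has_real_derivative (2 * f ?e) * (N ?b / Dn) + (N' ?b ?e * Dn - N ?b * D' ?e) / (Dn * Dn) * (2 * 1)) (at 0)"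
      by (rule DERIV_cong[OF DERIV_mult[OF DERIV_cmult[OF F', where c = 2] DERIV_divide[OF N' D'[of ?e] den0[of ?e]]]])
        (simp only: at0 Dn_def[symmetric] N_def mult_1)
    then have "((\<lambda>s. partial k (\<lambda>z. (zermelo_norm z (y + s *\<^sub>R ?e))\<^sup>2) x) has_real_derivative
        (2 * f ?e) * (N ?b / Dn) + (N' ?b ?e * Dn - N ?b * D' ?e) / (Dn * Dn) * (2 * 1)) (at 0)"
      by (rule DERIV_cong_ev[OF refl _ refl, THEN iffD2, rotated])
        (rule eventually_mono[OF ev], rule partial_x_F[OF x])
    then show ?thesis
      unfolding partial_def[of l] by (simp add: DERIV_imp_deriv mult_ac)
  qed
  have N_lin: "linear N" 
    by (intro linearI) (simp_all add: N_def dH_linear_direction[OF xS] H_linear linear_add[OF linw] linear_cmul[OF linw]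
        algebra_simps add_divide_distrib diff_divide_distrib)
  have N'_lin: "linear (\<lambda>b. N' b e)" for e
    by (intro linearI) (simp_all add: N'_def dH_linear_direction[OF xS] H_linear linear_add[OF linw] linear_cmul[OF linw] algebra_simps)
  have Q: "(\<Sum>k\<in>UNIV. partial l (\<lambda>u. partial k (\<lambda>z. (zermelo_norm z u)\<^sup>2) x) y * y $ k)
     = 2 * (f (axis l 1) * N y / Dn + (N' y (axis l 1) * Dn - N y * D' (axis l 1)) / (Dn * Dn))" for l
  proof -
    let ?T = "\<lambda>b. 2 * (f (axis l 1) * N b / Dn + (N' b (axis l 1) * Dn - N b * D' (axis l 1)) / (Dn * Dn))"
    have "linear ?T"
      by (intro linearI) (simp_all add: linear_add[OF N_lin] linear_cmul[OF N_lin] linear_add[OF N'_lin] linear_cmul[OF N'_lin]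
          algebra_simps add_divide_distrib diff_divide_distrib)
    from linear_sum_axis[OF this, of y] show ?thesis by (simp add: mixed mult.commute)
  qed
  have P: "partial l (\<lambda>z. (zermelo_norm z y)\<^sup>2) x = 2 * (N (axis l 1) / Dn)" for l
    using partial_x_F[OF x y, of l] by (simp add: F1 N_def Dn_def v_def)
  define R where "R e = f e * N y / Dn + (N' y e * Dn - N y * D' e) / (Dn * Dn) - N e / Dn" for e
  define Rv where "Rv = (\<chi> l. R (axis l 1))"
  have zermelo_spray: "2 * zermelo_spray i x y = (matrix_inv (zermelo_hessian x y) *v Rv) $ i" for i
    unfolding zermelo_spray_def Q P matrix_vector_mult_def Rv_def R_def
    by (simp add: sum_distrib_left right_diff_distrib[symmetric] algebra_simps)
  have mi: "zermelo_hessian x y ** matrix_inv (zermelo_hessian x y) = mat 1" "matrix_inv (zermelo_hessian x y) ** zermelo_hessian x y = mat 1"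
    using inv unfolding invertible_def matrix_inv_def by (metis (mono_tags, lifting) someI_ex)+
  have "(\<forall>i. a $ i + 2 * zermelo_spray i x y = 0) \<longleftrightarrow> a + matrix_inv (zermelo_hessian x y) *v Rv = 0"
    by (simp add: vec_eq_iff zermelo_spray)
  also have "\<dots> \<longleftrightarrow> zermelo_hessian x y *v a + Rv = 0"
  proof
    assume "a + matrix_inv (zermelo_hessian x y) *v Rv = 0"
    then have "zermelo_hessian x y *v (a + matrix_inv (zermelo_hessian x y) *v Rv) = 0" by simp
    then show "zermelo_hessian x y *v a + Rv = 0"
      by (simp add: matrix_vector_right_distrib matrix_vector_mul_assoc mi)
  next
    assume "zermelo_hessian x y *v a + Rv = 0"
    then have "matrix_inv (zermelo_hessian x y) *v (zermelo_hessian x y *v a + Rv) = 0" by simp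
    then show "a + matrix_inv (zermelo_hessian x y) *v Rv = 0"
      by (simp add: matrix_vector_right_distrib matrix_vector_mul_assoc mi)
  qed
  also have "\<dots> \<longleftrightarrow> (\<forall>l. G (axis l 1) a + R (axis l 1) = 0)"
    by (simp add: vec_eq_iff gFa Rv_def)
  also have "\<dots> \<longleftrightarrow> (\<forall>z. G z a + R z = 0)"
  proof -
    have "linear (\<lambda>e. G e a + R e)"
    proof -
      have "linear (\<lambda>e. N' y e)"
        by (intro linearI) (simp_all add: N'_def dv_lin f_lin dH_linear H_linear algebra_simps)
      moreover have "linear D'"
        by (intro linearI) (simp_all add: D'_def dv_lin f_lin H_linear algebra_simps)
      ultimately show ?thesis
        by (intro linearI) (simp_all add: R_def linear_add[OF N_lin] linear_cmul[OF N_lin] linear_add[OF G_lin1] linear_cmul[OF G_lin1]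
          linear_add linear_cmul f_lin algebra_simps add_divide_distrib diff_divide_distrib)
    qed
    from linear_sum_axis[OF this] show ?thesis by (metis (no_types, lifting) scaleR_zero_right sum.neutral)
  qed
  also have "\<dots> \<longleftrightarrow> a - D w x y = D w x v - Gam x v v - (\<sigma> / 2) *\<^sub>R v"
  proof -
    define b where "b = a - D w x y"
    have yv: "y = v + w x" by (simp add: v_def)
    define K where "K = H x b (w x) + dH x y v (w x) + H x v (D w x y)"
    have Hom: "dH x (w x) v z = \<sigma> * H x v z - H x (D w x v) z - H x v (D w x z)" for z
      using homothety[OF xS, of v z] by simp
    have dHy: "dH x y v z = dH x v v z + \<sigma> * H x v z - H x (D w x v) z - H x v (D w x z)" for z
      unfolding yv by (simp add: dH_linear_direction[OF xS] Hom)
    have Ga: "H x (Gam x v v) z = dH x v v z - dH x z v v / 2" for z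
      by (simp add: H_Gam[OF xS] field_simps)
    have const': "N y + H x v a = 0"
      using const by (simp add: N_def H_linear)
    have fa: "f a * Dn = - N y" using const' Dn by (simp add: f_def)
    have EL: "(G z a + R z) * Dn = H x (b + Gam x v v - D w x v + \<sigma> *\<^sub>R v - (K / Dn) *\<^sub>R v) z" for z
    proof -
      have "(G z a + R z) * Dn = f z * (f a * Dn) + (H x (dv z) (dv a) - f z * f a) + f z * N y
          + N' y z - (N y / Dn) * D' z - N z"
        using Dn by (simp add: G_def R_def field_simps)
      also have "N y / Dn = - f a" using fa Dn by (simp add: field_simps)
      also have "f z * (f a * Dn) + (H x (dv z) (dv a) - f z * f a) + f z * N y + N' y z - (- f a) * D' z - N z
        = H x (dv z) a + N' y z - N z"
        unfolding fa D'_def dv_def[of a] by (simp add: H_linear algebra_simps)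
      also have "\<dots> = H x (dv z) b + dH x y v (dv z) - f z * H x v (D w x y) - N z"
        by (simp add: N'_def b_def H_linear algebra_simps)
      also have "\<dots> = H x b z + dH x y v z - N z - f z * K"
        unfolding K_def dv_def using H_sym[OF xS, of b] by (simp add: H_linear dH_linear algebra_simps)
      also have "\<dots> = H x b z + H x (Gam x v v) z + \<sigma> * H x v z - H x (D w x v) z - f z * K"
        unfolding N_def dHy Ga by simp
      also have "\<dots> = H x (b + Gam x v v - D w x v + \<sigma> *\<^sub>R v - (K / Dn) *\<^sub>R v) z"
        by (simp add: f_def H_linear)
      finally show ?thesis .
    qed
    have half: "\<sigma> *\<^sub>R v = (\<sigma> / 2) *\<^sub>R v + (\<sigma> / 2) *\<^sub>R v"
      by (simp flip: scaleR_left_distrib)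
    have "(\<forall>z. G z a + R z = 0) \<longleftrightarrow> (\<forall>z. (G z a + R z) * Dn = 0)" using Dn by simp
    also have "\<dots> \<longleftrightarrow> b + Gam x v v - D w x v + \<sigma> *\<^sub>R v - (K / Dn) *\<^sub>R v = 0"
    proof
      assume "\<forall>z. (G z a + R z) * Dn = 0"
      then show "b + Gam x v v - D w x v + \<sigma> *\<^sub>R v - (K / Dn) *\<^sub>R v = 0"
        unfolding EL by (intro H_nondegenerate[OF xS]) (simp add: H_linear(9))
    qed (simp add: EL H_linear(9))
    also have "\<dots> \<longleftrightarrow> b = D w x v - Gam x v v - (\<sigma> / 2) *\<^sub>R v"
    proof
      assume eq: "b + Gam x v v - D w x v + \<sigma> *\<^sub>R v - (K / Dn) *\<^sub>R v = 0"
      then have "H x (b + Gam x v v - D w x v + \<sigma> *\<^sub>R v - (K / Dn) *\<^sub>R v) v = 0" by (simp add: H_linear)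
      then have 1: "H x b v + H x (Gam x v v) v - H x (D w x v) v + \<sigma> = K / Dn"
        by (simp add: H_linear vv)
      have "dH x y v v / 2 + H x b v = 0" using const H_sym[OF xS, of b v] by (simp add: b_def)
      then have "K / Dn = \<sigma> / 2"
        using 1 dHy[of v] Ga[of v] H_sym[OF xS, of v "D w x v"] by (simp add: vv field_simps)
      with eq have eq': "b + Gam x v v - D w x v + ((\<sigma> / 2) *\<^sub>R v + (\<sigma> / 2) *\<^sub>R v) - (\<sigma> / 2) *\<^sub>R v = 0"
        by (simp only: half)
      have "B + C - E + (A + A) - A = B + (C - E + A)" for A B C E :: "real ^ 'n"
        by (simp add: vec_eq_iff)
      from this[symmetric] eq' have "b + (Gam x v v - D w x v + (\<sigma> / 2) *\<^sub>R v) = 0"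
        by (rule trans)
      then have "b = - (Gam x v v - D w x v + (\<sigma> / 2) *\<^sub>R v)"
        unfolding eq_neg_iff_add_eq_0 .
      then show "b = D w x v - Gam x v v - (\<sigma> / 2) *\<^sub>R v" by simp
    next
      assume b: "b = D w x v - Gam x v v - (\<sigma> / 2) *\<^sub>R v"
      have "K = H x (D w x v) (w x) - H x (Gam x v v) (w x) - \<sigma> / 2 * H x v (w x) + dH x y v (w x) + H x v (D w x v) + H x v (D w x (w x))"
        unfolding K_def b yv by (simp add: H_linear linear_add[OF linw])
      also have "\<dots> = \<sigma> / 2 * Dn"
        using dHy[of "w x"] Ga[of "w x"] Hom[of v] H_sym[OF xS, of v "D w x v"]
        by (simp add: Dn_def vv field_simps)
      finally have KD: "K / Dn = \<sigma> / 2" using Dn by simp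
      have "(E - C - A) + C - E + (A + A) - A = 0" for A C E :: "real ^ 'n"
        by (simp add: vec_eq_iff)
      then show "b + Gam x v v - D w x v + \<sigma> *\<^sub>R v - (K / Dn) *\<^sub>R v = 0"
        unfolding b KD half .
    qed
    finally show ?thesis unfolding b_def .
  qed
  finally show ?thesis .
qed

text \<open>
  A solution of the equation for $v$ with $h(v,v) = 1$ keeps this value to first order; this is the
  condition that $F$ is constant along the curve.
\<close>

lemma geodesic_equation_speed:
  assumes x: "x \<in> S" and "H x v v = 1" "y = v + w x"
    and "a - D w x y = D w x v - Gam x v v - (\<sigma> / 2) *\<^sub>R v"
  shows "dH x y v v / 2 + H x v (a - D w x y) = 0"
  unfolding assms(4) unfolding assms(3) dH_linear_direction[OF x]
  using homothety[OF x, of v v] H_Gam[OF x, of v v v] H_sym[OF x, of v "D w x v"] H_sym[OF x, of v "Gam x v v"] assms(2)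
  by (simp add: H_linear field_simps)

end

section \<open>From the manifold to charts\<close>

lemma homeomorphism_chart:
  assumes "is_chart c"
  shows "open (cdom c)" "open (cimg c)" "continuous_on (cdom c) (cmap c)" "continuous_on (cimg c) (cinv c)"
    "p \<in> cdom c \<Longrightarrow> cinv c (cmap c p) = p" "p \<in> cdom c \<Longrightarrow> cmap c p \<in> cimg c"
    "x \<in> cimg c \<Longrightarrow> cmap c (cinv c x) = x" "x \<in> cimg c \<Longrightarrow> cinv c x \<in> cdom c"
  using assms unfolding is_chart_def homeomorphism_def by auto

lemma partial_cong_open:
  assumes "open S" "x \<in> S" "\<And>y. y \<in> S \<Longrightarrow> f y = f' y"
  shows "partial i f x = partial i f' x"
proof -
  have "((\<lambda>s. x + s *\<^sub>R axis i 1) \<longlongrightarrow> x + 0 *\<^sub>R axis i 1) (nhds 0)"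
    by (intro tendsto_intros) (simp add: filterlim_ident)
  then have "\<forall>\<^sub>F s in nhds 0. x + s *\<^sub>R axis i 1 \<in> S"
    using assms by (intro topological_tendstoD) auto
  then have "\<forall>\<^sub>F s in nhds 0. f (x + s *\<^sub>R axis i 1) = f' (x + s *\<^sub>R axis i 1)"
    by (rule eventually_mono) (rule assms(3))
  then show ?thesis unfolding partial_def by (intro deriv_cong_ev) auto
qed

locale homothetic_manifold =
  fixes A :: "('m::{t2_space, second_countable_topology}, 'n::finite) chart set"
    and h :: "('m, 'n) metric"
    and W :: "'m \<Rightarrow> ('m, 'n) tangent"
    and \<sigma> :: real
  assumes manifold: "smooth_atlas A"
    and metric: "riemannian_metric A h"
    and homothety: "infinitesimal_homothety A h W \<sigma>"
begin

lemma chart_in_atlas: "c \<in> A \<Longrightarrow> is_chart c"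
  using manifold unfolding smooth_atlas_def by blast

lemmas chart = homeomorphism_chart[OF chart_in_atlas]

abbreviation overlap :: "('m, 'n) chart \<Rightarrow> ('m, 'n) chart \<Rightarrow> (real ^ 'n) set" where
  "overlap c d \<equiv> cmap c ` (cdom c \<inter> cdom d)"

lemma overlap_eq: "c \<in> A \<Longrightarrow> overlap c d = cimg c \<inter> cinv c -` cdom d"
proof (intro equalityI subsetI)
  fix x assume c: "c \<in> A" and "x \<in> cimg c \<inter> cinv c -` cdom d"
  then have "cinv c x \<in> cdom c \<inter> cdom d" "x = cmap c (cinv c x)" by (simp_all add: chart)
  then show "x \<in> overlap c d" by (rule rev_image_eqI)
qed (auto simp: chart)

lemma open_overlap: assumes "c \<in> A" "d \<in> A" shows "open (overlap c d)"
  unfolding overlap_eq[OF assms(1)]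
  by (intro continuous_open_preimage chart assms)

lemma smooth_transition: "c \<in> A \<Longrightarrow> d \<in> A \<Longrightarrow> smooth_on (transition c d) (overlap c d)"
  using manifold unfolding smooth_atlas_def by blast

lemma transition_cmap: "c \<in> A \<Longrightarrow> p \<in> cdom c \<Longrightarrow> transition c d (cmap c p) = cmap d p"
  by (simp add: transition_def chart)

lemma transition_has_derivative:
  assumes "c \<in> A" "d \<in> A" "p \<in> cdom c" "p \<in> cdom d"
  shows "(transition c d has_derivative D (transition c d) (cmap c p)) (at (cmap c p))"
  by (rule smooth_on_has_derivative[OF smooth_transition]) (use assms in auto)

lemma linear_D_transition:
  "c \<in> A \<Longrightarrow> d \<in> A \<Longrightarrow> p \<in> cdom c \<Longrightarrow> p \<in> cdom d \<Longrightarrow> linear (D (transition c d) (cmap c p))"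
  using transition_has_derivative has_derivative_linear by blast

lemma D_transition_cocycle:
  assumes "c \<in> A" "d \<in> A" "e \<in> A" "p \<in> cdom c" "p \<in> cdom d" "p \<in> cdom e"
  shows "D (transition c e) (cmap c p) u = D (transition d e) (cmap d p) (D (transition c d) (cmap c p) u)"
proof -
  have "(transition d e has_derivative D (transition d e) (cmap d p)) (at (transition c d (cmap c p)))"
    using transition_has_derivative[of d e p] assms by (simp add: transition_cmap)
  from has_derivative_compose[OF transition_has_derivative[OF assms(1,2,4,5)] this]
  have "((\<lambda>x. transition d e (transition c d x)) has_derivative
      (\<lambda>u. D (transition d e) (cmap d p) (D (transition c d) (cmap c p) u))) (at (cmap c p))" .
  then have "(transition c e has_derivative
      (\<lambda>u. D (transition d e) (cmap d p) (D (transition c d) (cmap c p) u))) (at (cmap c p))"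
    by (rule has_derivative_transform_within_open[OF _ open_overlap[OF assms(1,2)]])
      (use assms in \<open>auto simp: transition_cmap\<close>)
  from frechet_derivative_at[OF this] show ?thesis by metis
qed

lemma D_transition_self: assumes "c \<in> A" "p \<in> cdom c" shows "D (transition c c) (cmap c p) u = u"
proof -
  have "(transition c c has_derivative (\<lambda>u. u)) (at (cmap c p))"
    by (rule has_derivative_transform_within_open[OF has_derivative_ident open_overlap[OF assms(1,1)]])
      (use assms in \<open>auto simp: transition_cmap\<close>)
  from frechet_derivative_at[OF this] show ?thesis by metis
qed

lemma tangent_of_in_tangent_space:
  assumes "c \<in> A" "p \<in> cdom c" shows "tangent_of A c p u \<in> tangent_space A p"
  unfolding tangent_space_def tangent_of_def
  by (auto intro: D_transition_cocycle[OF assms(1) _ _ assms(2)])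

lemma tangent_of_self: "c \<in> A \<Longrightarrow> p \<in> cdom c \<Longrightarrow> tangent_of A c p u c = u"
  by (simp add: tangent_of_def D_transition_self)

lemma tangent_space_eq_tangent_of:
  assumes "c \<in> A" "p \<in> cdom c" "v \<in> tangent_space A p" shows "v = tangent_of A c p (v c)"
proof (rule ext)
  fix d
  have "v d = D (transition c d) (cmap c p) (v c)" if "d \<in> A" "p \<in> cdom d"
    using assms that unfolding tangent_space_def by blast
  moreover have "v d = 0" if "\<not> (d \<in> A \<and> p \<in> cdom d)"
    using assms that unfolding tangent_space_def by blast
  ultimately show "v d = tangent_of A c p (v c) d" unfolding tangent_of_def by metis
qed

lemma tangent_of_transition:
  assumes "c \<in> A" "d \<in> A" "p \<in> cdom c" "p \<in> cdom d"
  shows "tangent_of A c p u = tangent_of A d p (D (transition c d) (cmap c p) u)"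
  unfolding tangent_of_def
  by (intro ext if_cong refl) (auto intro: D_transition_cocycle[OF assms(1,2) _ assms(3,4)])

lemma tangent_of_linear:
  assumes "c \<in> A" "p \<in> cdom c"
  shows "tangent_of A c p (a *\<^sub>R u + v) = (\<lambda>d. a *\<^sub>R tangent_of A c p u d + tangent_of A c p v d)"
  unfolding tangent_of_def using linear_D_transition[OF assms(1) _ assms(2)]
  by (intro ext) (auto simp: linear_add linear_cmul)

lemma in_carrier: "c \<in> A \<Longrightarrow> p \<in> cdom c \<Longrightarrow> p \<in> carrier A"
  by (auto simp: carrier_def)

lemma h_sym: "p \<in> carrier A \<Longrightarrow> u \<in> tangent_space A p \<Longrightarrow> v \<in> tangent_space A p \<Longrightarrow> h p u v = h p v u"
  and h_linear: "p \<in> carrier A \<Longrightarrow> u \<in> tangent_space A p \<Longrightarrow> v \<in> tangent_space A p \<Longrightarrow> v' \<in> tangent_space A p \<Longrightarrow>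
      h p (\<lambda>c. a *\<^sub>R u c + v c) v' = a * h p u v' + h p v v'"
  and h_pos: "p \<in> carrier A \<Longrightarrow> u \<in> tangent_space A p \<Longrightarrow> u \<noteq> (\<lambda>c. 0) \<Longrightarrow> h p u u > 0"
  using metric unfolding riemannian_metric_def by blast+

lemma linear_h_tangent_of:
  assumes "c \<in> A" "p \<in> cdom c" "v \<in> tangent_space A p"
  shows "linear (\<lambda>u. h p (tangent_of A c p u) v)" "linear (\<lambda>u. h p v (tangent_of A c p u))"
proof -
  note T = in_carrier[OF assms(1,2)] tangent_of_in_tangent_space[OF assms(1,2)]
  have *: "h p (tangent_of A c p (a *\<^sub>R u + u')) v = a * h p (tangent_of A c p u) v + h p (tangent_of A c p u') v" for a u u'
    unfolding tangent_of_linear[OF assms(1,2)] by (rule h_linear) (use T assms in auto)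
  have z: "h p (tangent_of A c p 0) v = 0" using *[of 1 0 0] by simp
  show "linear (\<lambda>u. h p (tangent_of A c p u) v)"
    using *[of 1] *[of _ _ 0] z by (intro linearI) simp_all
  then show "linear (\<lambda>u. h p v (tangent_of A c p u))"
    using h_sym[OF T(1) T(2) assms(3)] by simp
qed

lemma h_tangent_of_sum:
  assumes "c \<in> A" "p \<in> cdom c"
  shows "h p (tangent_of A c p u) (tangent_of A c p v) =
      (\<Sum>i\<in>UNIV. \<Sum>j\<in>UNIV. metric_comp A h c i j (cmap c p) * u $ i * v $ j)"
proof -
  have "h p (tangent_of A c p u) (tangent_of A c p v)
      = (\<Sum>i\<in>UNIV. u $ i *\<^sub>R h p (tangent_of A c p (axis i 1)) (tangent_of A c p v))"
    by (rule linear_sum_axis[OF linear_h_tangent_of(1)[OF assms tangent_of_in_tangent_space[OF assms]]])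
  also have "\<dots> = (\<Sum>i\<in>UNIV. u $ i *\<^sub>R (\<Sum>j\<in>UNIV.
      v $ j *\<^sub>R h p (tangent_of A c p (axis i 1)) (tangent_of A c p (axis j 1))))"
    by (intro sum.cong refl arg_cong2[of _ _ _ _ scaleR]
        linear_sum_axis[OF linear_h_tangent_of(2)[OF assms tangent_of_in_tangent_space[OF assms]]])
  finally show ?thesis
    unfolding metric_comp_def chart(5)[OF assms] by (simp add: sum_distrib_left mult_ac)
qed

lemma chart_local_metric: assumes c: "c \<in> A" shows "local_metric (cimg c) (metric_comp A h c)"
proof
  show "open (cimg c)" by (rule chart(2)[OF c])
  show "smooth_on (metric_comp A h c i j) (cimg c)" for i j
    using metric c unfolding riemannian_metric_def by blast
  fix x assume x: "x \<in> cimg c"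
  have p: "cinv c x \<in> cdom c" "cmap c (cinv c x) = x" using chart(7,8)[OF c x] by auto
  show "metric_comp A h c i j x = metric_comp A h c j i x" for i j
    unfolding metric_comp_def
    by (rule h_sym) (auto intro!: in_carrier[OF c] tangent_of_in_tangent_space[OF c] p)
  fix u :: "real ^ 'n" assume "u \<noteq> 0"
  then have "tangent_of A c (cinv c x) u c \<noteq> 0" by (simp add: tangent_of_self[OF c p(1)])
  then have "tangent_of A c (cinv c x) u \<noteq> (\<lambda>c. 0)" by metis
  then have "h (cinv c x) (tangent_of A c (cinv c x) u) (tangent_of A c (cinv c x) u) > 0"
    by (intro h_pos in_carrier[OF c] tangent_of_in_tangent_space[OF c] p)
  then show "(\<Sum>i\<in>UNIV. \<Sum>j\<in>UNIV. metric_comp A h c i j x * u $ i * u $ j) > 0"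
    unfolding h_tangent_of_sum[OF c p(1)] p(2) .
qed

abbreviation Hc where "Hc c \<equiv> local_metric.H (metric_comp A h c)"
abbreviation Gc where "Gc c \<equiv> local_metric.Gam (metric_comp A h c)"
abbreviation wc where "wc c \<equiv> field_comp W c"

lemma h_tangent_of:
  assumes "c \<in> A" "p \<in> cdom c"
  shows "h p (tangent_of A c p u) (tangent_of A c p v) = Hc c (cmap c p) u v"
  unfolding h_tangent_of_sum[OF assms] local_metric.H_def[OF chart_local_metric[OF assms(1)]] ..

lemma Hc_transition:
  assumes "c \<in> A" "d \<in> A" "p \<in> cdom c" "p \<in> cdom d"
  shows "Hc c (cmap c p) u v
    = Hc d (cmap d p) (D (transition c d) (cmap c p) u) (D (transition c d) (cmap c p) v)"
  unfolding h_tangent_of[OF assms(1,3), symmetric] h_tangent_of[OF assms(2,4), symmetric]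
    tangent_of_transition[OF assms] ..

text \<open>
  A transition map is an isometry between the metrics of its two charts.
\<close>

lemma Gc_transition:
  assumes "c \<in> A" "d \<in> A" "p \<in> cdom c" "p \<in> cdom d"
  shows "D (transition c d) (cmap c p) (Gc c (cmap c p) y y)
    = Gc d (cmap d p) (D (transition c d) (cmap c p) y) (D (transition c d) (cmap c p) y)
      + D (\<lambda>z. D (transition c d) z y) (cmap c p) y"
proof -
  have "D (transition c d) (cmap c p) (Gc c (cmap c p) y y)
    = Gc d (transition c d (cmap c p)) (D (transition c d) (cmap c p) y) (D (transition c d) (cmap c p) y)
      + D (\<lambda>z. D (transition c d) z y) (cmap c p) y"
  proof (rule christoffel_transformation[OF chart_local_metric[OF assms(1)] chart_local_metric[OF assms(2)]
        open_overlap[OF assms(1,2)] _ _ smooth_transition[OF assms(1,2)]])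
    show "overlap c d \<subseteq> cimg c" "transition c d ` overlap c d \<subseteq> cimg d"
      using assms by (auto simp: transition_cmap chart)
    show "cmap c p \<in> overlap c d" using assms by auto
    show "Hc c x u v = Hc d (transition c d x) (D (transition c d) x u) (D (transition c d) x v)"
      if "x \<in> overlap c d" for x u v
      using that Hc_transition[OF assms(1,2)] by (auto simp: transition_cmap[OF assms(1)])
    show "surj (D (transition c d) (cmap c p))"
      using D_transition_cocycle[OF assms(2,1,2,4,3,4)] D_transition_self[OF assms(2,4)] by (metis surjI)
  qed
  then show ?thesis by (simp add: transition_cmap assms)
qed

lemma chart_local_homothety: assumes c: "c \<in> A"
  shows "local_homothety (cimg c) (metric_comp A h c) (wc c) \<sigma>"
proof -
  interpret local_metric "cimg c" "metric_comp A h c" by (rule chart_local_metric[OF c])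
  show ?thesis
    by unfold_locales
      (use homothety c in \<open>auto simp: infinitesimal_homothety_def smooth_vector_field_def lie_derivative_comp_def\<close>)
qed

lemma W_in_tangent_space: "p \<in> carrier A \<Longrightarrow> W p \<in> tangent_space A p"
  using homothety unfolding infinitesimal_homothety_def smooth_vector_field_def by blast

lemma W_eq_tangent_of: assumes "c \<in> A" "p \<in> cdom c" shows "W p = tangent_of A c p (wc c (cmap c p))"
  unfolding field_comp_def chart(5)[OF assms]
  by (rule tangent_space_eq_tangent_of[OF assms W_in_tangent_space[OF in_carrier[OF assms]]])

lemma wc_transition:
  assumes "c \<in> A" "d \<in> A" "p \<in> cdom c" "p \<in> cdom d"
  shows "D (transition c d) (cmap c p) (wc c (cmap c p)) = W p d"
proof -
  have "W p d = D (transition c d) (cmap c p) (W p c)"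
    using W_in_tangent_space[OF in_carrier[OF assms(1,3)]] assms unfolding tangent_space_def by blast
  then show ?thesis by (simp add: field_comp_def chart assms)
qed

lemma hnorm_square:
  assumes "c \<in> A" "p \<in> cdom c" shows "(hnorm h p (tangent_of A c p u))\<^sup>2 = Hc c (cmap c p) u u"
  using local_metric.H_nonneg[OF chart_local_metric[OF assms(1)] chart(6)[OF assms], of u]
  by (simp add: hnorm_def h_tangent_of[OF assms])

lemma randers_tangent_of:
  assumes "c \<in> A" "p \<in> cdom c"
  shows "randers h W p (tangent_of A c p u) = local_homothety.zermelo_norm (metric_comp A h c) (wc c) (cmap c p) u"
proof -
  interpret local_homothety "cimg c" "metric_comp A h c" "wc c" \<sigma> by (rule chart_local_homothety[OF assms(1)])
  have "h p (W p) (tangent_of A c p u) = H (cmap c p) (wc c (cmap c p)) u"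
    "(hnorm h p (W p))\<^sup>2 = H (cmap c p) (wc c (cmap c p)) (wc c (cmap c p))"
    unfolding W_eq_tangent_of[OF assms] h_tangent_of[OF assms] hnorm_square[OF assms] by simp_all
  then show ?thesis by (simp add: randers_def zermelo_norm_def Let_def hnorm_square[OF assms])
qed

lemma navigation_domain_iff:
  assumes "c \<in> A" "p \<in> cdom c"
  shows "p \<in> navigation_domain A h W
    \<longleftrightarrow> cmap c p \<in> local_homothety.mild_wind (cimg c) (metric_comp A h c) (wc c)"
proof -
  interpret local_homothety "cimg c" "metric_comp A h c" "wc c" \<sigma> by (rule chart_local_homothety[OF assms(1)])
  have 1: "(hnorm h p (W p))\<^sup>2 = H (cmap c p) (wc c (cmap c p)) (wc c (cmap c p))"
    unfolding W_eq_tangent_of[OF assms] hnorm_square[OF assms] by simp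
  have "h p (W p) (W p) \<ge> 0"
    unfolding W_eq_tangent_of[OF assms] h_tangent_of[OF assms] by (rule H_nonneg[OF chart(6)[OF assms]])
  then have "hnorm h p (W p) \<ge> 0" by (simp add: hnorm_def)
  then have "hnorm h p (W p) < 1 \<longleftrightarrow> (hnorm h p (W p))\<^sup>2 < 1"
    using abs_square_less_1 by (metis abs_of_nonneg)
  then show ?thesis
    using in_carrier[OF assms] chart(6)[OF assms] by (simp add: navigation_domain_def mild_wind_def 1)
qed

lemma spray_coeff_eq:
  assumes c: "c \<in> A" and x: "x \<in> cimg c"
  shows "spray_coeff A (randers h W) c i x y = local_homothety.zermelo_spray (metric_comp A h c) (wc c) i x y"
proof -
  interpret local_homothety "cimg c" "metric_comp A h c" "wc c" \<sigma> by (rule chart_local_homothety[OF c])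
  have F: "finsler_sq_loc A (randers h W) c z u = (zermelo_norm z u)\<^sup>2" if "z \<in> cimg c" for z u
    unfolding finsler_sq_loc_def using randers_tangent_of[OF c chart(8)[OF c that]] chart(7)[OF c that] by simp
  have p: "partial k (\<lambda>z. finsler_sq_loc A (randers h W) c z u) x = partial k (\<lambda>z. (zermelo_norm z u)\<^sup>2) x" for k u
    by (rule partial_cong_open[OF chart(2)[OF c] x]) (rule F)
  have "fundamental_tensor A (randers h W) c x y = zermelo_hessian x y"
    unfolding fundamental_tensor_def zermelo_hessian_def F[OF x] ..
  then show ?thesis unfolding spray_coeff_def zermelo_spray_def p by simp
qed

lemma christoffel_sum_eq:
  assumes c: "c \<in> A"
  shows "(\<Sum>j\<in>UNIV. \<Sum>k\<in>UNIV. christoffel A h c i j k x * u $ j * v $ k) = Gc c x u v $ i"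
proof -
  interpret local_metric "cimg c" "metric_comp A h c" by (rule chart_local_metric[OF c])
  show ?thesis unfolding christoffel_def Gam_def christoffel_symbol_def by simp
qed

end

section \<open>Moving integral curves along the flow\<close>

text \<open>
  The time of existence is uniform for all initial points at distance at least $d$ from the boundary of
  the compact set.
\<close>

lemma local_flow:
  fixes X :: "'a::euclidean_space \<Rightarrow> 'a"
  assumes K: "compact K" "convex K" "K \<subseteq> S"
    and X': "\<And>x. x \<in> S \<Longrightarrow> (X has_derivative X' x) (at x)"
    and cont: "\<And>v. continuous_on S (\<lambda>x. X' x v)"
    and d: "d > 0" "\<And>z. z \<in> Z \<Longrightarrow> cball z d \<subseteq> K"
  shows "\<exists>\<eta>>0. \<exists>\<Psi>. \<forall>z\<in>Z. \<Psi> z 0 = z \<and>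
    (\<forall>s\<in>{-\<eta><..<\<eta>}. \<Psi> z s \<in> K \<and> (\<Psi> z has_vector_derivative X (\<Psi> z s)) (at s))"
proof -
  obtain L where L: "L \<ge> 0" "\<And>x y. x \<in> K \<Longrightarrow> y \<in> K \<Longrightarrow> norm (X x - X y) \<le> L * norm (x - y)"
    using C1_on_compact_convex(1)[OF K X' cont] by blast
  have contX: "continuous_on K X"
    using L by (intro lipschitz_on_continuous_on[of L] lipschitz_onI) (auto simp: dist_norm)
  then have "compact (X ` K)" using K(1) compact_continuous_image by blast
  then obtain B where B: "B > 0" "\<And>x. x \<in> K \<Longrightarrow> norm (X x) \<le> B"
    using compact_imp_bounded bounded_pos by (metis image_eqI)
  define \<eta> where "\<eta> = min (d / B) (1 / (2 * (L + 1)))"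
  have \<eta>: "\<eta> > 0" using B L d by (simp add: \<eta>_def)
  have "B * \<eta> \<le> B * (d / B)" using B by (intro mult_left_mono) (auto simp: \<eta>_def)
  then have B\<eta>: "B * \<eta> \<le> d" using B by simp
  have "L * \<eta> \<le> (L + 1) * (1 / (2 * (L + 1)))" using L \<eta> by (intro mult_mono) (auto simp: \<eta>_def)
  also have "(L + 1) * (1 / (2 * (L + 1))) = 1 / 2" using L(1) by (simp add: divide_simps)
  finally have L\<eta>: "L * \<eta> \<le> 1 / 2" .
  have "\<exists>f. f 0 = z \<and> (\<forall>s\<in>{-\<eta><..<\<eta>}. f s \<in> K \<and> (f has_vector_derivative X (f s)) (at s))" if "z \<in> Z" for z
  proof -
    note sub = subsetD[OF d(2)[OF that]]
    have "\<exists>f. f 0 = z \<and> (\<forall>s\<in>{-\<eta><..<\<eta>}. f s \<in> cball z d \<and> (f has_vector_derivative X (f s)) (at s))"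
      by (rule picard_existence[OF L(2)[OF sub sub] L(1) B(2)[OF sub] \<eta> d(1) B\<eta> L\<eta>])
    then show ?thesis using sub by blast
  qed
  then have "\<exists>\<Psi>. \<forall>z\<in>Z. \<Psi> z 0 = z \<and>
    (\<forall>s\<in>{-\<eta><..<\<eta>}. \<Psi> z s \<in> K \<and> (\<Psi> z has_vector_derivative X (\<Psi> z s)) (at s))"
    by (intro bchoice) blast
  then show ?thesis using \<eta> by blast
qed

lemma has_vector_derivative_fst_snd:
  assumes "(z has_vector_derivative (a, b)) F"
  shows "((\<lambda>t. fst (z t)) has_vector_derivative a) F" "((\<lambda>t. snd (z t)) has_vector_derivative b) F"
  using has_derivative_fst[OF assms[unfolded has_vector_derivative_def]]
    has_derivative_snd[OF assms[unfolded has_vector_derivative_def]]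
  unfolding has_vector_derivative_def by simp_all

context local_metric begin

text \<open>
  By compactness of the unit sphere bundle over a small ball. It bounds the coordinate length of a
  velocity by its energy.
\<close>

lemma H_locally_coercive:
  assumes "x0 \<in> S"
  shows "\<exists>r>0. \<exists>m>0. cball x0 r \<subseteq> S \<and> (\<forall>x\<in>cball x0 r. \<forall>y. m * (norm y)\<^sup>2 \<le> H x y y)"
proof -
  obtain r where r: "r > 0" "cball x0 r \<subseteq> S" using open_S assms open_contains_cball by blast
  let ?C = "cball x0 r \<times> sphere (0 :: real ^ 'n) 1"
  have "continuous_on (S \<times> UNIV) (\<lambda>p. H (fst p) (snd p) (snd p))"
    unfolding H_def
    by (intro continuous_intros continuous_on_compose2[OF smooth_on_continuous_on[OF smooth_g]]) auto
  then have cont: "continuous_on ?C (\<lambda>p. H (fst p) (snd p) (snd p))"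
    by (rule continuous_on_subset) (use r in auto)
  have "(x0, axis undefined 1) \<in> ?C" using r(1) by simp
  then have "?C \<noteq> {}" by blast
  moreover have "compact ?C" by (intro compact_Times) auto
  ultimately obtain p where p: "p \<in> ?C" "\<forall>p'\<in>?C. H (fst p) (snd p) (snd p) \<le> H (fst p') (snd p') (snd p')"
    using continuous_attains_inf[OF _ _ cont] by meson
  define m where "m = H (fst p) (snd p) (snd p)"
  have "fst p \<in> S" "snd p \<noteq> 0" using p(1) r(2) by (auto simp: mem_Times_iff)
  then have "m > 0" unfolding m_def by (rule H_pos)
  moreover have "m * (norm y)\<^sup>2 \<le> H x y y" if x: "x \<in> cball x0 r" for x y
  proof (cases "y = 0")
    case False
    have "m \<le> H x ((1 / norm y) *\<^sub>R y) ((1 / norm y) *\<^sub>R y)"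
      using bspec[OF p(2), of "(x, (1 / norm y) *\<^sub>R y)"] x False by (simp add: m_def)
    then show ?thesis using False by (simp add: H_linear field_simps power2_eq_square)
  qed (simp add: H_linear)
  ultimately show ?thesis using r by blast
qed

end

context local_homothety begin

text \<open>
  For $k = 0$ the integral curves are the geodesics of $h$, and for $k = 1$ those with
  $h(y,y) = 1$ are the unit speed geodesics of the Randers metric.
\<close>

definition drift_field :: "real \<Rightarrow> (real ^ 'n) \<times> (real ^ 'n) \<Rightarrow> (real ^ 'n) \<times> (real ^ 'n)" where
  "drift_field k p = damped_spray p + k *\<^sub>R complete_lift p"

text \<open>
  The map $\Psi$ is a flow of the lift, up to the time $\eta$, for base points near $x_0$ and velocities
  shorter than $R$.
\<close>

definition lift_flow :: "(real ^ 'n) \<Rightarrow> real \<Rightarrow> real \<Rightarrow> real \<Rightarrow>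
    ((real ^ 'n) \<times> (real ^ 'n) \<Rightarrow> real \<Rightarrow> (real ^ 'n) \<times> (real ^ 'n)) \<Rightarrow> bool" where
  "lift_flow x0 r R \<eta> \<Psi> \<longleftrightarrow> (\<forall>z\<in>ball x0 r \<times> ball 0 R. \<Psi> z 0 = z \<and>
     (\<forall>s\<in>{-\<eta><..<\<eta>}. fst (\<Psi> z s) \<in> S \<and> (\<Psi> z has_vector_derivative complete_lift (\<Psi> z s)) (at s)))"

text \<open>
  Moving an integral curve of \<open>drift_field k\<close> along the lift with speed $b'$ adds $b'$ to the
  coefficient of the lift. All drift fields commute with the lift since it commutes with itself.
\<close>

lemma lift_flow_exists:
  assumes x0: "x0 \<in> S" and "r > 0" "cball x0 (2 * r) \<subseteq> S"
  shows "\<exists>\<eta>>0. \<exists>\<Psi>. lift_flow x0 r R \<eta> \<Psi> \<and>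
    (\<forall>J z k b b' t. open J \<longrightarrow> t \<in> J \<longrightarrow>
       (\<forall>t\<in>J. z t \<in> ball x0 r \<times> ball 0 R \<and> (z has_vector_derivative drift_field k (z t)) (at t)) \<longrightarrow>
       (b has_real_derivative b') (at t) \<longrightarrow> b t \<in> {-\<eta><..<\<eta>} \<longrightarrow>
       ((\<lambda>t. \<Psi> (z t) (b t)) has_vector_derivative drift_field (k + b') (\<Psi> (z t) (b t))) (at t))"
proof -
  (* room of width r around the initial points, both for base points and for velocities *)
  define K where "K = cball x0 (2 * r) \<times> cball (0 :: real ^ 'n) (R + r)"
  have K: "compact K" "convex K" "K \<subseteq> S \<times> UNIV"
    using assms by (auto simp: K_def compact_Times convex_Times)
  have sub: "cball z r \<subseteq> K" if "z \<in> ball x0 r \<times> ball 0 R" for z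
  proof
    fix z' assume "z' \<in> cball z r"
    then have "dist (fst z) (fst z') \<le> r" "dist (snd z) (snd z') \<le> r"
      using dist_fst_le[of z z'] dist_snd_le[of z z'] by auto
    moreover have "dist x0 (fst z) < r" "dist 0 (snd z) < R" using that by auto
    ultimately have "dist x0 (fst z') \<le> 2 * r" "dist 0 (snd z') \<le> R + r"
      using dist_triangle[of x0 "fst z'" "fst z"] dist_triangle[of 0 "snd z'" "snd z"] by linarith+
    then show "z' \<in> K" by (simp add: K_def mem_Times_iff)
  qed
  obtain \<eta> \<Psi> where \<eta>: "\<eta> > 0" and \<Psi>: "\<And>z. z \<in> ball x0 r \<times> ball 0 R \<Longrightarrow> \<Psi> z 0 = z"
    "\<And>z s. z \<in> ball x0 r \<times> ball 0 R \<Longrightarrow> s \<in> {-\<eta><..<\<eta>} \<Longrightarrow>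
      \<Psi> z s \<in> K \<and> (\<Psi> z has_vector_derivative complete_lift (\<Psi> z s)) (at s)"
    using local_flow[OF K lift_has_derivative lift'_continuous \<open>r > 0\<close> sub] by metis
  have deriv: "(drift_field k has_derivative (\<lambda>q. D damped_spray p q + k *\<^sub>R complete_lift' p q)) (at p)"
    if "p \<in> S \<times> UNIV" for k p
    unfolding drift_field_def[abs_def]
    by (intro has_derivative_add has_derivative_scaleR_right spray_has_derivative lift_has_derivative that)
  have bracket: "complete_lift' p (drift_field k p) = D damped_spray p (complete_lift p) + k *\<^sub>R complete_lift' p (complete_lift p)"
    if "p \<in> S \<times> UNIV" for k p
    using has_derivative_linear[OF lift_has_derivative[OF that]] lift_spray_commute[OF that]
    by (simp add: drift_field_def linear_add linear_cmul)
  have "((\<lambda>t. \<Psi> (z t) (b t)) has_vector_derivative drift_field (k + b') (\<Psi> (z t) (b t))) (at t)"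
    if "open J" "t \<in> J" "\<forall>t\<in>J. z t \<in> ball x0 r \<times> ball 0 R \<and> (z has_vector_derivative drift_field k (z t)) (at t)"
      "(b has_real_derivative b') (at t)" "b t \<in> {-\<eta><..<\<eta>}" for J z k b b' t
  proof -
    have "((\<lambda>t. \<Psi> (z t) (b t)) has_vector_derivative
        drift_field k (\<Psi> (z t) (b t)) + b' *\<^sub>R complete_lift (\<Psi> (z t) (b t))) (at t)"
    proof (rule flow_of_integral_curve[OF K lift_has_derivative lift'_continuous deriv bracket that(1,2) _ _ that(4,5),
          where \<Phi> = "\<lambda>t. \<Psi> (z t)"])
      show "((\<lambda>t. \<Psi> (z t) 0) has_vector_derivative drift_field k (\<Psi> (z t) 0)) (at t)" if "t \<in> J" for t
      proof -
        have z: "z t \<in> ball x0 r \<times> ball 0 R" "(z has_vector_derivative drift_field k (z t)) (at t)"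
          using \<open>\<forall>t\<in>J. _\<close> that by blast+
        have "((\<lambda>t. \<Psi> (z t) 0) has_vector_derivative drift_field k (z t)) (at t)"
          by (rule has_vector_derivative_transform_within_open[OF z(2) \<open>open J\<close> that])
            (use \<open>\<forall>t\<in>J. _\<close> \<Psi>(1) in metis)
        then show ?thesis using \<Psi>(1)[OF z(1)] by simp
      qed
    qed (use that(3) \<Psi>(2) in auto)
    then show ?thesis by (simp add: drift_field_def algebra_simps)
  qed
  note flow = this
  have "fst p \<in> S" if "p \<in> K" for p using K(3) that by (auto simp: mem_Times_iff)
  then have \<Psi>S: "fst (\<Psi> z s) \<in> S" if "z \<in> ball x0 r \<times> ball 0 R" "s \<in> {-\<eta><..<\<eta>}" for z s
    using \<Psi>(2)[OF that] by blast
  show ?thesis unfolding lift_flow_def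
  proof (intro exI[of _ \<eta>] exI[of _ \<Psi>] conjI ballI allI impI)
    fix z :: "(real ^ 'n) \<times> (real ^ 'n)" and s assume zs: "z \<in> ball x0 r \<times> ball 0 R" "s \<in> {-\<eta><..<\<eta>}"
    show "fst (\<Psi> z s) \<in> S" using \<Psi>S[OF zs] .
    show "(\<Psi> z has_vector_derivative complete_lift (\<Psi> z s)) (at s)" using \<Psi>(2)[OF zs] by blast
  qed (rule \<eta>, erule \<Psi>(1), (rule flow; assumption))
qed

end

context homothetic_manifold begin

text \<open>
  Integral curves of $W$ on the manifold. Continuity is part of the notion since the differential
  equation is tested only in charts.
\<close>

definition W_integral :: "(real \<Rightarrow> 'm) \<Rightarrow> real set \<Rightarrow> bool" where
  "W_integral f T \<longleftrightarrow> continuous_on T f \<and> (\<forall>t\<in>T. f t \<in> carrier A \<and>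
     (\<forall>c\<in>A. f t \<in> cdom c \<longrightarrow> ((\<lambda>s. cmap c (f s)) has_vector_derivative W (f t) c) (at t)))"

lemma W_integral_subset: "W_integral f T \<Longrightarrow> T' \<subseteq> T \<Longrightarrow> W_integral f T'"
  unfolding W_integral_def using continuous_on_subset by blast

lemma W_integral_shift:
  assumes "W_integral f {a<..<b}" shows "W_integral (\<lambda>s. f (s - k)) {a + k<..<b + k}"
  unfolding W_integral_def
proof (intro conjI ballI impI)
  show "continuous_on {a + k<..<b + k} (\<lambda>s. f (s - k))"
    by (rule continuous_on_compose2[of "{a<..<b}" f])
      (use assms in \<open>auto simp: W_integral_def intro!: continuous_intros\<close>)
  fix t assume t: "t \<in> {a + k<..<b + k}"
  then have t': "t - k \<in> {a<..<b}" by auto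
  then show "f (t - k) \<in> carrier A" using assms unfolding W_integral_def by blast
  fix c assume "c \<in> A" "f (t - k) \<in> cdom c"
  then have "((\<lambda>s. cmap c (f s)) has_vector_derivative W (f (t - k)) c) (at (t - k))"
    using assms t' unfolding W_integral_def by blast
  then have "((\<lambda>s. cmap c (f s)) \<circ> (\<lambda>s. s - k) has_vector_derivative 1 *\<^sub>R W (f (t - k)) c) (at t)"
    by (intro vector_diff_chain_at) (auto intro!: derivative_eq_intros)
  then show "((\<lambda>s. cmap c (f (s - k))) has_vector_derivative W (f (t - k)) c) (at t)"
    by (simp add: o_def)
qed

lemma is_flow_W_integral:
  "is_flow A W T U N \<phi> \<Longrightarrow> N \<subseteq> carrier A \<Longrightarrow> x \<in> U \<Longrightarrow> W_integral (\<lambda>t. \<phi> t x) T"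
  unfolding is_flow_def W_integral_def by blast

lemma W_integral_of_chart:
  assumes c: "c \<in> A" and "open T"
    and q: "\<And>s. s \<in> T \<Longrightarrow> q s \<in> cimg c \<and> (q has_vector_derivative wc c (q s)) (at s)"
  shows "W_integral (\<lambda>s. cinv c (q s)) T"
  unfolding W_integral_def
proof (intro conjI ballI impI)
  have "continuous_on T q"
    using q has_vector_derivative_continuous continuous_at_imp_continuous_on by blast
  then show "continuous_on T (\<lambda>s. cinv c (q s))"
    by (rule continuous_on_compose2[OF chart(4)[OF c]]) (use q in auto)
  fix t assume t: "t \<in> T"
  have p: "cinv c (q t) \<in> cdom c" "cmap c (cinv c (q t)) = q t" using chart(7,8)[OF c] q[OF t] by auto
  then show "cinv c (q t) \<in> carrier A" using in_carrier c by blast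
  fix d assume d: "d \<in> A" "cinv c (q t) \<in> cdom d"
  have "(transition c d has_derivative D (transition c d) (q t)) (at (q t) within range q)"
    using transition_has_derivative[OF c d(1) p(1) d(2)] p(2) has_derivative_at_withinI by metis
  from vector_derivative_diff_chain_within[OF conjunct2[OF q[OF t]] this]
  have "((\<lambda>s. cmap d (cinv c (q s))) has_vector_derivative D (transition c d) (q t) (wc c (q t))) (at t)"
    by (simp add: o_def transition_def)
  then show "((\<lambda>s. cmap d (cinv c (q s))) has_vector_derivative W (cinv c (q t)) d) (at t)"
    using wc_transition[OF c d(1) p(1) d(2)] p(2) by simp
qed

lemma wc_C1:
  assumes "c \<in> A"
  shows "x \<in> cimg c \<Longrightarrow> (wc c has_derivative D (wc c) x) (at x)" "continuous_on (cimg c) (\<lambda>x. D (wc c) x v)"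
proof -
  interpret local_homothety "cimg c" "metric_comp A h c" "wc c" \<sigma> by (rule chart_local_homothety[OF assms])
  show "x \<in> cimg c \<Longrightarrow> (wc c has_derivative D (wc c) x) (at x)" "continuous_on (cimg c) (\<lambda>x. D (wc c) x v)"
    by (intro smooth_on_has_derivative smooth_on_continuous_on smooth_on_D smooth_w; assumption?)+
qed

text \<open>
  Two integral curves agree on a set that is closed because the manifold is Hausdorff, and open
  by the Lipschitz dependence on initial values in a chart.
\<close>

lemma W_integral_unique:
  assumes T: "open T" "connected T" and f: "W_integral f T" and g: "W_integral g T"
    and a: "a \<in> T" "f a = g a" and b: "b \<in> T"
  shows "f b = g b"
proof (rule connected_induction_simple[OF T(2) a(1) b, where P = "\<lambda>s. f s = g s", OF a(2)])
  have cont: "continuous_on T f" "continuous_on T g" using f g by (auto simp: W_integral_def)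
  fix s assume s: "s \<in> T"
  show "\<exists>N. openin (top_of_set T) N \<and> s \<in> N \<and> (\<forall>x\<in>N. \<forall>y\<in>N. f x = g x \<longrightarrow> f y = g y)"
  proof (cases "f s = g s")
    case False
    then obtain U V where UV: "open U" "open V" "f s \<in> U" "g s \<in> V" "U \<inter> V = {}" by (metis hausdorff)
    define N where "N = (T \<inter> f -` U) \<inter> (T \<inter> g -` V)"
    have "open N" unfolding N_def
      by (intro open_Int continuous_open_preimage cont T(1) UV)
    then have "openin (top_of_set T) N" by (intro open_subset) (auto simp: N_def)
    moreover have "f x \<noteq> g x" if "x \<in> N" for x using that UV(5) by (auto simp: N_def)
    moreover have "s \<in> N" using UV s by (auto simp: N_def)
    ultimately show ?thesis by (intro exI[of _ N] conjI ballI impI) simp_all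
  next
    case True
    obtain c where c: "c \<in> A" "f s \<in> cdom c"
      using f s unfolding W_integral_def carrier_def by blast
    obtain r where r: "r > 0" "cball (cmap c (f s)) r \<subseteq> cimg c"
      using chart(2,6)[OF c(1)] c(2) open_contains_cball by blast
    let ?K = "cball (cmap c (f s)) r"
    obtain L where L: "L \<ge> 0" "\<And>x y. x \<in> ?K \<Longrightarrow> y \<in> ?K \<Longrightarrow> norm (wc c x - wc c y) \<le> L * norm (x - y)"
      using C1_on_compact_convex(1)[OF compact_cball convex_cball r(2) wc_C1[OF c(1)]] by blast
    let ?V = "cdom c \<inter> cmap c -` ball (cmap c (f s)) r"
    have V: "open ?V" by (intro continuous_open_preimage chart c) auto
    define N0 where "N0 = (T \<inter> f -` ?V) \<inter> (T \<inter> g -` ?V)"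
    have "open N0" unfolding N0_def by (intro open_Int continuous_open_preimage cont T(1) V)
    moreover have "s \<in> N0" using s c r True by (auto simp: N0_def)
    ultimately obtain e where e: "e > 0" "ball s e \<subseteq> N0" using open_contains_ball by blast
    have sol: "cmap c (u x) \<in> ?K \<and> ((\<lambda>s. cmap c (u s)) has_vector_derivative wc c (cmap c (u x))) (at x)"
      if "x \<in> ball s e" "u = f \<or> u = g" for x u
    proof -
      have x: "x \<in> N0" using e that by blast
      then have u: "u x \<in> cdom c" "cmap c (u x) \<in> ?K" "x \<in> T" using that(2) unfolding N0_def by auto
      have "((\<lambda>s. cmap c (u s)) has_vector_derivative W (u x) c) (at x)"
        using f g that(2) u c unfolding W_integral_def by blast
      then show ?thesis using u chart(5)[OF c(1) u(1)] by (simp add: field_comp_def)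
    qed
    have step: "f y = g y" if xy: "x \<in> ball s e" "y \<in> ball s e" "f x = g x" for x y
    proof -
      have seg: "closed_segment x y \<subseteq> ball s e" using xy by (simp add: closed_segment_subset)
      have "(norm (cmap c (f y) - cmap c (g y)))\<^sup>2
          \<le> (norm (cmap c (f x) - cmap c (g x)))\<^sup>2 * exp ((2 * L + 1) * \<bar>y - x\<bar>)"
        by (rule ode_lipschitz_dependence[OF L(2) L(1)]) (use seg sol in blast)+
      then have "cmap c (f y) = cmap c (g y)" using xy(3) by simp
      moreover have "f y \<in> cdom c" "g y \<in> cdom c" using xy(2) e(2) unfolding N0_def by auto
      ultimately show ?thesis using chart(5)[OF c(1)] by metis
    qed
    have nbh: "openin (top_of_set T) (ball s e)"
      using e(2) by (intro open_subset) (auto simp: N0_def)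
    have "s \<in> ball s e" using e(1) by simp
    with nbh show ?thesis
    proof (intro exI[of _ "ball s e"] conjI ballI impI)
      fix x y assume "x \<in> ball s e" "y \<in> ball s e" "f x = g x"
      then show "f y = g y" by (rule step)
    qed
  qed
qed

text \<open>
  Near $t_0$ the curve $r$ is the base curve of an integral curve $(r, y)$ of \<open>drift_field k\<close> in the
  chart $c$, and $h(y, y) = E$. The vector $y$ is the velocity of $r$ minus $k W$.
\<close>

definition drift_germ :: "('m, 'n) chart \<Rightarrow> real \<Rightarrow> (real \<Rightarrow> real) \<Rightarrow> (real \<Rightarrow> 'm) \<Rightarrow> real \<Rightarrow> bool" where
  "drift_germ c k E r t0 \<longleftrightarrow> (\<exists>J y. open J \<and> t0 \<in> J \<and> (\<forall>t\<in>J. r t \<in> cdom c \<and>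
     ((\<lambda>s. (cmap c (r s), y s)) has_vector_derivative
        local_homothety.drift_field (metric_comp A h c) (wc c) \<sigma> k (cmap c (r t), y t)) (at t) \<and>
     Hc c (cmap c (r t)) (y t) (y t) = E t))"

lemma germ_near: assumes "drift_germ c k E r t0"
  obtains J where "open J" "t0 \<in> J" "\<And>t. t \<in> J \<Longrightarrow> drift_germ c k E r t"
proof -
  obtain J y where J: "open J" "t0 \<in> J" "\<forall>t\<in>J. r t \<in> cdom c \<and>
     ((\<lambda>s. (cmap c (r s), y s)) has_vector_derivative
        local_homothety.drift_field (metric_comp A h c) (wc c) \<sigma> k (cmap c (r t), y t)) (at t) \<and>
     Hc c (cmap c (r t)) (y t) (y t) = E t"
    using assms unfolding drift_germ_def by blast
  have "drift_germ c k E r t" if "t \<in> J" for t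
    unfolding drift_germ_def by (intro exI[of _ J] exI[of _ y] conjI J that)
  then show ?thesis using that J by blast
qed

lemma germ_cdom: "drift_germ c k E r t \<Longrightarrow> r t \<in> cdom c"
  unfolding drift_germ_def by blast

lemma germ_cong:
  assumes "drift_germ c k E r t0" "open J'" "t0 \<in> J'" and eq: "\<And>t. t \<in> J' \<Longrightarrow> r t = r' t \<and> E t = E' t"
  shows "drift_germ c k E' r' t0"
proof -
  obtain J y where J: "open J" "t0 \<in> J" "\<And>t. t \<in> J \<Longrightarrow> r t \<in> cdom c \<and>
     ((\<lambda>s. (cmap c (r s), y s)) has_vector_derivative
        local_homothety.drift_field (metric_comp A h c) (wc c) \<sigma> k (cmap c (r t), y t)) (at t) \<and>
     Hc c (cmap c (r t)) (y t) (y t) = E t"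
    using assms(1) unfolding drift_germ_def by blast
  have rr: "r' t = r t" "E' t = E t" if "t \<in> J'" for t using eq[OF that] by auto
  have "((\<lambda>s. (cmap c (r' s), y s)) has_vector_derivative
        local_homothety.drift_field (metric_comp A h c) (wc c) \<sigma> k (cmap c (r t), y t)) (at t)"
    if "t \<in> J \<inter> J'" for t
  proof (rule has_vector_derivative_transform_within_open[of "\<lambda>s. (cmap c (r s), y s)" _ _ "J \<inter> J'"])
    show "((\<lambda>s. (cmap c (r s), y s)) has_vector_derivative
        local_homothety.drift_field (metric_comp A h c) (wc c) \<sigma> k (cmap c (r t), y t)) (at t)"
      using J(3) that by blast
  qed (use J(1) assms(2) that rr in auto)
  then have "\<forall>t\<in>J \<inter> J'. r' t \<in> cdom c \<and>
     ((\<lambda>s. (cmap c (r' s), y s)) has_vector_derivative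
        local_homothety.drift_field (metric_comp A h c) (wc c) \<sigma> k (cmap c (r' t), y t)) (at t) \<and>
     Hc c (cmap c (r' t)) (y t) (y t) = E' t"
    using J(3) rr by simp
  then show ?thesis unfolding drift_germ_def using J(1,2) assms(2,3) by blast
qed

lemma germ_isCont:
  assumes c: "c \<in> A" and "drift_germ c k E r t0" shows "isCont r t0"
proof -
  obtain J y where J: "open J" "t0 \<in> J" "\<And>t. t \<in> J \<Longrightarrow> r t \<in> cdom c"
    and d: "((\<lambda>s. (cmap c (r s), y s)) has_vector_derivative
        local_homothety.drift_field (metric_comp A h c) (wc c) \<sigma> k (cmap c (r t0), y t0)) (at t0)"
    using assms(2) unfolding drift_germ_def by blast
  have "isCont (\<lambda>s. (cmap c (r s), y s)) t0" using d has_vector_derivative_continuous by blast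
  then have "isCont (\<lambda>s. cmap c (r s)) t0" using isCont_fst by force
  moreover have "isCont (cinv c) (cmap c (r t0))"
    using chart(2,4,6)[OF c] J by (simp add: continuous_on_eq_continuous_at)
  ultimately have "isCont (\<lambda>s. cinv c (cmap c (r s))) t0" by (rule isCont_o2)
  then have "((\<lambda>s. cinv c (cmap c (r s))) \<longlongrightarrow> r t0) (at t0)"
    using chart(5)[OF c J(3)[OF J(2)]] by (simp add: isCont_def)
  then show ?thesis unfolding isCont_def
    by (rule Lim_transform_within_open[OF _ J(1,2)]) (simp add: chart(5)[OF c J(3)])
qed

text \<open>
  The second derivative of the transition map produced by differentiating $D\tau\,y$ along the curve
  is cancelled by the one in the transformation law of the Christoffel symbols.
\<close>

lemma geodesic_germ_chart_change:
  assumes c: "c \<in> A" and d: "d \<in> A" and g: "drift_germ c 0 E r t0" and rd: "r t0 \<in> cdom d"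
  shows "drift_germ d 0 E r t0"
proof -
  interpret c: local_homothety "cimg c" "metric_comp A h c" "wc c" \<sigma> by (rule chart_local_homothety[OF c])
  interpret d: local_homothety "cimg d" "metric_comp A h d" "wc d" \<sigma> by (rule chart_local_homothety[OF d])
  obtain J y where J: "open J" "t0 \<in> J" and Jr: "\<And>t. t \<in> J \<Longrightarrow> r t \<in> cdom c"
    and Jd: "\<And>t. t \<in> J \<Longrightarrow> ((\<lambda>s. (cmap c (r s), y s)) has_vector_derivative c.drift_field 0 (cmap c (r t), y t)) (at t)"
    and JE: "\<And>t. t \<in> J \<Longrightarrow> c.H (cmap c (r t)) (y t) (y t) = E t"
    using g unfolding drift_germ_def by blast
  have d1: "((\<lambda>s. cmap c (r s)) has_vector_derivative y t) (at t)"
    "(y has_vector_derivative - c.Gam (cmap c (r t)) (y t) (y t) - (\<sigma> / 2) *\<^sub>R y t) (at t)" if "t \<in> J" for t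
    using has_vector_derivative_fst_snd[OF Jd[OF that, unfolded c.drift_field_def c.damped_spray_def scaleR_zero_left add_0_right fst_conv snd_conv]]
    by simp_all
  let ?\<tau> = "transition c d"
  define J' where "J' = J \<inter> (\<lambda>s. cmap c (r s)) -` overlap c d"
  have "continuous_on J (\<lambda>s. cmap c (r s))"
    using d1(1) has_vector_derivative_continuous continuous_at_imp_continuous_on by blast
  then have "open J'" unfolding J'_def
    by (intro continuous_open_preimage open_overlap c d J)
  have J'd: "r t \<in> cdom d" "t \<in> J" if "t \<in> J'" for t
    using that Jr chart(5)[OF c] by (auto simp: J'_def) (metis IntD2 chart(5) c IntD1)
  have "t0 \<in> J'" using J Jr[OF J(2)] rd by (auto simp: J'_def)
  define y' where "y' s = D ?\<tau> (cmap c (r s)) (y s)" for s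
  have "((\<lambda>s. (cmap d (r s), y' s)) has_vector_derivative d.drift_field 0 (cmap d (r t), y' t)) (at t)"
    if t: "t \<in> J'" for t
  proof -
    note tJ = J'd[OF t] and rc = Jr[OF J'd(2)[OF t]]
    let ?q = "cmap c (r t)"
    have q: "((\<lambda>s. cmap c (r s)) has_derivative (\<lambda>k. k *\<^sub>R y t)) (at t)"
      "(y has_derivative (\<lambda>k. k *\<^sub>R (- c.Gam ?q (y t) (y t) - (\<sigma> / 2) *\<^sub>R y t))) (at t)"
      using d1[OF tJ(2)] unfolding has_vector_derivative_def by auto
    have \<tau>: "(?\<tau> has_derivative D ?\<tau> ?q) (at ?q)" by (rule transition_has_derivative[OF c d rc tJ(1)])
    have lin: "linear (D ?\<tau> ?q)" using \<tau> has_derivative_linear by blast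
    have "((\<lambda>s. ?\<tau> (cmap c (r s))) has_derivative (\<lambda>k. k *\<^sub>R y' t)) (at t)"
      using has_derivative_compose[OF q(1) \<tau>] by (simp add: linear_cmul[OF lin] y'_def)
    then have 1: "((\<lambda>s. cmap d (r s)) has_derivative (\<lambda>k. k *\<^sub>R y' t)) (at t)"
      by (rule has_derivative_transform_within_open[OF _ J(1) tJ(2)]) (simp add: transition_cmap[OF c Jr])
    have ov: "?q \<in> overlap c d" using rc tJ by auto
    have lin2: "linear (D (\<lambda>z. D ?\<tau> z (y t)) ?q)"
      by (rule smooth_on_linear_D[OF smooth_on_D[OF smooth_transition[OF c d]] ov])
    have "D (\<lambda>z. D ?\<tau> z (y t)) ?q (y t) + D ?\<tau> ?q (- c.Gam ?q (y t) (y t) - (\<sigma> / 2) *\<^sub>R y t)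
        = - d.Gam (cmap d (r t)) (y' t) (y' t) - (\<sigma> / 2) *\<^sub>R y' t"
      using Gc_transition[OF c d rc tJ(1), of "y t"] by (simp add: linear_diff[OF lin] linear_neg[OF lin] linear_cmul[OF lin] y'_def)
    then have 2: "(y' has_derivative (\<lambda>k. k *\<^sub>R (- d.Gam (cmap d (r t)) (y' t) (y' t) - (\<sigma> / 2) *\<^sub>R y' t))) (at t)"
      unfolding y'_def[abs_def]
      by (intro has_derivative_eq_rhs[OF D_has_derivative[OF open_overlap[OF c d] smooth_transition[OF c d] ov q]])
        (simp add: fun_eq_iff linear_cmul[OF lin] linear_cmul[OF lin2] scaleR_add_right[symmetric])
    show ?thesis
      using has_derivative_Pair[OF 1 2] by (simp add: has_vector_derivative_def d.drift_field_def d.damped_spray_def)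
  qed
  moreover have "d.H (cmap d (r t)) (y' t) (y' t) = E t" if "t \<in> J'" for t
    using Hc_transition[OF c d Jr[OF J'd(2)[OF that]] J'd(1)[OF that]] JE[OF J'd(2)[OF that]] by (simp add: y'_def)
  ultimately show ?thesis unfolding drift_germ_def using \<open>open J'\<close> \<open>t0 \<in> J'\<close> J'd(1) by blast
qed

text \<open>
  The local step. The radius $r$ and the time $\eta$ depend only on the bound for the
  energy and not on the curve $f$; this uniformity is what lets the steps cover
  a whole time interval. The curves $g_t$ are the trajectories of $W$ through the points $f(t)$.
\<close>

lemma germ_transport:
  assumes c: "c \<in> A" and q0: "q0 \<in> cimg c"
  obtains r \<eta> where "r > 0" "\<eta> > 0"
    "\<And>k E f t0 \<beta>0 \<beta>. \<lbrakk>drift_germ c k E f t0; E t0 \<le> Emax; cmap c (f t0) \<in> ball q0 r; \<bar>\<beta>0\<bar> < \<eta>\<rbrakk> \<Longrightarrow>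
      \<exists>J g. open J \<and> t0 \<in> J \<and>
        (\<forall>t\<in>J. \<bar>\<beta>0 + \<beta> * (t - t0)\<bar> < \<eta> \<and> g t 0 = f t \<and> W_integral (g t) {-\<eta><..<\<eta>}) \<and>
        drift_germ c (k + \<beta>) (\<lambda>t. exp (\<sigma> * (\<beta>0 + \<beta> * (t - t0))) * E t) (\<lambda>t. g t (\<beta>0 + \<beta> * (t - t0))) t0"
proof -
  interpret local_homothety "cimg c" "metric_comp A h c" "wc c" \<sigma> by (rule chart_local_homothety[OF c])
  obtain r0 m where r0: "r0 > 0" "m > 0" "cball q0 r0 \<subseteq> cimg c" "\<And>x y. x \<in> cball q0 r0 \<Longrightarrow> m * (norm y)\<^sup>2 \<le> H x y y"
    using H_locally_coercive[OF q0] by blast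
  (* exceeds the coordinate length of every vector over the ball whose energy is at most Emax *)
  define R where "R = sqrt (\<bar>Emax\<bar> / m) + 1"
  define r where "r = r0 / 2"
  have r: "r > 0" "cball q0 (2 * r) \<subseteq> cimg c" using r0 by (auto simp: r_def)
  obtain \<eta> \<Psi> where \<eta>: "\<eta> > 0" and lf: "lift_flow q0 r R \<eta> \<Psi>"
    and flow: "\<forall>J z k b b' t. open J \<longrightarrow> t \<in> J \<longrightarrow>
       (\<forall>t\<in>J. z t \<in> ball q0 r \<times> ball 0 R \<and> (z has_vector_derivative drift_field k (z t)) (at t)) \<longrightarrow>
       (b has_real_derivative b') (at t) \<longrightarrow> b t \<in> {-\<eta><..<\<eta>} \<longrightarrow>
       ((\<lambda>t. \<Psi> (z t) (b t)) has_vector_derivative drift_field (k + b') (\<Psi> (z t) (b t))) (at t)"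
    using lift_flow_exists[OF q0 r, of R] by (elim exE conjE)
  have \<Psi>: "\<Psi> z 0 = z" "s \<in> {-\<eta><..<\<eta>} \<Longrightarrow>
      fst (\<Psi> z s) \<in> cimg c \<and> (\<Psi> z has_vector_derivative complete_lift (\<Psi> z s)) (at s)"
    if "z \<in> ball q0 r \<times> ball 0 R" for z s
    using lf that unfolding lift_flow_def by blast+
  show ?thesis
  proof (rule that[OF r(1) \<eta>])
    fix k E f t0 \<beta>0 \<beta>
    assume g: "drift_germ c k E f t0" and E: "E t0 \<le> Emax" and f0: "cmap c (f t0) \<in> ball q0 r" and \<beta>0: "\<bar>\<beta>0\<bar> < \<eta>"
    obtain J y where J: "open J" "t0 \<in> J" and Jr: "\<And>t. t \<in> J \<Longrightarrow> f t \<in> cdom c"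
      and Jd: "\<And>t. t \<in> J \<Longrightarrow> ((\<lambda>s. (cmap c (f s), y s)) has_vector_derivative drift_field k (cmap c (f t), y t)) (at t)"
      and JE: "\<And>t. t \<in> J \<Longrightarrow> H (cmap c (f t)) (y t) (y t) = E t"
      using g unfolding drift_germ_def by blast
    define z where "z t = (cmap c (f t), y t)" for t
    define b where "b t = \<beta>0 + \<beta> * (t - t0)" for t
    have yR: "norm (y t0) < R"
    proof -
      have "m * (norm (y t0))\<^sup>2 \<le> Emax"
        using r0(4)[of "cmap c (f t0)" "y t0"] f0 JE[OF J(2)] E r0(1) by (simp add: r_def)
      then have "(norm (y t0))\<^sup>2 \<le> \<bar>Emax\<bar> / m" using r0(2) by (simp add: field_simps)
      then have "norm (y t0) \<le> sqrt (\<bar>Emax\<bar> / m)" using real_le_rsqrt by blast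
      then show ?thesis by (simp add: R_def)
    qed
    have zcont: "continuous_on J z"
      unfolding z_def[abs_def] using Jd has_vector_derivative_continuous continuous_at_imp_continuous_on by blast
    define J' where "J' = (J \<inter> z -` (ball q0 r \<times> ball 0 R)) \<inter> (b -` {-\<eta><..<\<eta>})"
    have "open J'" unfolding J'_def
      by (intro open_Int continuous_open_preimage[OF zcont J(1)] open_Times open_vimage)
        (auto simp: b_def[abs_def] intro!: continuous_intros)
    have "t0 \<in> J'" using J f0 yR \<beta>0 by (auto simp: J'_def z_def b_def)
    have J': "t \<in> J" "z t \<in> ball q0 r \<times> ball 0 R" "b t \<in> {-\<eta><..<\<eta>}" if "t \<in> J'" for t
      using that unfolding J'_def by auto
    have bJ': "\<bar>b t\<bar> < \<eta>" if "t \<in> J'" for t using J'(3)[OF that] by auto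
    define g where "g t s = cinv c (fst (\<Psi> (z t) s))" for t s
    have "W_integral (g t) {-\<eta><..<\<eta>}" if t: "t \<in> J'" for t
      unfolding g_def[abs_def]
    proof (rule W_integral_of_chart[OF c])
      fix s assume "s \<in> {-\<eta><..<\<eta>}"
      from \<Psi>(2)[OF J'(2)[OF t] this] show "fst (\<Psi> (z t) s) \<in> cimg c \<and>
        ((\<lambda>s. fst (\<Psi> (z t) s)) has_vector_derivative wc c (fst (\<Psi> (z t) s))) (at s)"
        using has_vector_derivative_fst_snd(1) by (auto simp: complete_lift_def)
    qed simp
    moreover have "g t 0 = f t" if t: "t \<in> J'" for t
      using \<Psi>(1)[OF J'(2)[OF t]] chart(5)[OF c Jr[OF J'(1)[OF t]]] by (simp add: g_def z_def)
    moreover have "drift_germ c (k + \<beta>) (\<lambda>t. exp (\<sigma> * b t) * E t) (\<lambda>t. g t (b t)) t0"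
      unfolding drift_germ_def
    proof (intro exI[of _ J'] exI[of _ "\<lambda>t. snd (\<Psi> (z t) (b t))"] conjI ballI)
      fix t assume t: "t \<in> J'"
      have x: "fst (\<Psi> (z t) (b t)) \<in> cimg c" if "t \<in> J'" for t using \<Psi>(2)[OF J'(2,3)[OF that]] by blast
      show "g t (b t) \<in> cdom c" unfolding g_def using chart(8)[OF c x[OF t]] .
      have cm: "cmap c (g t (b t)) = fst (\<Psi> (z t) (b t))" if "t \<in> J'" for t
        unfolding g_def using chart(7)[OF c x[OF that]] .
      have "((\<lambda>t. \<Psi> (z t) (b t)) has_vector_derivative drift_field (k + \<beta>) (\<Psi> (z t) (b t))) (at t)"
      proof (rule flow[rule_format, OF \<open>open J'\<close> t])
        show "z t \<in> ball q0 r \<times> ball 0 R \<and> (z has_vector_derivative drift_field k (z t)) (at t)"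
          if "t \<in> J'" for t
          using J'(2)[OF that] Jd[OF J'(1)[OF that]] unfolding z_def[abs_def] by blast
        show "(b has_real_derivative \<beta>) (at t)" unfolding b_def[abs_def] by (auto intro!: derivative_eq_intros)
      qed (rule J'(3)[OF t])
      then have "((\<lambda>t. \<Psi> (z t) (b t)) has_vector_derivative drift_field (k + \<beta>) (cmap c (g t (b t)), snd (\<Psi> (z t) (b t)))) (at t)"
        by (simp add: cm[OF t])
      then show "((\<lambda>t. (cmap c (g t (b t)), snd (\<Psi> (z t) (b t)))) has_vector_derivative
          drift_field (k + \<beta>) (cmap c (g t (b t)), snd (\<Psi> (z t) (b t)))) (at t)"
        by (rule has_vector_derivative_transform_within_open[OF _ \<open>open J'\<close> t]) (simp add: cm)
      have seg: "closed_segment 0 (b t) \<subseteq> {-\<eta><..<\<eta>}"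
        using J'(3)[OF t] by (auto simp: closed_segment_eq_real_ivl split: if_splits)
      have "H (fst (\<Psi> (z t) (b t))) (snd (\<Psi> (z t) (b t))) (snd (\<Psi> (z t) (b t)))
         = exp (1 * \<sigma> * (b t - 0)) * H (fst (\<Psi> (z t) 0)) (snd (\<Psi> (z t) 0)) (snd (\<Psi> (z t) 0))"
        by (rule energy_along_lift) (use seg \<Psi>(2)[OF J'(2)[OF t]] in auto)
      then show "H (cmap c (g t (b t))) (snd (\<Psi> (z t) (b t))) (snd (\<Psi> (z t) (b t))) = exp (\<sigma> * b t) * E t"
        using \<Psi>(1)[OF J'(2)[OF t]] JE[OF J'(1)[OF t]] by (simp add: cm[OF t] z_def)
    qed (use \<open>open J'\<close> \<open>t0 \<in> J'\<close> in auto)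
    ultimately show "\<exists>J g. open J \<and> t0 \<in> J \<and>
        (\<forall>t\<in>J. \<bar>\<beta>0 + \<beta> * (t - t0)\<bar> < \<eta> \<and> g t 0 = f t \<and> W_integral (g t) {-\<eta><..<\<eta>}) \<and>
        drift_germ c (k + \<beta>) (\<lambda>t. exp (\<sigma> * (\<beta>0 + \<beta> * (t - t0))) * E t) (\<lambda>t. g t (\<beta>0 + \<beta> * (t - t0))) t0"
      using \<open>open J'\<close> \<open>t0 \<in> J'\<close> bJ' unfolding b_def[abs_def]
      by (intro exI[of _ J'] exI[of _ g]) simp
  qed
qed

end

section \<open>Geodesics as integral curves\<close>

lemma Ck_on_2I:
  fixes f :: "real \<Rightarrow> 'a::real_normed_vector"
  assumes "\<And>t. t \<in> T \<Longrightarrow> \<exists>J y a. open J \<and> t \<in> J \<and>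
    (\<forall>s\<in>J. (f has_vector_derivative y s) (at s) \<and> (y has_vector_derivative a s) (at s)) \<and> isCont a t"
  shows "Ck_on 2 f T"
proof -
  have "f differentiable (at t) \<and> (\<lambda>s. D f s v) differentiable (at t) \<and> isCont (\<lambda>s. D (\<lambda>s. D f s v) s v') t"
    if t: "t \<in> T" for t v v'
  proof -
    obtain J y a where J: "open J" "t \<in> J" and a: "isCont a t"
      and d: "\<And>s. s \<in> J \<Longrightarrow> (f has_vector_derivative y s) (at s)" "\<And>s. s \<in> J \<Longrightarrow> (y has_vector_derivative a s) (at s)"
      using assms[OF t] by blast
    have 1: "D f s = (\<lambda>h. h *\<^sub>R y s)" if "s \<in> J" for s
      using frechet_derivative_at[OF d(1)[OF that, unfolded has_vector_derivative_def]] by simp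
    have 2: "((\<lambda>s. D f s v) has_derivative (\<lambda>h. v *\<^sub>R (h *\<^sub>R a s))) (at s)" if s: "s \<in> J" for s
    proof (rule has_derivative_transform_within_open[OF _ J(1) s])
      show "((\<lambda>s. v *\<^sub>R y s) has_derivative (\<lambda>h. v *\<^sub>R (h *\<^sub>R a s))) (at s)"
        by (intro has_derivative_scaleR_right d(2)[OF s, unfolded has_vector_derivative_def])
    qed (simp add: 1)
    have 3: "D (\<lambda>s. D f s v) s v' = v *\<^sub>R (v' *\<^sub>R a s)" if "s \<in> J" for s
      using frechet_derivative_at[OF 2[OF that]] by metis
    have "((\<lambda>s. v *\<^sub>R (v' *\<^sub>R a s)) \<longlongrightarrow> v *\<^sub>R (v' *\<^sub>R a t)) (at t)"
      using a unfolding isCont_def by (intro tendsto_intros)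
    then have "((\<lambda>s. D (\<lambda>s. D f s v) s v') \<longlongrightarrow> v *\<^sub>R (v' *\<^sub>R a t)) (at t)"
      by (rule Lim_transform_within_open[OF _ J]) (simp add: 3)
    then have "isCont (\<lambda>s. D (\<lambda>s. D f s v) s v') t" by (simp add: isCont_def 3[OF J(2)])
    moreover have "f differentiable (at t)"
      using d(1)[OF J(2)] unfolding has_vector_derivative_def by (rule differentiableI)
    moreover have "(\<lambda>s. D f s v) differentiable (at t)" using 2[OF J(2)] by (rule differentiableI)
    ultimately show ?thesis by blast
  qed
  then show ?thesis
    by (auto simp: numeral_2_eq_2 intro!: continuous_at_imp_continuous_on)
qed

lemma Ck_on_2D:
  fixes f :: "real \<Rightarrow> 'a::real_normed_vector"
  assumes "Ck_on 2 f T" "open T" "t \<in> T"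
  shows "(f has_vector_derivative vector_derivative f (at t)) (at t)"
    "((\<lambda>s. vector_derivative f (at s)) has_vector_derivative
       vector_derivative (\<lambda>s. vector_derivative f (at s)) (at t)) (at t)"
proof -
  have f: "f differentiable (at s)" "(\<lambda>x. D f x 1) differentiable (at s)" if "s \<in> T" for s
    using assms(1) that by (auto simp: numeral_2_eq_2)
  show "(f has_vector_derivative vector_derivative f (at t)) (at t)"
    using f(1)[OF assms(3)] vector_derivative_works by blast
  have "((\<lambda>s. vector_derivative f (at s)) has_derivative D (\<lambda>x. D f x 1) t) (at t)"
  proof (rule has_derivative_transform_within_open[OF _ assms(2,3)])
    show "((\<lambda>x. D f x 1) has_derivative D (\<lambda>x. D f x 1) t) (at t)"
      using f(2)[OF assms(3)] frechet_derivative_works by blast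
    show "D f s 1 = vector_derivative f (at s)" if "s \<in> T" for s
      using frechet_derivative_eq_vector_derivative[OF f(1)[OF that]] by simp
  qed
  then have "(\<lambda>s. vector_derivative f (at s)) differentiable (at t)" by (rule differentiableI)
  then show "((\<lambda>s. vector_derivative f (at s)) has_vector_derivative
       vector_derivative (\<lambda>s. vector_derivative f (at s)) (at t)) (at t)"
    using vector_derivative_works by blast
qed

context homothetic_manifold begin

lemma velocity_eq_tangent_of:
  assumes c: "c \<in> A" and J: "open J" "t \<in> J" "\<And>s. s \<in> J \<Longrightarrow> r s \<in> cdom c"
    and y: "((\<lambda>s. cmap c (r s)) has_vector_derivative y) (at t)"
  shows "velocity A r t = tangent_of A c (r t) y"
proof (rule ext)
  fix d
  have "coord_vel d r t = D (transition c d) (cmap c (r t)) y" if d: "d \<in> A" "r t \<in> cdom d"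
  proof -
    note rc = J(3)[OF J(2)]
    have "linear (D (transition c d) (cmap c (r t)))" by (rule linear_D_transition[OF c d(1) rc d(2)])
    then have "((\<lambda>s. transition c d (cmap c (r s))) has_vector_derivative D (transition c d) (cmap c (r t)) y) (at t)"
      using has_derivative_compose[OF y[unfolded has_vector_derivative_def] transition_has_derivative[OF c d(1) rc d(2)]]
      by (simp add: has_vector_derivative_def linear_cmul)
    then have "((\<lambda>s. cmap d (r s)) has_vector_derivative D (transition c d) (cmap c (r t)) y) (at t)"
      by (rule has_vector_derivative_transform_within_open[OF _ J(1,2)]) (simp add: transition_cmap[OF c J(3)])
    then show ?thesis unfolding coord_vel_def by (rule vector_derivative_at)
  qed
  then show "velocity A r t d = tangent_of A c (r t) y d"
    unfolding velocity_def tangent_of_def by auto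
qed

lemma germD:
  assumes c: "c \<in> A" and "drift_germ c k E r t0"
  shows "\<exists>J y. open J \<and> t0 \<in> J \<and> (\<forall>t\<in>J. r t \<in> cdom c \<and>
    ((\<lambda>s. cmap c (r s)) has_vector_derivative y t + k *\<^sub>R wc c (cmap c (r t))) (at t) \<and>
    (y has_vector_derivative - Gc c (cmap c (r t)) (y t) (y t) - (\<sigma> / 2) *\<^sub>R y t
        + k *\<^sub>R D (wc c) (cmap c (r t)) (y t)) (at t) \<and>
    Hc c (cmap c (r t)) (y t) (y t) = E t)"
proof -
  interpret local_homothety "cimg c" "metric_comp A h c" "wc c" \<sigma> by (rule chart_local_homothety[OF c])
  obtain J y where J: "open J" "t0 \<in> J" and *: "\<forall>t\<in>J. r t \<in> cdom c \<and>
     ((\<lambda>s. (cmap c (r s), y s)) has_vector_derivative drift_field k (cmap c (r t), y t)) (at t) \<and>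
     H (cmap c (r t)) (y t) (y t) = E t"
    using assms(2) unfolding drift_germ_def by blast
  have d: "((\<lambda>s. (cmap c (r s), y s)) has_vector_derivative (y t + k *\<^sub>R wc c (cmap c (r t)),
      - Gam (cmap c (r t)) (y t) (y t) - (\<sigma> / 2) *\<^sub>R y t + k *\<^sub>R D (wc c) (cmap c (r t)) (y t))) (at t)"
    if "t \<in> J" for t
    using bspec[OF * that] by (simp add: drift_field_def damped_spray_def complete_lift_def)
  show ?thesis
    by (intro exI[of _ J] exI[of _ y] conjI ballI J)
      (use * has_vector_derivative_fst_snd[OF d] in \<open>simp_all\<close>)
qed

lemma germI:
  assumes c: "c \<in> A" and "open J" "t0 \<in> J" "\<And>t. t \<in> J \<Longrightarrow> r t \<in> cdom c"
    "\<And>t. t \<in> J \<Longrightarrow> ((\<lambda>s. cmap c (r s)) has_vector_derivative y t + k *\<^sub>R wc c (cmap c (r t))) (at t)"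
    "\<And>t. t \<in> J \<Longrightarrow> (y has_vector_derivative - Gc c (cmap c (r t)) (y t) (y t) - (\<sigma> / 2) *\<^sub>R y t
        + k *\<^sub>R D (wc c) (cmap c (r t)) (y t)) (at t)"
    "\<And>t. t \<in> J \<Longrightarrow> Hc c (cmap c (r t)) (y t) (y t) = E t"
  shows "drift_germ c k E r t0"
proof -
  interpret local_homothety "cimg c" "metric_comp A h c" "wc c" \<sigma> by (rule chart_local_homothety[OF c])
  have "((\<lambda>s. (cmap c (r s), y s)) has_vector_derivative drift_field k (cmap c (r t), y t)) (at t)"
    if "t \<in> J" for t
    using has_derivative_Pair[OF assms(5)[OF that, unfolded has_vector_derivative_def]
        assms(6)[OF that, unfolded has_vector_derivative_def]]
    by (simp add: has_vector_derivative_def drift_field_def damped_spray_def complete_lift_def)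
  then show ?thesis unfolding drift_germ_def using assms by blast
qed

text \<open>
  The first component of an integral curve has velocity $y + k W$, whose derivative is a differentiable
  expression in the curve, hence continuous.
\<close>

lemma germ_acceleration:
  assumes c: "c \<in> A" and "drift_germ c k E r t0"
  shows "\<exists>J y a. open J \<and> t0 \<in> J \<and> (\<forall>s\<in>J. ((\<lambda>s. cmap c (r s)) has_vector_derivative y s) (at s) \<and>
    (y has_vector_derivative a s) (at s)) \<and> isCont a t0"
proof -
  interpret local_homothety "cimg c" "metric_comp A h c" "wc c" \<sigma> by (rule chart_local_homothety[OF c])
  obtain J y where J0: "open J" "t0 \<in> J" and *: "\<forall>t\<in>J. r t \<in> cdom c \<and>
    ((\<lambda>s. cmap c (r s)) has_vector_derivative y t + k *\<^sub>R wc c (cmap c (r t))) (at t) \<and>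
    (y has_vector_derivative - Gam (cmap c (r t)) (y t) (y t) - (\<sigma> / 2) *\<^sub>R y t
        + k *\<^sub>R D (wc c) (cmap c (r t)) (y t)) (at t) \<and>
    H (cmap c (r t)) (y t) (y t) = E t"
    using germD[OF assms] by (elim exE conjE)
  have J: "open J" "t0 \<in> J" "t \<in> J \<Longrightarrow> r t \<in> cdom c" for t using J0 * by auto
  have qd: "((\<lambda>s. cmap c (r s)) has_vector_derivative y t + k *\<^sub>R wc c (cmap c (r t))) (at t)"
    and y: "(y has_vector_derivative - Gam (cmap c (r t)) (y t) (y t) - (\<sigma> / 2) *\<^sub>R y t
        + k *\<^sub>R D (wc c) (cmap c (r t)) (y t)) (at t)" if "t \<in> J" for t
    using bspec[OF * that] by blast+
  define q where "q s = cmap c (r s)" for s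
  define q' where "q' s = y s + k *\<^sub>R wc c (q s)" for s
  define a where "a s = - Gam (q s) (y s) (y s) - (\<sigma> / 2) *\<^sub>R y s + k *\<^sub>R D (wc c) (q s) (y s)
      + k *\<^sub>R D (wc c) (q s) (q' s)" for s
  have qS: "q s \<in> cimg c" if "s \<in> J" for s using chart(6)[OF c J(3)[OF that]] by (simp add: q_def)
  have dq: "(q has_vector_derivative q' s) (at s)" if "s \<in> J" for s
    using qd[OF that] by (simp add: q_def[abs_def] q'_def)
  have dw: "((\<lambda>s. wc c (q s)) has_vector_derivative D (wc c) (q s) (q' s)) (at s)" if "s \<in> J" for s
    using vector_derivative_diff_chain_within[OF dq[OF that]
        has_derivative_at_withinI[OF smooth_on_has_derivative[OF smooth_w qS[OF that]]]] by (simp add: o_def)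
  have dq': "(q' has_vector_derivative a s) (at s)" if "s \<in> J" for s
    unfolding q'_def[abs_def]
    by (rule has_vector_derivative_eq_rhs[OF has_vector_derivative_add[OF y[OF that]
            bounded_linear.has_vector_derivative[OF bounded_linear_scaleR_right dw[OF that]]]])
      (simp add: a_def q_def q'_def)
  have dif: "q differentiable (at t0)" "y differentiable (at t0)" "q' differentiable (at t0)"
    using dq[OF J(2)] y[OF J(2)] dq'[OF J(2)] unfolding has_vector_derivative_def by (blast intro: differentiableI)+
  have Ddif: "(\<lambda>s. D (wc c) (q s) (u s)) differentiable (at t0)" if "u differentiable (at t0)" for u
    using D_has_derivative[OF open_S smooth_w qS[OF J(2)] dif(1)[unfolded frechet_derivative_works]
        that[unfolded frechet_derivative_works]] by (rule differentiableI)
  have sc: "(\<lambda>s. k *\<^sub>R u s) differentiable (at t0)" if "u differentiable (at t0)" for u :: "real \<Rightarrow> real ^ 'n" and k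
    using that unfolding differentiable_def by (blast intro: has_derivative_scaleR_right)
  have "a differentiable (at t0)"
    unfolding a_def[abs_def]
    by (intro differentiable_add differentiable_diff differentiable_minus sc Ddif dif Gam_differentiable qS J(2))
  then have "isCont a t0" by (rule differentiable_imp_continuous_within)
  then show ?thesis
    using J dq dq' unfolding q_def[abs_def] by blast
qed

lemma C2_curve_of_germs:
  assumes I: "open I" and drift_germ: "\<And>t c. t \<in> I \<Longrightarrow> c \<in> A \<Longrightarrow> r t \<in> cdom c \<Longrightarrow> \<exists>k E. drift_germ c k E r t"
    and carrier: "r ` I \<subseteq> carrier A"
  shows "C2_curve A I r"
  unfolding C2_curve_def
proof (intro conjI ballI)
  show "r ` I \<subseteq> carrier A" by (rule carrier)
  show "continuous_on I r"
  proof (intro continuous_at_imp_continuous_on ballI)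
    fix t assume t: "t \<in> I"
    then obtain c where c: "c \<in> A" "r t \<in> cdom c" using carrier by (auto simp: carrier_def)
    then obtain k E where "drift_germ c k E r t" using drift_germ t by blast
    then show "isCont r t" by (rule germ_isCont[OF c(1)])
  qed
  fix c assume c: "c \<in> A"
  show "Ck_on 2 (\<lambda>t. cmap c (r t)) {t \<in> I. r t \<in> cdom c}"
  proof (rule Ck_on_2I)
    fix t assume "t \<in> {t \<in> I. r t \<in> cdom c}"
    then obtain k E where "drift_germ c k E r t" using drift_germ c by blast
    then show "\<exists>J y a. open J \<and> t \<in> J \<and> (\<forall>s\<in>J. ((\<lambda>t. cmap c (r t)) has_vector_derivative y s) (at s) \<and>
        (y has_vector_derivative a s) (at s)) \<and> isCont a t"
      by (rule germ_acceleration[OF c])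
  qed
qed

lemma C2_curve_chart:
  assumes "C2_curve A I r" "open I" and c: "c \<in> A"
  shows "open {t \<in> I. r t \<in> cdom c}"
    "t \<in> I \<Longrightarrow> r t \<in> cdom c \<Longrightarrow> ((\<lambda>s. cmap c (r s)) has_vector_derivative coord_vel c r t) (at t)"
    "t \<in> I \<Longrightarrow> r t \<in> cdom c \<Longrightarrow> (coord_vel c r has_vector_derivative coord_acc c r t) (at t)"
proof -
  have "continuous_on I r" using assms(1) by (simp add: C2_curve_def)
  then have "open (I \<inter> r -` cdom c)" by (intro continuous_open_preimage assms(2) chart(1)[OF c])
  also have "I \<inter> r -` cdom c = {t \<in> I. r t \<in> cdom c}" by auto
  finally show J: "open {t \<in> I. r t \<in> cdom c}" .
  have C: "Ck_on 2 (\<lambda>t. cmap c (r t)) {t \<in> I. r t \<in> cdom c}" using assms(1) c by (simp add: C2_curve_def)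
  show "t \<in> I \<Longrightarrow> r t \<in> cdom c \<Longrightarrow> ((\<lambda>s. cmap c (r s)) has_vector_derivative coord_vel c r t) (at t)"
    unfolding coord_vel_def by (rule Ck_on_2D(1)[OF C J]) simp
  show "t \<in> I \<Longrightarrow> r t \<in> cdom c \<Longrightarrow> (coord_vel c r has_vector_derivative coord_acc c r t) (at t)"
    unfolding coord_acc_def coord_vel_def[abs_def] by (rule Ck_on_2D(2)[OF C J]) simp
qed

text \<open>
  The right-hand side of the geodesic equation in an arbitrary parameterization becomes the damping
  term of \<open>damped_spray\<close> for the prescribed speed.
\<close>

lemma deriv_ln_speed:
  assumes "open I" "t \<in> I" and speed: "\<And>s. s \<in> I \<Longrightarrow> hnorm h (r s) (velocity A r s) = sqrt (exp (- \<sigma> * s))"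
  shows "deriv (\<lambda>s. ln (hnorm h (r s) (velocity A r s))) t = - \<sigma> / 2"
proof -
  have d: "((\<lambda>s. - \<sigma> * s / 2) has_real_derivative - \<sigma> / 2) (at t)" by (auto intro!: derivative_eq_intros)
  have ev: "\<forall>\<^sub>F s in nhds t. ln (hnorm h (r s) (velocity A r s)) = - \<sigma> * s / 2"
    using assms by (intro eventually_nhds[THEN iffD2] exI[of _ I]) (auto simp: ln_sqrt)
  show ?thesis
    by (rule DERIV_imp_deriv, rule DERIV_cong_ev[OF refl ev refl, THEN iffD2, OF d])
qed

lemma geodesic_of_germs:
  assumes I: "open I" and drift_germ: "\<And>t. t \<in> I \<Longrightarrow> \<exists>c\<in>A. drift_germ c 0 (\<lambda>t. exp (- \<sigma> * t)) r t"
  shows "geodesic A h I r" "\<And>t. t \<in> I \<Longrightarrow> (hnorm h (r t) (velocity A r t))\<^sup>2 = exp (- \<sigma> * t)"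
proof -
  let ?E = "\<lambda>t. exp (- \<sigma> * t)"
  have all: "drift_germ c 0 ?E r t" if "t \<in> I" "c \<in> A" "r t \<in> cdom c" for t c
    using drift_germ[OF that(1)] geodesic_germ_chart_change that by blast
  have sub: "r ` I \<subseteq> carrier A"
    using drift_germ germ_cdom by (fastforce simp: carrier_def)
  have vel: "velocity A r t \<noteq> (\<lambda>c. 0) \<and> hnorm h (r t) (velocity A r t) = sqrt (?E t)" if t: "t \<in> I" for t
  proof -
    obtain c where c: "c \<in> A" and g: "drift_germ c 0 ?E r t" using drift_germ[OF t] by blast
    interpret local_homothety "cimg c" "metric_comp A h c" "wc c" \<sigma> by (rule chart_local_homothety[OF c])
    obtain J y where J0: "open J" "t \<in> J" and *: "\<forall>t\<in>J. r t \<in> cdom c \<and>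
      ((\<lambda>s. cmap c (r s)) has_vector_derivative y t + 0 *\<^sub>R wc c (cmap c (r t))) (at t) \<and>
      (y has_vector_derivative - Gam (cmap c (r t)) (y t) (y t) - (\<sigma> / 2) *\<^sub>R y t
        + 0 *\<^sub>R D (wc c) (cmap c (r t)) (y t)) (at t) \<and>
      H (cmap c (r t)) (y t) (y t) = ?E t"
      using germD[OF c g] by (elim exE conjE)
    have J: "open J" "t \<in> J" "s \<in> J \<Longrightarrow> r s \<in> cdom c" for s using J0 * by auto
    have q: "((\<lambda>s. cmap c (r s)) has_vector_derivative y s + 0 *\<^sub>R wc c (cmap c (r s))) (at s)"
      and E: "H (cmap c (r s)) (y s) (y s) = ?E s" if "s \<in> J" for s
      using bspec[OF * that] by blast+
    have v: "velocity A r t = tangent_of A c (r t) (y t)"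
      by (rule velocity_eq_tangent_of[OF c J]) (use q[OF J(2)] in simp)+
    have "y t \<noteq> 0"
    proof
      assume "y t = 0"
      then show False using E[OF J(2)] by (simp add: H_linear)
    qed
    then have "velocity A r t c \<noteq> 0" unfolding v tangent_of_self[OF c J(3)[OF J(2)]] .
    then show ?thesis
      using E[OF J(2)] unfolding v hnorm_def h_tangent_of[OF c J(3)[OF J(2)]] by auto
  qed
  show "(hnorm h (r t) (velocity A r t))\<^sup>2 = ?E t" if "t \<in> I" for t using vel[OF that] by simp
  show "geodesic A h I r"
    unfolding geodesic_def
  proof (intro conjI ballI impI allI)
    show "C2_curve A I r" using C2_curve_of_germs[OF I _ sub] all by blast
    fix t assume t: "t \<in> I"
    then show "velocity A r t \<noteq> (\<lambda>c. 0)" using vel by blast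
    fix c i assume c: "c \<in> A" "r t \<in> cdom c"
    obtain J y where J: "open J" "t \<in> J" and *: "\<forall>t\<in>J. r t \<in> cdom c \<and>
      ((\<lambda>s. cmap c (r s)) has_vector_derivative y t + 0 *\<^sub>R wc c (cmap c (r t))) (at t) \<and>
      (y has_vector_derivative - Gc c (cmap c (r t)) (y t) (y t) - (\<sigma> / 2) *\<^sub>R y t
        + 0 *\<^sub>R D (wc c) (cmap c (r t)) (y t)) (at t) \<and>
      Hc c (cmap c (r t)) (y t) (y t) = ?E t"
      using germD[OF c(1) all[OF t c]] by (elim exE conjE)
    have q: "((\<lambda>s. cmap c (r s)) has_vector_derivative y s + 0 *\<^sub>R wc c (cmap c (r s))) (at s)"
      and y: "(y has_vector_derivative - Gc c (cmap c (r s)) (y s) (y s) - (\<sigma> / 2) *\<^sub>R y s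
        + 0 *\<^sub>R D (wc c) (cmap c (r s)) (y s)) (at s)" if "s \<in> J" for s
      using bspec[OF * that] by blast+
    have cv: "coord_vel c r s = y s" if "s \<in> J" for s
      unfolding coord_vel_def using q[OF that] by (intro vector_derivative_at) simp
    have "(coord_vel c r has_vector_derivative - Gc c (cmap c (r t)) (y t) (y t) - (\<sigma> / 2) *\<^sub>R y t) (at t)"
      by (rule has_vector_derivative_transform_within_open[OF _ J, of y]) (use y[OF J(2)] cv in auto)
    then have ca: "coord_acc c r t = - Gc c (cmap c (r t)) (y t) (y t) - (\<sigma> / 2) *\<^sub>R y t"
      unfolding coord_acc_def by (rule vector_derivative_at)
    have "deriv (\<lambda>s. ln (hnorm h (r s) (velocity A r s))) t = - \<sigma> / 2"
      by (rule deriv_ln_speed[OF I t]) (use vel in blast)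
    then show "coord_acc c r t $ i + (\<Sum>j\<in>UNIV. \<Sum>k\<in>UNIV. christoffel A h c i j k (cmap c (r t))
               * coord_vel c r t $ j * coord_vel c r t $ k)
        = deriv (\<lambda>s. ln (hnorm h (r s) (velocity A r s))) t * coord_vel c r t $ i"
      unfolding christoffel_sum_eq[OF c(1)] by (simp add: ca cv[OF J(2)])
  qed
qed

lemma germ_of_geodesic:
  assumes geo: "geodesic A h I r" and I: "open I"
    and speed: "\<And>t. t \<in> I \<Longrightarrow> (hnorm h (r t) (velocity A r t))\<^sup>2 = exp (- \<sigma> * t)"
    and t: "t \<in> I" and c: "c \<in> A" "r t \<in> cdom c"
  shows "drift_germ c 0 (\<lambda>t. exp (- \<sigma> * t)) r t"
proof -
  interpret local_homothety "cimg c" "metric_comp A h c" "wc c" \<sigma> by (rule chart_local_homothety[OF c(1)])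
  have C2: "C2_curve A I r" using geo by (simp add: geodesic_def)
  have vel: "velocity A r s = tangent_of A d (r s) (coord_vel d r s)"
    if "s \<in> I" "d \<in> A" "r s \<in> cdom d" for s d
    by (rule velocity_eq_tangent_of[OF that(2) C2_curve_chart(1)[OF C2 I that(2)]])
      (use that C2_curve_chart(2)[OF C2 I that(2,1,3)] in auto)
  have nn: "hnorm h (r s) (velocity A r s) = sqrt (exp (- \<sigma> * s))" if s: "s \<in> I" for s
  proof -
    obtain d where d: "d \<in> A" "r s \<in> cdom d" using C2 s by (auto simp: C2_curve_def carrier_def)
    have "h (r s) (velocity A r s) (velocity A r s) \<ge> 0"
      unfolding vel[OF s d] h_tangent_of[OF d]
      by (rule local_metric.H_nonneg[OF chart_local_metric[OF d(1)] chart(6)[OF d]])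
    then have "hnorm h (r s) (velocity A r s) \<ge> 0" by (simp add: hnorm_def)
    then show ?thesis using speed[OF s] by (metis real_sqrt_unique)
  qed
  show ?thesis
  proof (rule germI[OF c(1) C2_curve_chart(1)[OF C2 I c(1)], where y = "coord_vel c r"])
    fix s assume "s \<in> {t \<in> I. r t \<in> cdom c}"
    then have s: "s \<in> I" and rs: "r s \<in> cdom c" by auto
    show "r s \<in> cdom c" by (rule rs)
    show "((\<lambda>s. cmap c (r s)) has_vector_derivative coord_vel c r s + 0 *\<^sub>R wc c (cmap c (r s))) (at s)"
      using C2_curve_chart(2)[OF C2 I c(1) s rs] by simp
    have "deriv (\<lambda>s. ln (hnorm h (r s) (velocity A r s))) s = - \<sigma> / 2"
      by (rule deriv_ln_speed[OF I s nn])
    moreover have "coord_acc c r s $ i + (\<Sum>j\<in>UNIV. \<Sum>k\<in>UNIV. christoffel A h c i j k (cmap c (r s))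
               * coord_vel c r s $ j * coord_vel c r s $ k)
        = deriv (\<lambda>s. ln (hnorm h (r s) (velocity A r s))) s * coord_vel c r s $ i" for i
      using geo s c(1) rs unfolding geodesic_def by blast
    ultimately have "coord_acc c r s $ i + Gam (cmap c (r s)) (coord_vel c r s) (coord_vel c r s) $ i
       = - \<sigma> / 2 * coord_vel c r s $ i" for i
      by (simp only: christoffel_sum_eq[OF c(1)])
    then have "coord_acc c r s $ i = (- Gam (cmap c (r s)) (coord_vel c r s) (coord_vel c r s)
        - (\<sigma> / 2) *\<^sub>R coord_vel c r s) $ i" for i
      by (simp add: algebra_simps eq_neg_iff_add_eq_0)
    then have "coord_acc c r s = - Gam (cmap c (r s)) (coord_vel c r s) (coord_vel c r s) - (\<sigma> / 2) *\<^sub>R coord_vel c r s"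
      unfolding vec_eq_iff by blast
    then show "(coord_vel c r has_vector_derivative - Gam (cmap c (r s)) (coord_vel c r s) (coord_vel c r s)
        - (\<sigma> / 2) *\<^sub>R coord_vel c r s + 0 *\<^sub>R D (wc c) (cmap c (r s)) (coord_vel c r s)) (at s)"
      using C2_curve_chart(3)[OF C2 I c(1) s rs] by simp
    show "H (cmap c (r s)) (coord_vel c r s) (coord_vel c r s) = exp (- \<sigma> * s)"
      using speed[OF s] unfolding vel[OF s c(1) rs] hnorm_square[OF c(1) rs] .
  qed (use t c in auto)
qed

text \<open>
  With $v = P' - W$, the condition $F(P') = 1$ means $h(v,v) = 1$, and its derivative is the
  constancy assumption of \<open>unit_spray_iff\<close>.
\<close>

lemma germ_of_randers_geodesic:
  assumes geo: "unit_speed_finsler_geodesic A (navigation_domain A h W) (randers h W) I P" and I: "open I"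
    and t: "t \<in> I" and c: "c \<in> A" "P t \<in> cdom c"
  shows "drift_germ c 1 (\<lambda>_. 1) P t"
proof -
  interpret local_homothety "cimg c" "metric_comp A h c" "wc c" \<sigma> by (rule chart_local_homothety[OF c(1)])
  have C2: "C2_curve A I P" using geo by (simp add: unit_speed_finsler_geodesic_def)
  let ?J = "{t \<in> I. P t \<in> cdom c}"
  have J: "open ?J" by (rule C2_curve_chart(1)[OF C2 I c(1)])
  define q where "q s = cmap c (P s)" for s
  define y where "y s = coord_vel c P s" for s
  define a where "a s = coord_acc c P s" for s
  have q': "(q has_vector_derivative y s) (at s)" and y': "(y has_vector_derivative a s) (at s)" if "s \<in> ?J" for s
    using C2_curve_chart(2,3)[OF C2 I c(1)] that unfolding q_def[abs_def] y_def[abs_def] a_def by auto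
  have mild_wind: "q s \<in> mild_wind" if "s \<in> ?J" for s
    using geo that navigation_domain_iff[OF c(1)] by (auto simp: unit_speed_finsler_geodesic_def q_def)
  have F1: "zermelo_norm (q s) (y s) = 1" if "s \<in> ?J" for s
  proof -
    have v: "velocity A P s = tangent_of A c (P s) (y s)"
      by (rule velocity_eq_tangent_of[OF c(1) J]) (use that q'[OF that] in \<open>auto simp: q_def[abs_def]\<close>)
    show ?thesis
      using geo that randers_tangent_of[OF c(1), of "P s" "y s"]
      unfolding unit_speed_finsler_geodesic_def v[symmetric] q_def by auto
  qed
  have Fl0: "zermelo_norm x 0 = 0" for x by (simp add: zermelo_norm_def H_linear)
  have y0: "y s \<noteq> 0" if "s \<in> ?J" for s using F1[OF that] Fl0[of "q s"] by force
  have HE: "H (q s) (y s - wc c (q s)) (y s - wc c (q s)) = 1" if "s \<in> ?J" for s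
    using zermelo_norm_zermelo[OF mild_wind[OF that], of "y s"] by (simp add: F1[OF that])
  have eq: "a s - D (wc c) (q s) (y s) = D (wc c) (q s) (y s - wc c (q s))
      - Gam (q s) (y s - wc c (q s)) (y s - wc c (q s)) - (\<sigma> / 2) *\<^sub>R (y s - wc c (q s))" if s: "s \<in> ?J" for s
  proof -
    have "((\<lambda>_. 1) has_real_derivative 0) (at s)" by simp
    then have "((\<lambda>s. zermelo_norm (q s) (y s)) has_real_derivative 0) (at s)"
      by (rule has_field_derivative_transform_within_open[OF _ J s]) (simp add: F1[OF s] F1)
    from DERIV_unique[OF this zermelo_norm_DERIV[OF mild_wind[OF s] y0[OF s] q'[OF s] y'[OF s]]]
    have "dH (q s) (y s) (y s - wc c (q s)) (y s - wc c (q s)) / 2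
        + H (q s) (y s - wc c (q s)) (a s - D (wc c) (q s) (y s)) = 0"
      using zermelo_norm_denominator[OF mild_wind[OF s] y0[OF s]] by (simp add: F1[OF s])
    moreover have "\<forall>i. a s $ i + 2 * zermelo_spray i (q s) (y s) = 0"
    proof -
      have "P s \<in> cdom c" using s by simp
      moreover have "coord_acc c P s $ i + 2 * spray_coeff A (randers h W) c i (cmap c (P s)) (coord_vel c P s) = 0" for i
        using geo s c(1) unfolding unit_speed_finsler_geodesic_def by blast
      ultimately show ?thesis
        unfolding a_def y_def q_def by (simp only: spray_coeff_eq[OF c(1) chart(6)[OF c(1)]]) blast
    qed
    ultimately show ?thesis using unit_spray_iff[OF mild_wind[OF s] y0[OF s] F1[OF s]] by blast
  qed
  show ?thesis
  proof (rule germI[OF c(1) J, where y = "\<lambda>s. y s - wc c (q s)"])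
    fix s assume s: "s \<in> ?J"
    then have qS: "q s \<in> cimg c" using mildD(1)[OF mild_wind] by blast
    show "P s \<in> cdom c" using s by simp
    show "((\<lambda>s. cmap c (P s)) has_vector_derivative y s - wc c (q s) + 1 *\<^sub>R wc c (cmap c (P s))) (at s)"
      using q'[OF s] by (simp add: q_def[abs_def])
    have "((\<lambda>s. wc c (q s)) has_vector_derivative D (wc c) (q s) (y s)) (at s)"
      using vector_derivative_diff_chain_within[OF q'[OF s]
        has_derivative_at_withinI[OF smooth_on_has_derivative[OF smooth_w qS]]] by (simp add: o_def)
    from has_vector_derivative_diff[OF y'[OF s] this]
    show "((\<lambda>s. y s - wc c (q s)) has_vector_derivative
        - Gam (cmap c (P s)) (y s - wc c (q s)) (y s - wc c (q s)) - (\<sigma> / 2) *\<^sub>R (y s - wc c (q s))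
        + 1 *\<^sub>R D (wc c) (cmap c (P s)) (y s - wc c (q s))) (at s)"
    proof (rule has_vector_derivative_eq_rhs)
      have "E - C - B = - C - B + 1 *\<^sub>R E" for E C B :: "real ^ 'n"
        by (simp add: vec_eq_iff)
      then show "a s - D (wc c) (q s) (y s) = - Gam (cmap c (P s)) (y s - wc c (q s)) (y s - wc c (q s))
          - (\<sigma> / 2) *\<^sub>R (y s - wc c (q s)) + 1 *\<^sub>R D (wc c) (cmap c (P s)) (y s - wc c (q s))"
        unfolding eq[OF s, unfolded q_def] q_def by blast
    qed
    show "H (cmap c (P s)) (y s - wc c (q s)) (y s - wc c (q s)) = 1"
      using HE[OF s] by (simp add: q_def)
  qed (use t c in auto)
qed

lemma randers_geodesic_of_germs:
  assumes I: "open I" and M: "P ` I \<subseteq> navigation_domain A h W"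
    and drift_germ: "\<And>t c. t \<in> I \<Longrightarrow> c \<in> A \<Longrightarrow> P t \<in> cdom c \<Longrightarrow> drift_germ c 1 (\<lambda>_. 1) P t"
  shows "unit_speed_finsler_geodesic A (navigation_domain A h W) (randers h W) I P"
proof -
  have sub: "P ` I \<subseteq> carrier A" using M by (auto simp: navigation_domain_def)
  have C2: "C2_curve A I P" using C2_curve_of_germs[OF I _ sub] drift_germ by blast
  have main: "randers h W (P t) (velocity A P t) = 1 \<and>
      (\<forall>i. coord_acc c P t $ i + 2 * spray_coeff A (randers h W) c i (cmap c (P t)) (coord_vel c P t) = 0)"
    if t: "t \<in> I" and c: "c \<in> A" "P t \<in> cdom c" for t c
  proof -
    interpret local_homothety "cimg c" "metric_comp A h c" "wc c" \<sigma> by (rule chart_local_homothety[OF c(1)])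
    obtain J v where J0: "open J" "t \<in> J" and *: "\<forall>t\<in>J. P t \<in> cdom c \<and>
      ((\<lambda>s. cmap c (P s)) has_vector_derivative v t + 1 *\<^sub>R wc c (cmap c (P t))) (at t) \<and>
      (v has_vector_derivative - Gam (cmap c (P t)) (v t) (v t) - (\<sigma> / 2) *\<^sub>R v t
        + 1 *\<^sub>R D (wc c) (cmap c (P t)) (v t)) (at t) \<and>
      H (cmap c (P t)) (v t) (v t) = 1"
      using germD[OF c(1) drift_germ[OF t c]] by (elim exE conjE)
    have J: "open J" "t \<in> J" "s \<in> J \<Longrightarrow> P s \<in> cdom c" for s using J0 * by auto
    have q: "((\<lambda>s. cmap c (P s)) has_vector_derivative v s + 1 *\<^sub>R wc c (cmap c (P s))) (at s)"
      and v: "(v has_vector_derivative - Gam (cmap c (P s)) (v s) (v s) - (\<sigma> / 2) *\<^sub>R v s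
        + 1 *\<^sub>R D (wc c) (cmap c (P s)) (v s)) (at s)"
      and E: "H (cmap c (P s)) (v s) (v s) = 1" if "s \<in> J" for s
      using bspec[OF * that] by blast+
    define x where "x = cmap c (P t)"
    define y where "y = v t + wc c x"
    have mild_wind: "x \<in> mild_wind" using navigation_domain_iff[OF c] M t by (auto simp: x_def)
    note xS = mildD(1)[OF mild_wind]
    have vy: "y - wc c x = v t" by (simp add: y_def)
    have Ev: "H x (v t) (v t) = 1" using E[OF J(2)] by (simp add: x_def)
    have "y \<noteq> 0"
    proof
      assume "y = 0"
      then have "v t = - wc c x" by (simp add: y_def eq_neg_iff_add_eq_0)
      then show False using Ev mildD(2)[OF mild_wind] by (simp add: H_linear)
    qed
    have F1: "zermelo_norm x y = 1" by (rule zermelo_norm_unique[OF mild_wind]) (simp_all add: vy Ev)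
    have cv: "coord_vel c P s = v s + wc c (cmap c (P s))" if "s \<in> J" for s
      unfolding coord_vel_def using q[OF that] by (intro vector_derivative_at) simp
    have vel: "velocity A P t = tangent_of A c (P t) y"
      by (rule velocity_eq_tangent_of[OF c(1) J]) (use q[OF J(2)] in \<open>simp_all add: y_def x_def\<close>)
    have "((\<lambda>s. wc c (cmap c (P s))) has_vector_derivative D (wc c) x y) (at t)"
      using vector_derivative_diff_chain_within[OF q[OF J(2)]
        has_derivative_at_withinI[OF smooth_on_has_derivative[OF smooth_w xS[unfolded x_def]]]]
      by (simp add: o_def x_def y_def)
    from has_vector_derivative_add[OF v[OF J(2)] this]
    have "((\<lambda>s. v s + wc c (cmap c (P s))) has_vector_derivative
        - Gam x (v t) (v t) - (\<sigma> / 2) *\<^sub>R v t + D (wc c) x (v t) + D (wc c) x y) (at t)"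
      by (simp add: x_def)
    then have "(coord_vel c P has_vector_derivative
        - Gam x (v t) (v t) - (\<sigma> / 2) *\<^sub>R v t + D (wc c) x (v t) + D (wc c) x y) (at t)"
      by (rule has_vector_derivative_transform_within_open[OF _ J(1,2)]) (simp add: cv)
    then have ca: "coord_acc c P t = - Gam x (v t) (v t) - (\<sigma> / 2) *\<^sub>R v t + D (wc c) x (v t) + D (wc c) x y"
      unfolding coord_acc_def by (rule vector_derivative_at)
    have eq: "coord_acc c P t - D (wc c) x y = D (wc c) x (y - wc c x) - Gam x (y - wc c x) (y - wc c x)
        - (\<sigma> / 2) *\<^sub>R (y - wc c x)"
      by (simp add: ca vy)
    have "dH x y (y - wc c x) (y - wc c x) / 2 + H x (y - wc c x) (coord_acc c P t - D (wc c) x y) = 0"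
      by (rule geodesic_equation_speed[OF xS _ _ eq]) (simp only: vy Ev, simp)
    from unit_spray_iff[OF mild_wind \<open>y \<noteq> 0\<close> F1 this] eq
    have "\<forall>i. coord_acc c P t $ i + 2 * zermelo_spray i x y = 0" by blast
    then show ?thesis
      using randers_tangent_of[OF c, of y] spray_coeff_eq[OF c(1) chart(6)[OF c]] cv[OF J(2)] F1
      by (simp add: vel x_def y_def)
  qed
  show ?thesis
    unfolding unit_speed_finsler_geodesic_def
  proof (intro conjI C2 M ballI allI impI)
    fix t assume t: "t \<in> I"
    then obtain c where "c \<in> A" "P t \<in> cdom c" using sub by (auto simp: carrier_def)
    then show "randers h W (P t) (velocity A P t) = 1" using main[OF t] by blast
  qed (use main in blast)
qed

lemma flow_exists:
  assumes p: "p \<in> navigation_domain A h W"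
  obtains e U \<phi> where "e > 0" "open U" "p \<in> U" "is_flow A W {-e<..<e} U (navigation_domain A h W) \<phi>"
proof -
  obtain c where c: "c \<in> A" "p \<in> cdom c" using p by (auto simp: navigation_domain_def carrier_def)
  interpret local_homothety "cimg c" "metric_comp A h c" "wc c" \<sigma> by (rule chart_local_homothety[OF c(1)])
  have x0: "cmap c p \<in> mild_wind" using navigation_domain_iff[OF c] p by simp
  obtain r0 where r0: "r0 > 0" "cball (cmap c p) r0 \<subseteq> mild_wind" using open_mild x0 open_contains_cball by blast
  define r where "r = r0 / 2"
  have r: "r > 0" using r0 by (simp add: r_def)
  let ?K = "cball (cmap c p) r0" and ?Z = "ball (cmap c p) r"
  have K: "?K \<subseteq> cimg c" using r0 mildD(1) by blast
  have sub: "cball z r \<subseteq> ?K" if "z \<in> ?Z" for z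
  proof
    fix z' assume "z' \<in> cball z r"
    then have "dist (cmap c p) z' \<le> dist (cmap c p) z + dist z z'" "dist z z' \<le> r"
      using dist_triangle by auto
    then show "z' \<in> ?K" using that by (simp add: r_def)
  qed
  have "\<exists>\<eta>>0. \<exists>\<Psi>. \<forall>z\<in>?Z. \<Psi> z 0 = z \<and>
    (\<forall>s\<in>{-\<eta><..<\<eta>}. \<Psi> z s \<in> ?K \<and> (\<Psi> z has_vector_derivative wc c (\<Psi> z s)) (at s))"
    by (rule local_flow[OF compact_cball convex_cball K wc_C1[OF c(1)] r sub])
  then obtain e \<Psi> where e: "e > 0" and \<Psi>: "\<forall>z\<in>?Z. \<Psi> z 0 = z \<and>
    (\<forall>s\<in>{-e<..<e}. \<Psi> z s \<in> ?K \<and> (\<Psi> z has_vector_derivative wc c (\<Psi> z s)) (at s))"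
    by blast
  define U where "U = cdom c \<inter> cmap c -` ?Z"
  define \<phi> where "\<phi> t x = cinv c (\<Psi> (cmap c x) t)" for t x
  have "open U" unfolding U_def by (intro continuous_open_preimage chart c) auto
  moreover have "p \<in> U" using c r by (simp add: U_def)
  moreover have "is_flow A W {-e<..<e} U (navigation_domain A h W) \<phi>"
    unfolding is_flow_def
  proof (intro ballI conjI impI)
    fix x assume "x \<in> U"
    then have x: "x \<in> cdom c" "cmap c x \<in> ?Z" by (auto simp: U_def)
    have sol: "\<Psi> (cmap c x) s \<in> cimg c \<and> (\<Psi> (cmap c x) has_vector_derivative wc c (\<Psi> (cmap c x) s)) (at s)"
      "\<Psi> (cmap c x) s \<in> ?K" if "s \<in> {-e<..<e}" for s
      using \<Psi> x(2) that K by blast+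
    have int: "W_integral (\<lambda>t. \<phi> t x) {-e<..<e}"
      unfolding \<phi>_def by (rule W_integral_of_chart[OF c(1) _ sol(1)]) auto
    show "\<phi> 0 x = x" using \<Psi> x chart(5)[OF c(1) x(1)] by (simp add: \<phi>_def)
    show "continuous_on {-e<..<e} (\<lambda>t. \<phi> t x)" using int by (simp add: W_integral_def)
    fix t assume t: "t \<in> {-e<..<e}"
    have "cinv c (\<Psi> (cmap c x) t) \<in> cdom c" "cmap c (cinv c (\<Psi> (cmap c x) t)) = \<Psi> (cmap c x) t"
      using chart(7,8)[OF c(1)] sol(1)[OF t] by auto
    then show "\<phi> t x \<in> navigation_domain A h W"
      using navigation_domain_iff[OF c(1)] sol(2)[OF t] r0(2) by (auto simp: \<phi>_def)
    show "((\<lambda>s. cmap d (\<phi> s x)) has_vector_derivative W (\<phi> t x) d) (at t)"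
      if "d \<in> A" "\<phi> t x \<in> cdom d" for d
      using int t that unfolding W_integral_def by blast
  qed
  ultimately show ?thesis using that e by blast
qed

end

section \<open>Zermelo navigation with a homothety\<close>

context homothetic_manifold begin

lemma navigation_domain_subset: "navigation_domain A h W \<subseteq> carrier A"
  by (auto simp: navigation_domain_def)

lemma is_flow_subset: "is_flow A W T U N \<phi> \<Longrightarrow> T' \<subseteq> T \<Longrightarrow> is_flow A W T' U N \<phi>"
  unfolding is_flow_def by (meson continuous_on_subset subsetD)

text \<open>
  Uniqueness of integral curves, once the trajectory $g$ is delayed so that both meet at the same time.
\<close>

lemma flow_eq_W_integral:
  assumes flow: "is_flow A W {-e<..<e} U (navigation_domain A h W) \<phi>" and x: "x \<in> U"
    and g: "W_integral g {-\<eta><..<\<eta>}"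
    and s1: "s1 \<in> {-e<..<e}" "k \<in> {-\<eta><..<\<eta>}" "\<phi> s1 x = g k"
    and s2: "s2 \<in> {-e<..<e}" "k + (s2 - s1) \<in> {-\<eta><..<\<eta>}"
  shows "\<phi> s2 x = g (k + (s2 - s1))"
proof -
  (* the common domain of the given flow and of the trajectory g, delayed so that they meet at time s1 *)
  let ?d = "s1 - k"
  let ?T = "{max (-e) (-\<eta> + ?d)<..<min e (\<eta> + ?d)}"
  have 1: "W_integral (\<lambda>s. \<phi> s x) ?T"
    by (rule W_integral_subset[OF is_flow_W_integral[OF flow navigation_domain_subset x]]) auto
  have 2: "W_integral (\<lambda>s. g (s - ?d)) ?T"
    by (rule W_integral_subset[OF W_integral_shift[OF g]]) auto
  have "\<phi> s2 x = g (s2 - ?d)"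
    by (rule W_integral_unique[OF _ _ 1 2, of s1]) (use s1 s2 in auto)
  then show ?thesis by (simp add: algebra_simps)
qed

lemma continuous_open_neighbourhood:
  fixes f :: "real \<Rightarrow> 'm"
  assumes "isCont f t" "open U" "f t \<in> U"
  obtains J where "open J" "t \<in> J" "\<And>s. s \<in> J \<Longrightarrow> f s \<in> U"
proof -
  have "\<forall>\<^sub>F s in at t. f s \<in> U" using assms unfolding isCont_def by (intro topological_tendstoD)
  then have "\<forall>\<^sub>F s in nhds t. f s \<in> U" using assms(3) by (simp add: eventually_nhds_conv_at)
  then show ?thesis using that unfolding eventually_nhds by blast
qed

lemma open_interval_around_0:
  fixes J :: "real set"
  assumes "open J" "0 \<in> J" obtains d where "d > 0" "{-d<..<d} \<subseteq> J"
proof -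
  obtain d where "d > 0" "ball 0 d \<subseteq> J" using assms open_contains_ball by blast
  moreover have "{-d<..<d} = ball 0 d" by (auto simp: dist_real_def)
  ultimately show ?thesis using that by metis
qed

text \<open>
  Moving $P(t)$ for the time $-t$ along $W$ removes the lift from the drift.
\<close>

lemma randers_geodesic_factorization:
  assumes "e > 0" and P: "unit_speed_finsler_geodesic A (navigation_domain A h W) (randers h W) {-e<..<e} P"
  shows "\<exists>e'. 0 < e' \<and> e' \<le> e \<and> (\<exists>\<rho> U \<phi>.
           geodesic A h {-e'<..<e'} \<rho> \<and>
           (\<forall>t\<in>{-e'<..<e'}. (hnorm h (\<rho> t) (velocity A \<rho> t))\<^sup>2 = exp (- \<sigma> * t)) \<and>
           open U \<and> (\<forall>t\<in>{-e'<..<e'}. \<rho> t \<in> U) \<and>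
           is_flow A W {-e'<..<e'} U (navigation_domain A h W) \<phi> \<and>
           (\<forall>t\<in>{-e'<..<e'}. P t = \<phi> t (\<rho> t)))"
proof -
  have 0: "0 \<in> {-e<..<e}" using \<open>e > 0\<close> by simp
  have P0: "P 0 \<in> navigation_domain A h W" using P 0 by (auto simp: unit_speed_finsler_geodesic_def)
  then obtain c where c: "c \<in> A" "P 0 \<in> cdom c" by (auto simp: navigation_domain_def carrier_def)
  have germP: "drift_germ c 1 (\<lambda>_. 1) P 0"
    by (rule germ_of_randers_geodesic[OF P _ 0 c]) simp
  obtain r \<eta> where r: "r > 0" "\<eta> > 0" and tr: "\<And>k E f t0 \<beta>0 \<beta>. \<lbrakk>drift_germ c k E f t0; E t0 \<le> 1; cmap c (f t0) \<in> ball (cmap c (P 0)) r; \<bar>\<beta>0\<bar> < \<eta>\<rbrakk> \<Longrightarrow>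
      \<exists>J g. open J \<and> t0 \<in> J \<and>
        (\<forall>t\<in>J. \<bar>\<beta>0 + \<beta> * (t - t0)\<bar> < \<eta> \<and> g t 0 = f t \<and> W_integral (g t) {-\<eta><..<\<eta>}) \<and>
        drift_germ c (k + \<beta>) (\<lambda>t. exp (\<sigma> * (\<beta>0 + \<beta> * (t - t0))) * E t) (\<lambda>t. g t (\<beta>0 + \<beta> * (t - t0))) t0"
    using germ_transport[OF c(1) chart(6)[OF c], of 1] by blast
  obtain J g where J: "open J" "0 \<in> J"
    and g: "\<forall>t\<in>J. \<bar>0 + (-1) * (t - 0)\<bar> < \<eta> \<and> g t 0 = P t \<and> W_integral (g t) {-\<eta><..<\<eta>}"
    and drift_germ: "drift_germ c (1 + (-1)) (\<lambda>t. exp (\<sigma> * (0 + (-1) * (t - 0))) * 1) (\<lambda>t. g t (0 + (-1) * (t - 0))) 0"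
    using tr[of 1 "\<lambda>_. 1" P 0 0 "-1", OF germP] r by auto
  define \<rho> where "\<rho> t = g t (- t)" for t
  have drift_germ\<rho>: "drift_germ c 0 (\<lambda>t. exp (- \<sigma> * t)) \<rho> 0"
    using drift_germ by (simp add: \<rho>_def[abs_def])
  obtain J1 where J1: "open J1" "0 \<in> J1" "\<And>t. t \<in> J1 \<Longrightarrow> drift_germ c 0 (\<lambda>t. exp (- \<sigma> * t)) \<rho> t"
    using germ_near[OF drift_germ\<rho>] by blast
  obtain e0 U \<phi> where e0: "e0 > 0" and U: "open U" "P 0 \<in> U"
    and flow: "is_flow A W {-e0<..<e0} U (navigation_domain A h W) \<phi>"
    using flow_exists[OF P0] by blast
  have "\<rho> 0 = P 0" using bspec[OF g J(2)] by (simp add: \<rho>_def)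
  then obtain J2 where J2: "open J2" "0 \<in> J2" "\<And>t. t \<in> J2 \<Longrightarrow> \<rho> t \<in> U"
    using continuous_open_neighbourhood[OF germ_isCont[OF c(1) drift_germ\<rho>] U(1)] U(2) by metis
  have "open (J \<inter> J1 \<inter> J2)" "0 \<in> J \<inter> J1 \<inter> J2" using J J1 J2 by auto
  then obtain d where d: "d > 0" "{-d<..<d} \<subseteq> J \<inter> J1 \<inter> J2" by (rule open_interval_around_0)
  define e' where "e' = min e (min e0 d)"
  let ?I = "{-e'<..<e'}"
  have I: "t \<in> J" "t \<in> J1" "t \<in> J2" "t \<in> {-e0<..<e0}" if "t \<in> ?I" for t
    using that d(2) by (auto simp: e'_def)
  have e': "0 < e'" "e' \<le> e" using \<open>e > 0\<close> e0 d(1) by (auto simp: e'_def)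
  have geo: "\<exists>c\<in>A. drift_germ c 0 (\<lambda>t. exp (- \<sigma> * t)) \<rho> t" if "t \<in> ?I" for t
    using J1(3) I(2)[OF that] c(1) by blast
  have P_eq: "P t = \<phi> t (\<rho> t)" if t: "t \<in> ?I" for t
  proof -
    note gt = bspec[OF g I(1)[OF t]]
    have x: "\<rho> t \<in> U" using J2(3) I(3)[OF t] .
    have \<phi>0: "\<phi> 0 (\<rho> t) = g t (- t)" using flow x by (simp add: is_flow_def \<rho>_def)
    have "\<phi> t (\<rho> t) = g t (- t + (t - 0))"
      by (rule flow_eq_W_integral[OF flow x, where g = "g t" and k = "- t" and ?s1.0 = 0 and \<eta> = \<eta>])
        (use gt \<phi>0 I(4)[OF t] e0 r in auto)
    then show ?thesis using gt by simp
  qed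
  have "is_flow A W ?I U (navigation_domain A h W) \<phi>"
    by (rule is_flow_subset[OF flow]) (use I(4) in blast)
  then show ?thesis
    by (intro exI[of _ e'] exI[of _ \<rho>] exI[of _ U] exI[of _ \<phi>] conjI ballI e' U(1)
        geodesic_of_germs[OF open_greaterThanLessThan geo] J2(3)[OF I(3)] P_eq)
qed

text \<open>
  The maps $\varphi(s, \cdot)$ are homotheties and so preserve geodesics. As $\varphi$ is given only
  through its trajectories, the claim is carried from $s = 0$ along the connected time interval, in
  steps that stay in one chart; each step moves the curve along $W$ for a constant time.
\<close>

lemma flow_of_geodesic_is_geodesic:
  assumes geo: "geodesic A h {-e<..<e} \<rho>"
    and speed: "\<And>t. t \<in> {-e<..<e} \<Longrightarrow> (hnorm h (\<rho> t) (velocity A \<rho> t))\<^sup>2 = exp (- \<sigma> * t)"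
    and \<rho>U: "\<And>t. t \<in> {-e<..<e} \<Longrightarrow> \<rho> t \<in> U"
    and flow: "is_flow A W {-e<..<e} U (navigation_domain A h W) \<phi>"
    and t0: "t0 \<in> {-e<..<e}" and s: "s \<in> {-e<..<e}"
  shows "\<exists>c\<in>A. drift_germ c 0 (\<lambda>t. exp (\<sigma> * (s - t))) (\<lambda>t. \<phi> s (\<rho> t)) t0"
proof (rule connected_induction_simple[of "{-e<..<e}" 0 s])
  show "connected {-e<..<e}" "s \<in> {-e<..<e}" using s by auto
  show 0: "0 \<in> {-e<..<e}" using t0 by auto
  have sub: "\<rho> ` {-e<..<e} \<subseteq> carrier A" using geo by (simp add: geodesic_def C2_curve_def)
  then have "\<rho> t0 \<in> carrier A" using t0 by blast
  then obtain c where c: "c \<in> A" "\<rho> t0 \<in> cdom c" by (auto simp: carrier_def)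
  have "drift_germ c 0 (\<lambda>t. exp (\<sigma> * (0 - t))) (\<lambda>t. \<phi> 0 (\<rho> t)) t0"
    by (rule germ_cong[OF germ_of_geodesic[OF geo open_greaterThanLessThan speed t0 c] open_greaterThanLessThan t0])
      (use flow \<rho>U in \<open>auto simp: is_flow_def\<close>)
  then show "\<exists>c\<in>A. drift_germ c 0 (\<lambda>t. exp (\<sigma> * (0 - t))) (\<lambda>t. \<phi> 0 (\<rho> t)) t0" using c by blast
  fix a assume a: "a \<in> {-e<..<e}"
  have x0: "\<rho> t0 \<in> U" using \<rho>U t0 by blast
  have "\<phi> a (\<rho> t0) \<in> carrier A"
    using flow x0 a navigation_domain_subset by (auto simp: is_flow_def)
  then obtain c where c: "c \<in> A" "\<phi> a (\<rho> t0) \<in> cdom c" by (auto simp: carrier_def)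
  (* ?E bounds the energy exp (\<sigma> * (s - t0)) of all curves that occur, so that the step size does not depend on s *)
  let ?q0 = "cmap c (\<phi> a (\<rho> t0))" and ?E = "exp (\<bar>\<sigma>\<bar> * (2 * e))"
  obtain r \<eta> where r: "r > 0" "\<eta> > 0" and tr: "\<And>k E f t0 \<beta>0 \<beta>. \<lbrakk>drift_germ c k E f t0; E t0 \<le> ?E; cmap c (f t0) \<in> ball ?q0 r; \<bar>\<beta>0\<bar> < \<eta>\<rbrakk> \<Longrightarrow>
      \<exists>J g. open J \<and> t0 \<in> J \<and>
        (\<forall>t\<in>J. \<bar>\<beta>0 + \<beta> * (t - t0)\<bar> < \<eta> \<and> g t 0 = f t \<and> W_integral (g t) {-\<eta><..<\<eta>}) \<and>
        drift_germ c (k + \<beta>) (\<lambda>t. exp (\<sigma> * (\<beta>0 + \<beta> * (t - t0))) * E t) (\<lambda>t. g t (\<beta>0 + \<beta> * (t - t0))) t0"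
    using germ_transport[OF c(1) chart(6)[OF c], of ?E] by blast
  define N where "N = ({-e<..<e} \<inter> (\<lambda>s. \<phi> s (\<rho> t0)) -` (cdom c \<inter> cmap c -` ball ?q0 r)) \<inter> ball a (\<eta> / 2)"
  have "continuous_on {-e<..<e} (\<lambda>s. \<phi> s (\<rho> t0))" using flow x0 by (auto simp: is_flow_def)
  then have "open N"
    unfolding N_def by (intro open_Int continuous_open_preimage chart c) auto
  then have "openin (top_of_set {-e<..<e}) N" by (intro open_subset) (auto simp: N_def)
  moreover have "a \<in> N" using a c r by (auto simp: N_def)
  moreover have "\<exists>c\<in>A. drift_germ c 0 (\<lambda>t. exp (\<sigma> * (s2 - t))) (\<lambda>t. \<phi> s2 (\<rho> t)) t0"
    if s12: "s1 \<in> N" "s2 \<in> N" and G: "\<exists>c\<in>A. drift_germ c 0 (\<lambda>t. exp (\<sigma> * (s1 - t))) (\<lambda>t. \<phi> s1 (\<rho> t)) t0" for s1 s2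
  proof -
    have s1: "s1 \<in> {-e<..<e}" "\<phi> s1 (\<rho> t0) \<in> cdom c" "cmap c (\<phi> s1 (\<rho> t0)) \<in> ball ?q0 r" and s2: "s2 \<in> {-e<..<e}"
      using s12 by (auto simp: N_def)
    have "\<bar>a - s1\<bar> < \<eta> / 2" "\<bar>a - s2\<bar> < \<eta> / 2" using s12 by (auto simp: N_def dist_real_def)
    then have s12': "\<bar>s2 - s1\<bar> < \<eta>" by linarith
    obtain c1 where c1: "c1 \<in> A" "drift_germ c1 0 (\<lambda>t. exp (\<sigma> * (s1 - t))) (\<lambda>t. \<phi> s1 (\<rho> t)) t0"
      using G by blast
    have g1: "drift_germ c 0 (\<lambda>t. exp (\<sigma> * (s1 - t))) (\<lambda>t. \<phi> s1 (\<rho> t)) t0"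
      by (rule geodesic_germ_chart_change[OF c1(1) c(1) c1(2)]) (rule s1(2))
    have "\<sigma> * (s1 - t0) \<le> \<bar>\<sigma>\<bar> * \<bar>s1 - t0\<bar>" by (metis abs_ge_self abs_mult)
    also have "\<dots> \<le> \<bar>\<sigma>\<bar> * (2 * e)" using s1 t0 by (intro mult_left_mono) auto
    finally have E: "exp (\<sigma> * (s1 - t0)) \<le> ?E" by simp
    obtain J g where J: "open J" "t0 \<in> J"
      and g: "\<forall>t\<in>J. \<bar>s2 - s1 + 0 * (t - t0)\<bar> < \<eta> \<and> g t 0 = \<phi> s1 (\<rho> t) \<and> W_integral (g t) {-\<eta><..<\<eta>}"
      and drift_germ: "drift_germ c (0 + 0) (\<lambda>t. exp (\<sigma> * (s2 - s1 + 0 * (t - t0))) * exp (\<sigma> * (s1 - t)))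
          (\<lambda>t. g t (s2 - s1 + 0 * (t - t0))) t0"
      using tr[OF g1 E s1(3) s12', of 0] by blast
    have "drift_germ c (0 + 0) (\<lambda>t. exp (\<sigma> * (s2 - t))) (\<lambda>t. \<phi> s2 (\<rho> t)) t0"
    proof (rule germ_cong[OF drift_germ, of "J \<inter> {-e<..<e}"])
      fix t assume t: "t \<in> J \<inter> {-e<..<e}"
      then have gt: "g t 0 = \<phi> s1 (\<rho> t)" "W_integral (g t) {-\<eta><..<\<eta>}" and x: "\<rho> t \<in> U" using g \<rho>U by blast+
      have "\<phi> s2 (\<rho> t) = g t (0 + (s2 - s1))"
        by (rule flow_eq_W_integral[OF flow x gt(2) s1(1) _ gt(1)[symmetric] s2]) (use s12' r in auto)
      then show "g t (s2 - s1 + 0 * (t - t0)) = \<phi> s2 (\<rho> t) \<and>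
          exp (\<sigma> * (s2 - s1 + 0 * (t - t0))) * exp (\<sigma> * (s1 - t)) = exp (\<sigma> * (s2 - t))"
        by (simp add: algebra_simps flip: exp_add)
    qed (use J t0 in auto)
    then show ?thesis using c(1) by auto
  qed
  ultimately show "\<exists>N. openin (top_of_set {-e<..<e}) N \<and> a \<in> N \<and> (\<forall>s1\<in>N. \<forall>s2\<in>N.
      (\<exists>c\<in>A. drift_germ c 0 (\<lambda>t. exp (\<sigma> * (s1 - t))) (\<lambda>t. \<phi> s1 (\<rho> t)) t0) \<longrightarrow>
      (\<exists>c\<in>A. drift_germ c 0 (\<lambda>t. exp (\<sigma> * (s2 - t))) (\<lambda>t. \<phi> s2 (\<rho> t)) t0))"
    by blast
qed

text \<open>
  Near $t_0$ the curve $t \mapsto \varphi(t, \rho(t))$ arises from the geodesic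
  $t \mapsto \varphi(t_0, \rho(t))$ by moving along $W$ for the time $t - t_0$, so one local step with $\beta = 1$
  suffices.
\<close>

lemma flow_composed_with_geodesic:
  assumes geo: "geodesic A h {-e<..<e} \<rho>"
    and speed: "\<And>t. t \<in> {-e<..<e} \<Longrightarrow> (hnorm h (\<rho> t) (velocity A \<rho> t))\<^sup>2 = exp (- \<sigma> * t)"
    and \<rho>U: "\<And>t. t \<in> {-e<..<e} \<Longrightarrow> \<rho> t \<in> U"
    and flow: "is_flow A W {-e<..<e} U (navigation_domain A h W) \<phi>"
  shows "unit_speed_finsler_geodesic A (navigation_domain A h W) (randers h W) {-e<..<e} (\<lambda>t. \<phi> t (\<rho> t))"
proof (rule randers_geodesic_of_germs[OF open_greaterThanLessThan])
  show "(\<lambda>t. \<phi> t (\<rho> t)) ` {-e<..<e} \<subseteq> navigation_domain A h W"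
    using flow \<rho>U by (auto simp: is_flow_def)
  fix t0 c assume t0: "t0 \<in> {-e<..<e}" and c: "c \<in> A" "\<phi> t0 (\<rho> t0) \<in> cdom c"
  obtain c0 where c0: "c0 \<in> A" "drift_germ c0 0 (\<lambda>t. exp (\<sigma> * (t0 - t))) (\<lambda>t. \<phi> t0 (\<rho> t)) t0"
    using flow_of_geodesic_is_geodesic[OF geo speed \<rho>U flow t0 t0] by blast
  have g0: "drift_germ c 0 (\<lambda>t. exp (\<sigma> * (t0 - t))) (\<lambda>t. \<phi> t0 (\<rho> t)) t0"
    by (rule geodesic_germ_chart_change[OF c0(1) c(1) c0(2)]) (rule c(2))
  obtain r \<eta> where r: "r > 0" "\<eta> > 0" and tr: "\<And>k E f t1 \<beta>0 \<beta>. \<lbrakk>drift_germ c k E f t1; E t1 \<le> 1; cmap c (f t1) \<in> ball (cmap c (\<phi> t0 (\<rho> t0))) r; \<bar>\<beta>0\<bar> < \<eta>\<rbrakk> \<Longrightarrow>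
      \<exists>J g. open J \<and> t1 \<in> J \<and>
        (\<forall>t\<in>J. \<bar>\<beta>0 + \<beta> * (t - t1)\<bar> < \<eta> \<and> g t 0 = f t \<and> W_integral (g t) {-\<eta><..<\<eta>}) \<and>
        drift_germ c (k + \<beta>) (\<lambda>t. exp (\<sigma> * (\<beta>0 + \<beta> * (t - t1))) * E t) (\<lambda>t. g t (\<beta>0 + \<beta> * (t - t1))) t1"
    using germ_transport[OF c(1) chart(6)[OF c], of 1] by blast
  have "\<exists>J g. open J \<and> t0 \<in> J \<and>
        (\<forall>t\<in>J. \<bar>0 + 1 * (t - t0)\<bar> < \<eta> \<and> g t 0 = \<phi> t0 (\<rho> t) \<and> W_integral (g t) {-\<eta><..<\<eta>}) \<and>
        drift_germ c (0 + 1) (\<lambda>t. exp (\<sigma> * (0 + 1 * (t - t0))) * exp (\<sigma> * (t0 - t))) (\<lambda>t. g t (0 + 1 * (t - t0))) t0"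
    by (rule tr[OF g0]) (use r in auto)
  then obtain J g where J: "open J" "t0 \<in> J"
    and g: "\<forall>t\<in>J. \<bar>0 + 1 * (t - t0)\<bar> < \<eta> \<and> g t 0 = \<phi> t0 (\<rho> t) \<and> W_integral (g t) {-\<eta><..<\<eta>}"
    and drift_germ: "drift_germ c (0 + 1) (\<lambda>t. exp (\<sigma> * (0 + 1 * (t - t0))) * exp (\<sigma> * (t0 - t))) (\<lambda>t. g t (0 + 1 * (t - t0))) t0"
    by (elim exE conjE)
  have "drift_germ c (0 + 1) (\<lambda>_. 1) (\<lambda>t. \<phi> t (\<rho> t)) t0"
  proof (rule germ_cong[OF drift_germ, of "J \<inter> {-e<..<e}"])
    fix t assume t: "t \<in> J \<inter> {-e<..<e}"
    then have gt: "\<bar>0 + 1 * (t - t0)\<bar> < \<eta>" "g t 0 = \<phi> t0 (\<rho> t)" "W_integral (g t) {-\<eta><..<\<eta>}"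
      and x: "\<rho> t \<in> U" and te: "t \<in> {-e<..<e}" using g \<rho>U by blast+
    have "\<phi> t (\<rho> t) = g t (0 + (t - t0))"
      by (rule flow_eq_W_integral[OF flow x gt(3) t0 _ gt(2)[symmetric] te]) (use gt(1) r in auto)
    then show "g t (0 + 1 * (t - t0)) = \<phi> t (\<rho> t) \<and> exp (\<sigma> * (0 + 1 * (t - t0))) * exp (\<sigma> * (t0 - t)) = 1"
      by (simp add: algebra_simps flip: exp_add)
  qed (use J t0 in auto)
  then show "drift_germ c 1 (\<lambda>_. 1) (\<lambda>t. \<phi> t (\<rho> t)) t0" by simp
qed

lemma flow_near_geodesic:
  assumes "e > 0" and geo: "geodesic A h {-e<..<e} \<rho>" and \<rho>0: "\<rho> 0 \<in> navigation_domain A h W"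
  shows "\<exists>e' U \<phi>. 0 < e' \<and> e' \<le> e \<and> open U \<and> (\<forall>t\<in>{-e'<..<e'}. \<rho> t \<in> U) \<and>
           is_flow A W {-e'<..<e'} U (navigation_domain A h W) \<phi>"
proof -
  obtain e0 U \<phi> where e0: "e0 > 0" and U: "open U" "\<rho> 0 \<in> U"
    and flow: "is_flow A W {-e0<..<e0} U (navigation_domain A h W) \<phi>"
    using flow_exists[OF \<rho>0] by blast
  have "continuous_on {-e<..<e} \<rho>" using geo by (simp add: geodesic_def C2_curve_def)
  then have "isCont \<rho> 0"
    using \<open>e > 0\<close> by (simp add: continuous_on_eq_continuous_at)
  then obtain J where J: "open J" "0 \<in> J" "\<And>s. s \<in> J \<Longrightarrow> \<rho> s \<in> U"
    using continuous_open_neighbourhood U by metis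
  then obtain d where d: "d > 0" "{-d<..<d} \<subseteq> J" using open_interval_around_0 by metis
  define e' where "e' = min e (min e0 d)"
  have "is_flow A W {-e'<..<e'} U (navigation_domain A h W) \<phi>"
    by (rule is_flow_subset[OF flow]) (auto simp: e'_def)
  moreover have "\<rho> t \<in> U" if "t \<in> {-e'<..<e'}" for t
  proof -
    have "t \<in> {-d<..<d}" using that by (auto simp: e'_def)
    then show ?thesis using J(3) d(2) by blast
  qed
  ultimately show ?thesis
    using \<open>e > 0\<close> e0 d(1) U(1) by (intro exI[of _ e'] exI[of _ U] exI[of _ \<phi>]) (auto simp: e'_def)
qed

end

theorem theorem2:
  fixes A :: "('m::{t2_space, second_countable_topology}, 'n::finite) chart set"
    and h :: "('m, 'n) metric"
    and W :: "'m \<Rightarrow> ('m, 'n) tangent"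
    and \<sigma> :: real
    and F :: "('m, 'n) finsler"
    and M :: "'m set"
  assumes manifold: "smooth_atlas A"
    and metric: "riemannian_metric A h"
    and homothety: "infinitesimal_homothety A h W \<sigma>"
    and F_def: "F = randers h W"
    and M_def: "M = navigation_domain A h W"
  shows
    \<comment> \<open>every unit speed geodesic of F is, after shrinking, of the stated form\<close>
    "(\<forall>e>0. \<forall>P. unit_speed_finsler_geodesic A M F {-e<..<e} P \<longrightarrow>
        (\<exists>e'. 0 < e' \<and> e' \<le> e \<and> (\<exists>\<rho> U \<phi>.
           geodesic A h {-e'<..<e'} \<rho> \<and>
           (\<forall>t\<in>{-e'<..<e'}. (hnorm h (\<rho> t) (velocity A \<rho> t))\<^sup>2 = exp (- \<sigma> * t)) \<and>
           open U \<and> (\<forall>t\<in>{-e'<..<e'}. \<rho> t \<in> U) \<and>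
           is_flow A W {-e'<..<e'} U M \<phi> \<and>
           (\<forall>t\<in>{-e'<..<e'}. P t = \<phi> t (\<rho> t)))))
   \<and>
    \<comment> \<open>every curve of the stated form is a unit speed geodesic of F\<close>
     (\<forall>e>0. \<forall>\<rho> U \<phi>.
        geodesic A h {-e<..<e} \<rho> \<and>
        (\<forall>t\<in>{-e<..<e}. (hnorm h (\<rho> t) (velocity A \<rho> t))\<^sup>2 = exp (- \<sigma> * t)) \<and>
        open U \<and> (\<forall>t\<in>{-e<..<e}. \<rho> t \<in> U) \<and>
        is_flow A W {-e<..<e} U M \<phi> \<longrightarrow>
        unit_speed_finsler_geodesic A M F {-e<..<e} (\<lambda>t. \<phi> t (\<rho> t)))
   \<and>
    \<comment> \<open>the flow needed to form such a curve exists after shrinking\<close>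
     (\<forall>e>0. \<forall>\<rho>.
        geodesic A h {-e<..<e} \<rho> \<and>
        (\<forall>t\<in>{-e<..<e}. (hnorm h (\<rho> t) (velocity A \<rho> t))\<^sup>2 = exp (- \<sigma> * t)) \<and>
        \<rho> 0 \<in> M \<longrightarrow>
        (\<exists>e' U \<phi>. 0 < e' \<and> e' \<le> e \<and> open U \<and> (\<forall>t\<in>{-e'<..<e'}. \<rho> t \<in> U) \<and>
           is_flow A W {-e'<..<e'} U M \<phi>))"
proof -
  interpret homothetic_manifold A h W \<sigma>
    by unfold_locales (fact manifold metric homothety)+
  show ?thesis
    unfolding F_def M_def
  proof (intro conjI allI impI)
    fix e :: real and P
    assume "0 < e" "unit_speed_finsler_geodesic A (navigation_domain A h W) (randers h W) {-e<..<e} P"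
    then show "\<exists>e'. 0 < e' \<and> e' \<le> e \<and> (\<exists>\<rho> U \<phi>.
           geodesic A h {-e'<..<e'} \<rho> \<and>
           (\<forall>t\<in>{-e'<..<e'}. (hnorm h (\<rho> t) (velocity A \<rho> t))\<^sup>2 = exp (- \<sigma> * t)) \<and>
           open U \<and> (\<forall>t\<in>{-e'<..<e'}. \<rho> t \<in> U) \<and>
           is_flow A W {-e'<..<e'} U (navigation_domain A h W) \<phi> \<and>
           (\<forall>t\<in>{-e'<..<e'}. P t = \<phi> t (\<rho> t)))"
      by (rule randers_geodesic_factorization)
  next
    fix e :: real and \<rho> U \<phi>
    assume "geodesic A h {-e<..<e} \<rho> \<and>
        (\<forall>t\<in>{-e<..<e}. (hnorm h (\<rho> t) (velocity A \<rho> t))\<^sup>2 = exp (- \<sigma> * t)) \<and>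
        open U \<and> (\<forall>t\<in>{-e<..<e}. \<rho> t \<in> U) \<and>
        is_flow A W {-e<..<e} U (navigation_domain A h W) \<phi>"
    then show "unit_speed_finsler_geodesic A (navigation_domain A h W) (randers h W) {-e<..<e} (\<lambda>t. \<phi> t (\<rho> t))"
      by (elim conjE, intro flow_composed_with_geodesic[where U = U]) auto
  next
    fix e :: real and \<rho>
    assume "0 < e" "geodesic A h {-e<..<e} \<rho> \<and>
        (\<forall>t\<in>{-e<..<e}. (hnorm h (\<rho> t) (velocity A \<rho> t))\<^sup>2 = exp (- \<sigma> * t)) \<and>
        \<rho> 0 \<in> navigation_domain A h W"
    then show "\<exists>e' U \<phi>. 0 < e' \<and> e' \<le> e \<and> open U \<and> (\<forall>t\<in>{-e'<..<e'}. \<rho> t \<in> U) \<and>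
           is_flow A W {-e'<..<e'} U (navigation_domain A h W) \<phi>"
      by (intro flow_near_geodesic) auto
  qed
qed

end
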